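(* Let $\mathbf v=(v_1,\dots,v_{n_e})$ be the weak solution of the fixed-boundary problem (P) of the context, and let $\mathbf V=(V_1,\dots,V_{n_e})$ be the solution of the semidiscrete problem: $\mathbf V(\cdot,t)\in (S_h^k)^{n_e}$ for $t\ge 0$ and, for all $\mathbf W=(W_1,\dots,W_{n_e})\in (S_h^k)^{n_e}$, all $t\in]0,T[$ and all $i=1,\dots,n_e$, $$\left(\frac{\partial V_i}{\partial t},W_i\right)+a_i\big(l(V_1),\dots,l(V_{n_e})\big)\,b_2\left(\frac{\partial V_i}{\partial y},\frac{\partial W_i}{\partial y}\right)-\left(b_1\frac{\partial V_i}{\partial y},W_i\right)=(g_i,W_i),\qquad V_i(y,0)=I_hv_{i0}.$$ Then $$\|V_i-v_i\|\le C h^{k+1},\qquad t\in]0,T],\quad i=1,\dots,n_e,$$ where $C$ may depend on $\sum_{i=1}^{n_e}\|v_{i0}\|_{H^{k+1}}$, $\sum_{i=1}^{n_e}\|v_i\|_{L_\infty(0,T;H^{k+1}(\Omega))}$, $\sum_{i=1}^{n_e}\left\|\frac{\partial v_i}{\partial y}\right\|_{L_\infty(0,T;L_2(\Omega))}$, $\sum_{i=1}^{n_e}\|v_i\|_{L_2(0,T;H^{k+1}(\Omega))}$ and $\sum_{i=1}^{n_e}\left\|\frac{\partial v_i}{\partial t}\right\|_{L_2(0,T;H^{k+1}(\Omega))}$ (all assumed finite), but does not depend on $h$, $k$ or $i$.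
   Context: Let $n_e\ge1$ be an integer and $T>0$. Let $\alpha,\beta\in\mathcal C^2([0,T])$ with $\alpha',\beta'\in L_2(]0,T[)$, put $\gamma=\beta-\alpha$, and assume $0<\gamma_0<\gamma(t)<\gamma_1<\infty$, $|\gamma'(t)|\le\gamma'_{\max}$ and $|\alpha'(t)|\le\alpha'_{\max}$ for all $t\in[0,T]$. Put $\Omega_t=]\alpha(t),\beta(t)[$ and $\Omega=]0,1[$. For $i=1,\dots,n_e$: $u_{i0}\in H_0^1(\Omega_0)$; $f_i$ satisfies $\int_0^T\int_{\Omega_t}f_i^2\,dx\,dt<\infty$; $a_i:\mathbb R^{n_e}\to\mathbb R^+$ is Lipschitz-continuous with $0<m_a\le a_i(s)\le M_a$ for all $s\in\mathbb R^{n_e}$. Notation: $b_1(y,t)=\dfrac{\alpha'(t)+\gamma'(t)y}{\gamma(t)}$, $b_2(t)=\dfrac1{\gamma(t)^2}$, $g_i(y,t)=f_i(\alpha(t)+\gamma(t)y,t)$, $v_{i0}(y)=u_{i0}(\alpha(0)+\gamma(0)y)$, $l(w)(t)=\gamma(t)\int_0^1w(y,t)\,dy$. Problem (P): for $i=1,\dots,n_e$, $$\frac{\partial v_i}{\partial t}-a_i(l(v_1),\dots,l(v_{n_e}))\,b_2(t)\frac{\partial^2v_i}{\partial y^2}-b_1(y,t)\frac{\partial v_i}{\partial y}=g_i\ \text{ in }\ ]0,1[\times]0,T[,\quad v_i(0,t)=v_i(1,t)=0,\quad v_i(y,0)=v_{i0}(y).$$ A weak solution is $\mathbf v=(v_1,\dots,v_{n_e})$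 with $v_i\in L_\infty(0,T;H_0^1(\Omega)\cap H^2(\Omega))$, $\frac{\partial v_i}{\partial t}\in L_2(0,T;L_2(\Omega))$, $v_i(\cdot,0)=v_{i0}$, and, for all $w_i\in H_0^1(\Omega)$ and $t\in]0,T[$, $$\int_0^1\frac{\partial v_i}{\partial t}w_i\,dy+a_i(l(v_1),\dots,l(v_{n_e}))b_2\int_0^1\frac{\partial v_i}{\partial y}\frac{\partial w_i}{\partial y}dy-\int_0^1b_1\frac{\partial v_i}{\partial y}w_i\,dy=\int_0^1g_iw_i\,dy.$$ $\|\cdot\|$ and $(\cdot,\cdot)$ are the norm and inner product of $L_2(\Omega)$, and $\|\cdot\|_{H^m}$ is the norm of $H^m(\Omega)$. $\mathcal T_h$ is a partition of $\Omega$ into disjoint intervals of maximal length $h$; $S_h^k$ ($k\ge1$ an integer) is the space of continuous functions on $[0,1]$ that vanish at $0$ and $1$ and are polynomials of degree $k$ on each interval of $\mathcal T_h$. $I_h$ is the Lagrange interpolation operator onto $S_h^k$: $I_hu=\sum_{j=1}^{n_p}u(P_j)\varphi_j$, with $\{\varphi_j\}$ the Lagrange basis of $S_h^k$ associated to the nodes $\{P_j\}_{j=1}^{n_p}$. The constant $C$ may also depend on the fixed data of the problem ($T$, $n_e$, $\alpha$, $\beta$, the bounds and Lipschitz constants of the $a_i$). *)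

theory Defs
  imports
    "HOL-Analysis.Analysis"
    "HOL-Probability.Essential_Supremum"
    "HOL-Computational_Algebra.Polynomial"
begin

section \<open>Lebesgue and Sobolev spaces\<close>

text \<open>Elements of \<open>L\<^sub>2(S)\<close> and \<open>H\<^sup>m(S)\<close> are represented by functions that may be modified
  on null sets and outside \<open>S\<close>; in what follows \<open>S\<close> is always an open set.\<close>

definition L2 :: "'a::euclidean_space set \<Rightarrow> ('a \<Rightarrow> real) set" where
  "L2 S = {u. u \<in> borel_measurable (lebesgue_on S) \<and> integrable (lebesgue_on S) (\<lambda>x. (u x)\<^sup>2)}"

definition ip :: "real set \<Rightarrow> (real \<Rightarrow> real) \<Rightarrow> (real \<Rightarrow> real) \<Rightarrow> real" where
  "ip S u w = (LINT x|lebesgue_on S. u x * w x)"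

definition L2norm :: "real set \<Rightarrow> (real \<Rightarrow> real) \<Rightarrow> real" where
  "L2norm S u = sqrt (ip S u u)"

definition C1c :: "real set \<Rightarrow> (real \<Rightarrow> real) set" where
  "C1c S = {\<phi>. \<phi> differentiable_on UNIV \<and> continuous_on UNIV (deriv \<phi>) \<and>
               (\<exists>K. compact K \<and> K \<subseteq> S \<and> (\<forall>x. x \<notin> K \<longrightarrow> \<phi> x = 0))}"

text \<open>In one dimension it makes no difference, for weak derivatives and for \<open>H\<^sup>1\<^sub>0\<close>, whether the
  test functions are \<open>C\<^sup>1\<close> or \<open>C\<^sup>\<infinity>\<close> with compact support; we follow Brezis (Functional Analysis,
  Sobolev Spaces and PDE, Chapter 8) and use \<open>C\<^sup>1\<close>.\<close>

definition has_weak_deriv :: "real set \<Rightarrow> (real \<Rightarrow> real) \<Rightarrow> (real \<Rightarrow> real) \<Rightarrow> bool" where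
  "has_weak_deriv S u g \<longleftrightarrow> (\<forall>\<phi>\<in>C1c S. ip S u (deriv \<phi>) = - ip S g \<phi>)"

definition wD :: "real set \<Rightarrow> (real \<Rightarrow> real) \<Rightarrow> (real \<Rightarrow> real)" where
  "wD S u = (SOME g. g \<in> L2 S \<and> has_weak_deriv S u g)"

primrec Hs :: "nat \<Rightarrow> real set \<Rightarrow> (real \<Rightarrow> real) set" where
  "Hs 0 S = L2 S"
| "Hs (Suc m) S = {u \<in> L2 S. \<exists>g \<in> Hs m S. has_weak_deriv S u g}"

definition Hnorm :: "nat \<Rightarrow> real set \<Rightarrow> (real \<Rightarrow> real) \<Rightarrow> real" where
  "Hnorm m S u = sqrt (\<Sum>j\<le>m. (L2norm S ((wD S ^^ j) u))\<^sup>2)"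

definition H10 :: "real set \<Rightarrow> (real \<Rightarrow> real) set" where
  "H10 S = {u \<in> Hs 1 S. \<exists>\<phi>. (\<forall>n. \<phi> n \<in> C1c S) \<and> (\<lambda>n. Hnorm 1 S (\<lambda>x. u x - \<phi> n x)) \<longlonglongrightarrow> 0}"

section \<open>Functions of time with values in a function space\<close>

text \<open>A function \<open>u(y,t)\<close> is represented by the map \<open>u\<close> taking \<open>t\<close> to the function \<open>u(\<cdot>,t)\<close>, so its
  value is \<open>u t y\<close>. Below, \<open>X\<close> is a space of functions and \<open>N\<close> its norm; \<open>strongly_measurable\<close> is
  Bochner measurability.\<close>

definition simple_map :: "real \<Rightarrow> (real \<Rightarrow> real) set \<Rightarrow> (real \<Rightarrow> real \<Rightarrow> real) \<Rightarrow> bool" where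
  "simple_map T X s \<longleftrightarrow> finite (s ` {0<..<T}) \<and> s ` {0<..<T} \<subseteq> X \<and>
     (\<forall>x. {t \<in> {0<..<T}. s t = x} \<in> sets lebesgue)"

definition strongly_measurable ::
  "real \<Rightarrow> (real \<Rightarrow> real) set \<Rightarrow> ((real \<Rightarrow> real) \<Rightarrow> real) \<Rightarrow> (real \<Rightarrow> real \<Rightarrow> real) \<Rightarrow> bool" where
  "strongly_measurable T X N u \<longleftrightarrow>
     (\<exists>s. (\<forall>n. simple_map T X (s n)) \<and>
          (AE t in lebesgue_on {0<..<T}. u t \<in> X \<and> (\<lambda>n. N (\<lambda>y. s n t y - u t y)) \<longlonglongrightarrow> 0))"

definition L2_time ::
  "real \<Rightarrow> (real \<Rightarrow> real) set \<Rightarrow> ((real \<Rightarrow> real) \<Rightarrow> real) \<Rightarrow> (real \<Rightarrow> real \<Rightarrow> real) set" where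
  "L2_time T X N = {u. strongly_measurable T X N u \<and>
                       integrable (lebesgue_on {0<..<T}) (\<lambda>t. (N (u t))\<^sup>2)}"

definition L2_time_norm :: "real \<Rightarrow> ((real \<Rightarrow> real) \<Rightarrow> real) \<Rightarrow> (real \<Rightarrow> real \<Rightarrow> real) \<Rightarrow> real" where
  "L2_time_norm T N u = sqrt (LINT t|lebesgue_on {0<..<T}. (N (u t))\<^sup>2)"

definition Linf_time ::
  "real \<Rightarrow> (real \<Rightarrow> real) set \<Rightarrow> ((real \<Rightarrow> real) \<Rightarrow> real) \<Rightarrow> (real \<Rightarrow> real \<Rightarrow> real) set" where
  "Linf_time T X N = {u. strongly_measurable T X N u \<and>
                         esssup (lebesgue_on {0<..<T}) (\<lambda>t. ereal (N (u t))) < \<infinity>}"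

definition Linf_time_norm :: "real \<Rightarrow> ((real \<Rightarrow> real) \<Rightarrow> real) \<Rightarrow> (real \<Rightarrow> real \<Rightarrow> real) \<Rightarrow> real" where
  "Linf_time_norm T N u = real_of_ereal (esssup (lebesgue_on {0<..<T}) (\<lambda>t. ereal (N (u t))))"

text \<open>The weak derivative in time is characterised by an identity between \<open>L\<^sub>2(S)\<close>-valued Bochner
  integrals; such an identity holds iff it holds after pairing with every \<open>w\<close> in \<open>L\<^sub>2(S)\<close>.\<close>

definition has_weak_time_deriv ::
  "real \<Rightarrow> real set \<Rightarrow> (real \<Rightarrow> real \<Rightarrow> real) \<Rightarrow> (real \<Rightarrow> real \<Rightarrow> real) \<Rightarrow> bool" where
  "has_weak_time_deriv T S u u' \<longleftrightarrow>
     (\<forall>w\<in>L2 S. \<forall>\<phi>\<in>C1c {0<..<T}.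
        (LINT t|lebesgue_on {0<..<T}. ip S (u t) w * deriv \<phi> t) =
        - (LINT t|lebesgue_on {0<..<T}. ip S (u' t) w * \<phi> t))"

definition Dt :: "real \<Rightarrow> real set \<Rightarrow> (real \<Rightarrow> real \<Rightarrow> real) \<Rightarrow> (real \<Rightarrow> real \<Rightarrow> real)" where
  "Dt T S u = (SOME u'. u' \<in> L2_time T (L2 S) (L2norm S) \<and> has_weak_time_deriv T S u u')"

text \<open>Functions with \<open>\<partial>u/\<partial>t\<close> in \<open>L\<^sub>2(0,T;L\<^sub>2(S))\<close>, always taken in their representative in
  \<open>C([0,T];L\<^sub>2(S))\<close>: this is what gives a meaning to \<open>u(\<cdot>,t)\<close> for every \<open>t\<close>, in particular \<open>t = 0\<close>.\<close>

definition H1_time :: "real \<Rightarrow> real set \<Rightarrow> (real \<Rightarrow> real \<Rightarrow> real) set" where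
  "H1_time T S = {u.
     (\<forall>t\<in>{0..T}. u t \<in> L2 S \<and>
        ((\<lambda>s. L2norm S (\<lambda>y. u s y - u t y)) \<longlongrightarrow> 0) (at t within {0..T})) \<and>
     (\<exists>u' \<in> L2_time T (L2 S) (L2norm S). has_weak_time_deriv T S u u')}"

section \<open>The parabolic system\<close>

abbreviation Om :: "real set" where "Om \<equiv> {0<..<1}"

definition b1 :: "(real \<Rightarrow> real) \<Rightarrow> (real \<Rightarrow> real) \<Rightarrow> (real \<Rightarrow> real) \<Rightarrow> real \<Rightarrow> real \<Rightarrow> real" where
  "b1 \<alpha>' \<gamma> \<gamma>' t y = (\<alpha>' t + \<gamma>' t * y) / \<gamma> t"

definition b2 :: "(real \<Rightarrow> real) \<Rightarrow> real \<Rightarrow> real" where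
  "b2 \<gamma> t = 1 / (\<gamma> t)\<^sup>2"

definition l :: "(real \<Rightarrow> real) \<Rightarrow> (real \<Rightarrow> real \<Rightarrow> real) \<Rightarrow> real \<Rightarrow> real" where
  "l \<gamma> w t = \<gamma> t * (LINT y|lebesgue_on Om. w t y)"

definition variational_eq ::
  "real \<Rightarrow> (real \<Rightarrow> real) \<Rightarrow> (real \<Rightarrow> real) \<Rightarrow> (real \<Rightarrow> real) \<Rightarrow> (real \<Rightarrow> real) \<Rightarrow>
   ('n::finite \<Rightarrow> real ^ 'n \<Rightarrow> real) \<Rightarrow> ('n \<Rightarrow> real \<Rightarrow> real \<Rightarrow> real) \<Rightarrow>
   (real \<Rightarrow> real) set \<Rightarrow> ('n \<Rightarrow> real \<Rightarrow> real \<Rightarrow> real) \<Rightarrow> bool" where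
  "variational_eq T \<alpha> \<alpha>' \<gamma> \<gamma>' a f X v \<longleftrightarrow>
     (\<forall>i. \<forall>w\<in>X. AE t in lebesgue_on {0<..<T}.
        ip Om (Dt T Om (v i) t) w
        + a i (\<chi> j. l \<gamma> (v j) t) * b2 \<gamma> t * ip Om (wD Om (v i t)) (wD Om w)
        - ip Om (\<lambda>y. b1 \<alpha>' \<gamma> \<gamma>' t y * wD Om (v i t) y) w
        = ip Om (\<lambda>y. f i t (\<alpha> t + \<gamma> t * y)) w)"

definition weak_solution ::
  "real \<Rightarrow> (real \<Rightarrow> real) \<Rightarrow> (real \<Rightarrow> real) \<Rightarrow> (real \<Rightarrow> real) \<Rightarrow> (real \<Rightarrow> real) \<Rightarrow>
   ('n::finite \<Rightarrow> real ^ 'n \<Rightarrow> real) \<Rightarrow> ('n \<Rightarrow> real \<Rightarrow> real \<Rightarrow> real) \<Rightarrow>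
   ('n \<Rightarrow> real \<Rightarrow> real) \<Rightarrow> ('n \<Rightarrow> real \<Rightarrow> real \<Rightarrow> real) \<Rightarrow> bool" where
  "weak_solution T \<alpha> \<alpha>' \<gamma> \<gamma>' a f v0 v \<longleftrightarrow>
     (\<forall>i. v i \<in> Linf_time T (H10 Om \<inter> Hs 2 Om) (Hnorm 2 Om)) \<and>
     (\<forall>i. v i \<in> H1_time T Om) \<and>
     (\<forall>i. AE y in lebesgue_on Om. v i 0 y = v0 i y) \<and>
     variational_eq T \<alpha> \<alpha>' \<gamma> \<gamma>' a f (H10 Om) v"

section \<open>Finite elements\<close>

text \<open>The elements of the partition are the intervals between consecutive break points
  \<open>0 = x 0 < \<dots> < x n = 1\<close>.\<close>

definition is_partition :: "nat \<Rightarrow> (nat \<Rightarrow> real) \<Rightarrow> bool" where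
  "is_partition n x \<longleftrightarrow> 1 \<le> n \<and> x 0 = 0 \<and> x n = 1 \<and> (\<forall>j<n. x j < x (Suc j))"

definition mesh :: "nat \<Rightarrow> (nat \<Rightarrow> real) \<Rightarrow> real" where
  "mesh n x = Max ((\<lambda>j. x (Suc j) - x j) ` {..<n})"

definition Sh :: "nat \<Rightarrow> nat \<Rightarrow> (nat \<Rightarrow> real) \<Rightarrow> (real \<Rightarrow> real) set" where
  "Sh k n x = {W. continuous_on {0..1} W \<and> W 0 = 0 \<and> W 1 = 0 \<and>
     (\<forall>j<n. \<exists>p :: real poly. degree p \<le> k \<and> (\<forall>y\<in>{x j..x (Suc j)}. W y = poly p y))}"

text \<open>The nodes are the points of \<open>P\<close>. Together with \<open>0\<close> and \<open>1\<close>, where the functions of \<open>S\<^sub>h\<^sup>k\<close> vanish,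
  they put \<open>k + 1\<close> points on each closed element, its end points among them. Their position inside
  the elements is arbitrary.\<close>

definition lagrange_nodes :: "nat \<Rightarrow> nat \<Rightarrow> (nat \<Rightarrow> real) \<Rightarrow> real set \<Rightarrow> bool" where
  "lagrange_nodes k n x P \<longleftrightarrow> finite P \<and> P \<subseteq> {0<..<1} \<and>
     (\<forall>j<n. {x j, x (Suc j)} \<subseteq> P \<union> {0, 1} \<and>
            card ((P \<union> {0, 1}) \<inter> {x j..x (Suc j)}) = k + 1)"

definition lagrange_basis :: "nat \<Rightarrow> nat \<Rightarrow> (nat \<Rightarrow> real) \<Rightarrow> real set \<Rightarrow> real \<Rightarrow> (real \<Rightarrow> real)" where
  "lagrange_basis k n x P p = (SOME \<phi>. \<phi> \<in> Sh k n x \<and> (\<forall>q\<in>P. \<phi> q = (if q = p then 1 else 0)))"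

text \<open>Point values of an element of \<open>H\<^sup>1\<close> are those of its continuous representative.\<close>

definition cont_rep :: "(real \<Rightarrow> real) \<Rightarrow> (real \<Rightarrow> real)" where
  "cont_rep u = (SOME c. continuous_on {0..1} c \<and> (AE y in lebesgue_on Om. c y = u y))"

definition Ih :: "nat \<Rightarrow> nat \<Rightarrow> (nat \<Rightarrow> real) \<Rightarrow> real set \<Rightarrow> (real \<Rightarrow> real) \<Rightarrow> (real \<Rightarrow> real)" where
  "Ih k n x P u = (\<lambda>y. \<Sum>p\<in>P. cont_rep u p * lagrange_basis k n x P p y)"

definition semidiscrete_solution ::
  "real \<Rightarrow> (real \<Rightarrow> real) \<Rightarrow> (real \<Rightarrow> real) \<Rightarrow> (real \<Rightarrow> real) \<Rightarrow> (real \<Rightarrow> real) \<Rightarrow>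
   ('n::finite \<Rightarrow> real ^ 'n \<Rightarrow> real) \<Rightarrow> ('n \<Rightarrow> real \<Rightarrow> real \<Rightarrow> real) \<Rightarrow> ('n \<Rightarrow> real \<Rightarrow> real) \<Rightarrow>
   nat \<Rightarrow> nat \<Rightarrow> (nat \<Rightarrow> real) \<Rightarrow> real set \<Rightarrow> ('n \<Rightarrow> real \<Rightarrow> real \<Rightarrow> real) \<Rightarrow> bool" where
  "semidiscrete_solution T \<alpha> \<alpha>' \<gamma> \<gamma>' a f v0 k n x P V \<longleftrightarrow>
     (\<forall>i. \<forall>t\<in>{0..T}. V i t \<in> Sh k n x) \<and>
     (\<forall>i. V i \<in> H1_time T Om) \<and>
     (\<forall>i. \<forall>y\<in>{0..1}. V i 0 y = Ih k n x P (v0 i) y) \<and>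
     variational_eq T \<alpha> \<alpha>' \<gamma> \<gamma>' a f (Sh k n x) V"

end

theory Submission
  imports Defs
begin

text \<open>Let \<open>R v\<close> be the Ritz projection, \<open>((v - R v)', W') = 0\<close> for all \<open>W \<in> S\<^sub>h\<^sup>k\<close>, and split
  \<open>V - v = \<theta> - \<rho>\<close> with \<open>\<theta> = V - R v\<close> and \<open>\<rho> = v - R v\<close>. One has \<open>\<parallel>\<rho>\<parallel> \<le> h\<^sup>k\<^sup>+\<^sup>1 \<parallel>v\<parallel>\<close> in the norm of \<open>H\<^sup>k\<^sup>+\<^sup>1\<close>,
  with constant 1, and the same for \<open>\<partial>\<rho>/\<partial>t\<close> because \<open>\<partial>v/\<partial>t\<close> inherits the boundary values of \<open>v\<close>. Testing the
  difference of the two equations with \<open>\<theta>\<close>, the diffusion terms leave \<open>(\<theta>',\<theta>')\<close> and the difference of the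
  nonlocal coefficients, which is Lipschitz in \<open>\<parallel>\<theta>\<parallel> + \<parallel>\<rho>\<parallel>\<close>; in the convection term \<open>\<rho>'\<close> is integrated by
  parts. Young's inequality and Gronwall's lemma then bound \<open>\<parallel>\<theta>\<parallel>\<close> by its initial value, where
  \<open>V\<close> is the interpolant of \<open>v\<^sub>0\<close>, and by norms of \<open>\<rho>\<close> and \<open>\<partial>\<rho>/\<partial>t\<close>.\<close>

text \<open>Two obstacles shape the details. First, the projection of v(t) exists only at times when
  v(t) has a derivative, and the equations hold outside a null set depending on the test function,
  while \<theta> varies with t. The energy is therefore written with coefficients in fixed bases of
  the finite-dimensional space, each absolutely continuous in t; the equations are extended from the
  basis to \<theta>(t) at one good t, and continuity in L2 restores every t at the end. Second, the
  constant must not see k. Instead of a scaling argument with an unspecified constant, Rolle's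
  theorem and Cauchy-Schwarz are iterated on each element, every step having constant 1.
  One-dimensional Sobolev facts, in space and in time, are reduced to \<open>ac\<close>: an initial
  value plus the primitive of an L2 function. Boundary values are read off by parts against affine
  functions, and those of v0 are inherited from v(t) as t tends to 0. The bound on the y-derivative
  of v is needed because the difference of nonlocal coefficients multiplies that derivative, which
  is not an error term.\<close>

section \<open>Square-integrable functions\<close>

lemma L2I: "u \<in> borel_measurable (lebesgue_on S) \<Longrightarrow> integrable (lebesgue_on S) (\<lambda>x. (u x)\<^sup>2) \<Longrightarrow> u \<in> L2 S"
  by (simp add: L2_def)

lemma L2_measurable [measurable_dest]: "u \<in> L2 S \<Longrightarrow> u \<in> borel_measurable (lebesgue_on S)"
  by (simp add: L2_def)

lemma L2_square_integrable: "u \<in> L2 S \<Longrightarrow> integrable (lebesgue_on S) (\<lambda>x. (u x)\<^sup>2)"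
  by (simp add: L2_def)

lemma L2_mult_integrable:
  fixes u w :: "'a::euclidean_space \<Rightarrow> real"
  assumes "u \<in> L2 S" "w \<in> L2 S"
  shows "integrable (lebesgue_on S) (\<lambda>x. u x * w x)"
proof (rule Bochner_Integration.integrable_bound)
  show "integrable (lebesgue_on S) (\<lambda>x. (u x)\<^sup>2 + (w x)\<^sup>2)"
    using assms by (intro Bochner_Integration.integrable_add L2_square_integrable)
  show "(\<lambda>x. u x * w x) \<in> borel_measurable (lebesgue_on S)"
    using assms by (intro borel_measurable_times L2_measurable)
  have "\<bar>u x * w x\<bar> \<le> (u x)\<^sup>2 + (w x)\<^sup>2" for x
  proof -
    have "2 * \<bar>u x * w x\<bar> \<le> (u x)\<^sup>2 + (w x)\<^sup>2"
      using sum_squares_bound[of "\<bar>u x\<bar>" "\<bar>w x\<bar>"] by (simp add: abs_mult)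
    moreover have "0 \<le> \<bar>u x * w x\<bar>" by simp
    ultimately show ?thesis by linarith
  qed
  then show "AE x in lebesgue_on S. norm (u x * w x) \<le> norm ((u x)\<^sup>2 + (w x)\<^sup>2)"
    by simp
qed

lemma L2_zero [simp]: "(\<lambda>x. 0) \<in> L2 S"
  by (simp add: L2_def)

lemma L2_scale [intro]: "u \<in> L2 S \<Longrightarrow> (\<lambda>x. c * u x) \<in> L2 S"
  by (auto simp: L2_def power_mult_distrib)

lemma L2_add [intro]:
  assumes "u \<in> L2 S" "w \<in> L2 S" shows "(\<lambda>x. u x + w x) \<in> L2 S"
proof (rule L2I)
  show "(\<lambda>x. u x + w x) \<in> borel_measurable (lebesgue_on S)"
    using assms by (intro borel_measurable_add L2_measurable)
  have "integrable (lebesgue_on S) (\<lambda>x. (u x)\<^sup>2 + (w x)\<^sup>2 + 2 * (u x * w x))"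
    using assms by (intro Bochner_Integration.integrable_add integrable_mult_right
        L2_square_integrable L2_mult_integrable)
  then show "integrable (lebesgue_on S) (\<lambda>x. (u x + w x)\<^sup>2)"
    by (simp add: power2_sum ac_simps)
qed

lemma L2_uminus [intro]: "u \<in> L2 S \<Longrightarrow> (\<lambda>x. - u x) \<in> L2 S"
  using L2_scale[of u S "-1"] by simp

lemma L2_diff [intro]: "u \<in> L2 S \<Longrightarrow> w \<in> L2 S \<Longrightarrow> (\<lambda>x. u x - w x) \<in> L2 S"
  using L2_add[of u S "\<lambda>x. - w x"] L2_uminus[of w S] by simp

lemma L2_sum [intro]:
  "(\<And>i. i \<in> I \<Longrightarrow> u i \<in> L2 S) \<Longrightarrow> (\<lambda>x. \<Sum>i\<in>I. u i x) \<in> L2 S"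
  by (induction I rule: infinite_finite_induct) auto

lemma L2_bound:
  assumes "u \<in> L2 S" "w \<in> borel_measurable (lebesgue_on S)" "AE x in lebesgue_on S. \<bar>w x\<bar> \<le> \<bar>u x\<bar>"
  shows "w \<in> L2 S"
proof (rule L2I)
  show "integrable (lebesgue_on S) (\<lambda>x. (w x)\<^sup>2)"
    by (rule Bochner_Integration.integrable_bound[OF L2_square_integrable[OF assms(1)]])
       (use assms in \<open>auto simp: abs_le_square_iff\<close>)
qed fact

lemma L2_bounded_mult:
  assumes "u \<in> L2 S" "b \<in> borel_measurable (lebesgue_on S)" "\<And>x. x \<in> S \<Longrightarrow> \<bar>b x\<bar> \<le> B"
  shows "(\<lambda>x. b x * u x) \<in> L2 S"
proof (rule L2_bound[OF L2_scale[OF assms(1), of B]])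
  have "\<bar>b x * u x\<bar> \<le> \<bar>B * u x\<bar>" if "x \<in> S" for x
    using assms(3)[OF that] by (auto simp: abs_mult intro: mult_right_mono)
  then show "AE x in lebesgue_on S. \<bar>b x * u x\<bar> \<le> \<bar>B * u x\<bar>"
    by (intro AE_I2) auto
qed (use assms in \<open>auto intro: L2_measurable\<close>)

lemma ip_commute: "ip S u w = ip S w u"
  by (simp add: ip_def mult.commute)

lemma ip_add_left: "u \<in> L2 S \<Longrightarrow> v \<in> L2 S \<Longrightarrow> w \<in> L2 S \<Longrightarrow>
    ip S (\<lambda>x. u x + v x) w = ip S u w + ip S v w"
  by (simp add: ip_def distrib_right L2_mult_integrable)

lemma ip_diff_left: "u \<in> L2 S \<Longrightarrow> v \<in> L2 S \<Longrightarrow> w \<in> L2 S \<Longrightarrow>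
    ip S (\<lambda>x. u x - v x) w = ip S u w - ip S v w"
  by (simp add: ip_def left_diff_distrib L2_mult_integrable)

lemma ip_scale_left: "ip S (\<lambda>x. c * u x) w = c * ip S u w"
  by (simp add: ip_def mult.assoc)

lemma ip_uminus_left: "ip S (\<lambda>x. - u x) w = - ip S u w"
  by (simp add: ip_def)

lemma ip_sum_left: "(\<And>i. i \<in> I \<Longrightarrow> u i \<in> L2 S) \<Longrightarrow> w \<in> L2 S \<Longrightarrow>
    ip S (\<lambda>x. \<Sum>i\<in>I. u i x) w = (\<Sum>i\<in>I. ip S (u i) w)"
  by (simp add: ip_def sum_distrib_right L2_mult_integrable)

lemma ip_add_right: "u \<in> L2 S \<Longrightarrow> v \<in> L2 S \<Longrightarrow> w \<in> L2 S \<Longrightarrow>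
    ip S w (\<lambda>x. u x + v x) = ip S w u + ip S w v"
  by (simp add: ip_add_left ip_commute[of S w])

lemma ip_diff_right: "u \<in> L2 S \<Longrightarrow> v \<in> L2 S \<Longrightarrow> w \<in> L2 S \<Longrightarrow>
    ip S w (\<lambda>x. u x - v x) = ip S w u - ip S w v"
  by (simp add: ip_diff_left ip_commute[of S w])

lemma ip_scale_right: "ip S w (\<lambda>x. c * u x) = c * ip S w u"
  by (simp add: ip_scale_left ip_commute[of S w])

lemma ip_sum_right: "(\<And>i. i \<in> I \<Longrightarrow> u i \<in> L2 S) \<Longrightarrow> w \<in> L2 S \<Longrightarrow>
    ip S w (\<lambda>x. \<Sum>i\<in>I. u i x) = (\<Sum>i\<in>I. ip S w (u i))"
  by (simp add: ip_sum_left ip_commute[of S w])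

lemma ip_self_nonneg: "0 \<le> ip S u u"
  by (simp add: ip_def)

lemma L2norm_nonneg [simp]: "0 \<le> L2norm S u"
  by (simp add: L2norm_def ip_self_nonneg)

lemma L2norm_square: "(L2norm S u)\<^sup>2 = ip S u u"
  by (simp add: L2norm_def ip_self_nonneg)

lemma ip_cong_AE:
  assumes "AE x in lebesgue_on S. u x = u' x" "AE x in lebesgue_on S. w x = w' x"
    and "u \<in> L2 S" "u' \<in> L2 S" "w \<in> L2 S" "w' \<in> L2 S"
  shows "ip S u w = ip S u' w'"
  unfolding ip_def
  by (rule integral_cong_AE) (use assms in \<open>auto intro: borel_measurable_times L2_measurable\<close>)

lemma ip_cong: "(\<And>x. x \<in> S \<Longrightarrow> u x = u' x) \<Longrightarrow> (\<And>x. x \<in> S \<Longrightarrow> w x = w' x) \<Longrightarrow> ip S u w = ip S u' w'"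
  unfolding ip_def by (rule Bochner_Integration.integral_cong) auto

lemma L2norm_cong_AE: "AE x in lebesgue_on S. u x = u' x \<Longrightarrow> u \<in> L2 S \<Longrightarrow> u' \<in> L2 S \<Longrightarrow> L2norm S u = L2norm S u'"
  by (simp add: L2norm_def ip_cong_AE[where u = u and u' = u' and w = u and w' = u'])

lemma L2norm_cong: "(\<And>x. x \<in> S \<Longrightarrow> u x = u' x) \<Longrightarrow> L2norm S u = L2norm S u'"
  by (simp add: L2norm_def cong: ip_cong)

lemma ip_eq_0_imp_AE:
  assumes "u \<in> L2 S" "ip S u u = 0" shows "AE x in lebesgue_on S. u x = 0"
proof -
  have "AE x in lebesgue_on S. u x * u x = 0"
    using assms integral_nonneg_eq_0_iff_AE[OF L2_mult_integrable[OF assms(1,1)]]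
    by (simp add: ip_def)
  then show ?thesis by simp
qed

lemma ip_Cauchy_Schwarz:
  assumes u: "u \<in> L2 S" and w: "w \<in> L2 S"
  shows "\<bar>ip S u w\<bar> \<le> L2norm S u * L2norm S w"
proof -
  \<comment> \<open>The squared norm of u - s w. The minimising s = (u,w)/(w,w) gives the
    inequality; the case of w vanishing almost everywhere is treated apart.\<close>
  have q: "0 \<le> ip S u u - 2 * s * ip S u w + s\<^sup>2 * ip S w w" for s
  proof -
    have sw: "(\<lambda>x. s * w x) \<in> L2 S" using w by (rule L2_scale)
    have "ip S (\<lambda>x. u x - s * w x) (\<lambda>x. u x - s * w x)
        = ip S u u - 2 * s * ip S u w + s\<^sup>2 * ip S w w"
      using u w sw
      by (simp add: ip_diff_left ip_diff_right L2_diff ip_scale_left ip_scale_right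
          ip_commute[of S w u] algebra_simps power2_eq_square)
    then show ?thesis using ip_self_nonneg[of S "\<lambda>x. u x - s * w x"] by simp
  qed
  have "(ip S u w)\<^sup>2 \<le> ip S u u * ip S w w"
  proof (cases "ip S w w = 0")
    case True
    then have "AE x in lebesgue_on S. w x = 0" by (rule ip_eq_0_imp_AE[OF w])
    then have "ip S u w = ip S u (\<lambda>x. 0)" by (intro ip_cong_AE) (use u w in auto)
    then show ?thesis using True by (simp add: ip_def)
  next
    case False
    then have pos: "0 < ip S w w" using ip_self_nonneg[of S w] by simp
    have "0 \<le> ip S u u - (ip S u w)\<^sup>2 / ip S w w"
      using q[of "ip S u w / ip S w w"] False by (simp add: power2_eq_square field_simps)
    then show ?thesis using pos by (simp add: field_simps)
  qed
  then have "\<bar>ip S u w\<bar> \<le> sqrt (ip S u u * ip S w w)"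
    using real_le_rsqrt[of "\<bar>ip S u w\<bar>"] by simp
  then show ?thesis by (simp add: L2norm_def real_sqrt_mult)
qed

lemma L2norm_scale: "L2norm S (\<lambda>x. c * u x) = \<bar>c\<bar> * L2norm S u"
  by (simp add: L2norm_def ip_scale_left ip_scale_right real_sqrt_mult flip: mult.assoc)

lemma L2norm_uminus: "L2norm S (\<lambda>x. - u x) = L2norm S u"
  by (simp add: L2norm_def ip_def)

lemma L2norm_zero [simp]: "L2norm S (\<lambda>x. 0) = 0"
  by (simp add: L2norm_def ip_def)

lemma L2norm_minus_commute: "L2norm S (\<lambda>x. u x - w x) = L2norm S (\<lambda>x. w x - u x)"
  using L2norm_uminus[of S "\<lambda>x. u x - w x"] by simp

lemma L2norm_triangle:
  assumes u: "u \<in> L2 S" and w: "w \<in> L2 S"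
  shows "L2norm S (\<lambda>x. u x + w x) \<le> L2norm S u + L2norm S w"
proof (rule power2_le_imp_le)
  have "(L2norm S (\<lambda>x. u x + w x))\<^sup>2 = ip S u u + 2 * ip S u w + ip S w w"
    using u w by (simp add: L2norm_square ip_add_left ip_add_right L2_add ip_commute[of S w u])
  also have "\<dots> \<le> (L2norm S u + L2norm S w)\<^sup>2"
    using ip_Cauchy_Schwarz[OF u w] by (simp add: power2_sum L2norm_square)
  finally show "(L2norm S (\<lambda>x. u x + w x))\<^sup>2 \<le> (L2norm S u + L2norm S w)\<^sup>2" .
qed simp

lemma L2norm_triangle_diff:
  assumes "u \<in> L2 S" "w \<in> L2 S" "v \<in> L2 S"
  shows "L2norm S (\<lambda>x. u x - v x) \<le> L2norm S (\<lambda>x. u x - w x) + L2norm S (\<lambda>x. w x - v x)"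
  using L2norm_triangle[OF L2_diff[OF assms(1,2)] L2_diff[OF assms(2,3)]] by simp

lemma L2norm_le_add_diff:
  assumes "u \<in> L2 S" "w \<in> L2 S"
  shows "L2norm S u \<le> L2norm S w + L2norm S (\<lambda>x. u x - w x)"
  using L2norm_triangle[OF assms(2) L2_diff[OF assms]] by simp

lemma L2norm_mono:
  assumes "u \<in> L2 S" "w \<in> L2 S" "AE x in lebesgue_on S. \<bar>u x\<bar> \<le> \<bar>w x\<bar>"
  shows "L2norm S u \<le> L2norm S w"
  unfolding L2norm_def ip_def
  by (intro real_sqrt_le_mono integral_mono_AE L2_mult_integrable assms)
     (use assms(3) in eventually_elim, simp add: abs_le_square_iff flip: power2_eq_square)

lemma L2norm_bounded_mult:
  assumes "u \<in> L2 S" "b \<in> borel_measurable (lebesgue_on S)" "\<And>x. x \<in> S \<Longrightarrow> \<bar>b x\<bar> \<le> B" "0 \<le> B"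
  shows "L2norm S (\<lambda>x. b x * u x) \<le> B * L2norm S u"
proof -
  have "L2norm S (\<lambda>x. b x * u x) \<le> L2norm S (\<lambda>x. B * u x)"
  proof (rule L2norm_mono)
    have "\<bar>b x * u x\<bar> \<le> \<bar>B * u x\<bar>" if "x \<in> S" for x
      using assms(3)[OF that] by (auto simp: abs_mult intro: mult_right_mono)
    then show "AE x in lebesgue_on S. \<bar>b x * u x\<bar> \<le> \<bar>B * u x\<bar>"
      by (intro AE_I2) auto
  qed (use assms in \<open>auto intro: L2_bounded_mult[OF assms(1-3)]\<close>)
  then show ?thesis using assms(4) by (simp add: L2norm_scale)
qed

lemma tendsto_ip:
  assumes u: "u \<in> L2 S" "\<And>n. U n \<in> L2 S" "(\<lambda>n. L2norm S (\<lambda>x. U n x - u x)) \<longlonglongrightarrow> 0"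
    and w: "w \<in> L2 S" "\<And>n. W n \<in> L2 S" "(\<lambda>n. L2norm S (\<lambda>x. W n x - w x)) \<longlonglongrightarrow> 0"
  shows "(\<lambda>n. ip S (U n) (W n)) \<longlonglongrightarrow> ip S u w"
proof -
  let ?a = "\<lambda>n. L2norm S (\<lambda>x. U n x - u x)" and ?b = "\<lambda>n. L2norm S (\<lambda>x. W n x - w x)"
  have le: "\<bar>ip S (U n) (W n) - ip S u w\<bar> \<le> ?a n * ?b n + ?a n * L2norm S w + L2norm S u * ?b n" for n
  proof -
    note d = L2_diff[OF u(2)[of n] u(1)] L2_diff[OF w(2)[of n] w(1)]
    \<comment> \<open>Expanding around both limits keeps the product of the two small norms as a
      separate term, so the norms of \<open>W n\<close> need no separate bound.\<close>
    have "ip S (U n) (W n) - ip S u w = ip S (\<lambda>x. U n x - u x) (\<lambda>x. W n x - w x)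
        + ip S (\<lambda>x. U n x - u x) w + ip S u (\<lambda>x. W n x - w x)"
      using u(1) u(2)[of n] w(1) w(2)[of n] d by (simp add: ip_diff_left ip_diff_right)
    then show ?thesis
      using ip_Cauchy_Schwarz[OF d] ip_Cauchy_Schwarz[OF d(1) w(1)] ip_Cauchy_Schwarz[OF u(1) d(2)]
      by linarith
  qed
  have "(\<lambda>n. ?a n * ?b n + ?a n * L2norm S w + L2norm S u * ?b n) \<longlonglongrightarrow> 0 * 0 + 0 * L2norm S w + L2norm S u * 0"
    by (intro tendsto_intros u w)
  then have "(\<lambda>n. ?a n * ?b n + ?a n * L2norm S w + L2norm S u * ?b n) \<longlonglongrightarrow> 0" by simp
  then have "(\<lambda>n. ip S (U n) (W n) - ip S u w) \<longlonglongrightarrow> 0"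
    by (rule Lim_null_comparison[rotated]) (simp add: le)
  then show ?thesis by (simp add: LIM_zero_iff)
qed

lemma tendsto_ip_left:
  assumes "u \<in> L2 S" "\<And>n. U n \<in> L2 S" "(\<lambda>n. L2norm S (\<lambda>x. U n x - u x)) \<longlonglongrightarrow> 0" "w \<in> L2 S"
  shows "(\<lambda>n. ip S (U n) w) \<longlonglongrightarrow> ip S u w"
  using tendsto_ip[of u S U w "\<lambda>_. w"] assms by simp

section \<open>Primitives on an interval\<close>

lemma open_interval_lebesgue [simp]: "{a<..<b::real} \<in> sets lebesgue"
  by simp

lemma finite_measure_open_interval: "finite_measure (lebesgue_on {a<..<b::real})"
  using emeasure_bounded_finite[of "{a<..<b}"]
  by (intro finite_measureI) (auto simp: emeasure_restrict_space less_top)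

lemma L2_bounded:
  assumes "u \<in> borel_measurable (lebesgue_on {a<..<b::real})" "\<And>x. x \<in> {a<..<b} \<Longrightarrow> \<bar>u x\<bar> \<le> B"
  shows "u \<in> L2 {a<..<b}"
proof (rule L2I[OF assms(1)])
  have "(u x)\<^sup>2 \<le> B\<^sup>2" if "x \<in> {a<..<b}" for x
    using assms(2)[OF that] power_mono[of "\<bar>u x\<bar>" B 2] by simp
  then show "integrable (lebesgue_on {a<..<b}) (\<lambda>x. (u x)\<^sup>2)"
    by (intro finite_measure.integrable_const_bound[OF finite_measure_open_interval, where B="B\<^sup>2"] AE_I2)
       (use assms(1) in auto)
qed

lemma continuous_measurable_open_interval:
  "continuous_on {a..b::real} f \<Longrightarrow> f \<in> borel_measurable (lebesgue_on {a<..<b})" for f :: "real \<Rightarrow> real"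
  by (rule continuous_imp_measurable_on_sets_lebesgue) (auto elim: continuous_on_subset)

lemma L2_continuous:
  fixes f :: "real \<Rightarrow> real"
  assumes "continuous_on {a..b} f" shows "f \<in> L2 {a<..<b}"
proof -
  have "bounded (f ` {a..b})"
    by (intro compact_imp_bounded compact_continuous_image assms) auto
  then obtain B where "\<forall>x\<in>{a..b}. \<bar>f x\<bar> \<le> B"
    by (auto simp: bounded_iff)
  then show ?thesis
    by (intro L2_bounded[where B=B] continuous_measurable_open_interval assms) auto
qed

lemma L2_const [simp]: "(\<lambda>x. c) \<in> L2 {a<..<b::real}"
  by (rule L2_bounded[where B="\<bar>c\<bar>"]) auto

lemma L2_indicator [simp]:
  assumes "A \<in> sets lebesgue" shows "indicator A \<in> L2 {a<..<b::real}"
proof (rule L2_bounded[where B=1])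
  show "indicator A \<in> borel_measurable (lebesgue_on {a<..<b::real})"
    using assms by (intro measurable_restrict_space1 borel_measurable_indicator)
qed (auto simp: indicator_def)

lemma L2_mult_indicator [intro]:
  assumes "u \<in> L2 {a<..<b::real}" "A \<in> sets lebesgue"
  shows "(\<lambda>x. u x * indicator A x) \<in> L2 {a<..<b}"
proof (rule L2_bound[OF assms(1)])
  have "indicator A \<in> borel_measurable (lebesgue_on {a<..<b::real})"
    using assms by (intro measurable_restrict_space1 borel_measurable_indicator)
  then show "(\<lambda>x. u x * indicator A x) \<in> borel_measurable (lebesgue_on {a<..<b})"
    using L2_measurable[OF assms(1)] by (rule borel_measurable_times[rotated])
qed (auto simp: indicator_def)

lemma L2_mult_bounded_continuous [intro]:
  assumes "u \<in> L2 {a<..<b::real}" "continuous_on {a..b} f"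
  shows "(\<lambda>x. f x * u x) \<in> L2 {a<..<b}"
proof -
  have "bounded (f ` {a..b})"
    by (intro compact_imp_bounded compact_continuous_image assms) auto
  then obtain B where "\<forall>x\<in>{a..b}. \<bar>f x\<bar> \<le> B"
    by (auto simp: bounded_iff)
  then show ?thesis
    by (intro L2_bounded_mult[where B=B] continuous_measurable_open_interval assms) auto
qed

lemma ip_indicator_indicator:
  fixes c d :: real
  assumes "a \<le> c" "c \<le> d" "d \<le> b"
  shows "ip {a<..<b} (indicator {c<..d}) (indicator {c<..d}) = d - c"
proof -
  have "ip {a<..<b} (indicator {c<..d}) (indicator {c<..d}) = integral\<^sup>L (lebesgue_on {a<..<b}) (indicator {c<..d})"
    unfolding ip_def by (rule Bochner_Integration.integral_cong) (auto simp: indicator_def)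
  also have "\<dots> = measure (lebesgue_on {a<..<b}) ({c<..d} \<inter> {a<..<b})"
    by simp
  also have "\<dots> = measure lebesgue ({c<..d} \<inter> {a<..<b})"
    by (subst measure_restrict_space) auto
  also have "\<dots> = d - c"
  proof (cases "d = b")
    case True
    then have "{c<..d} \<inter> {a<..<b} = {c<..<d}" using assms by auto
    then show ?thesis using assms by simp
  next
    case False
    then have "{c<..d} \<inter> {a<..<b} = {c<..d}" using assms by auto
    then show ?thesis using assms by simp
  qed
  finally show ?thesis .
qed

text \<open>The primitive from the left end of S, written as an inner product with a half-line
  indicator: linearity, Cauchy-Schwarz and the convergence results for \<open>ip\<close> apply to it
  directly, and for y beyond the right end it stays equal to the full integral.\<close>

definition prim :: "real set \<Rightarrow> (real \<Rightarrow> real) \<Rightarrow> real \<Rightarrow> real" where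
  "prim S g y = ip S g (indicator {..y})"

lemma prim_diff_eq:
  assumes "g \<in> L2 {a<..<b}" "c \<le> d"
  shows "prim {a<..<b} g d - prim {a<..<b} g c = ip {a<..<b} g (indicator {c<..d})"
proof -
  have "prim {a<..<b} g d - prim {a<..<b} g c = ip {a<..<b} g (\<lambda>x. indicator {..d} x - indicator {..c} x)"
    using assms by (simp add: prim_def ip_diff_right)
  also have "\<dots> = ip {a<..<b} g (indicator {c<..d})"
    by (rule ip_cong) (use assms(2) in \<open>auto simp: indicator_def\<close>)
  finally show ?thesis .
qed

lemma prim_left [simp]: "prim {a<..<b} g a = 0"
proof -
  have "prim {a<..<b} g a = ip {a<..<b} g (\<lambda>x. 0)"
    unfolding prim_def by (rule ip_cong) auto
  then show ?thesis by (simp add: ip_def)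
qed

lemma prim_right: "prim {a<..<b} g b = ip {a<..<b} g (\<lambda>x. 1)"
  unfolding prim_def by (rule ip_cong) auto

lemma L2norm_indicator:
  fixes c d :: real
  shows "a \<le> c \<Longrightarrow> c \<le> d \<Longrightarrow> d \<le> b \<Longrightarrow> L2norm {a<..<b} (indicator {c<..d}) = sqrt (d - c)"
  by (simp add: L2norm_def ip_indicator_indicator)

lemma L2norm_const:
  assumes "a \<le> b" shows "L2norm {a<..<b::real} (\<lambda>x. c) = \<bar>c\<bar> * sqrt (b - a)"
proof -
  have "L2norm {a<..<b} (\<lambda>x. c) = L2norm {a<..<b} (\<lambda>x. c * indicator {a<..b} x)"
    by (rule L2norm_cong) auto
  then show ?thesis using assms by (simp add: L2norm_scale L2norm_indicator)
qed

lemma prim_Hoelder: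
  assumes "g \<in> L2 {a<..<b}" "a \<le> c" "c \<le> d" "d \<le> b"
  shows "\<bar>prim {a<..<b} g d - prim {a<..<b} g c\<bar> \<le> L2norm {a<..<b} g * sqrt (d - c)"
  using ip_Cauchy_Schwarz[OF assms(1), of "indicator {c<..d}"] assms
  by (simp add: prim_diff_eq L2norm_indicator)

lemma prim_bound:
  assumes "g \<in> L2 {a<..<b}" "a \<le> y" "y \<le> b"
  shows "\<bar>prim {a<..<b} g y\<bar> \<le> L2norm {a<..<b} g * sqrt (b - a)"
proof -
  have "\<bar>prim {a<..<b} g y\<bar> \<le> L2norm {a<..<b} g * sqrt (y - a)"
    using prim_Hoelder[OF assms(1) order_refl assms(2,3)] by simp
  also have "\<dots> \<le> L2norm {a<..<b} g * sqrt (b - a)"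
    using assms by (intro mult_left_mono) auto
  finally show ?thesis .
qed

lemma continuous_on_prim [continuous_intros]:
  assumes "g \<in> L2 {a<..<b}" shows "continuous_on {a..b} (prim {a<..<b} g)"
  unfolding continuous_on_def
proof
  fix y assume y: "y \<in> {a..b}"
  have le: "\<bar>prim {a<..<b} g z - prim {a<..<b} g y\<bar> \<le> L2norm {a<..<b} g * sqrt \<bar>z - y\<bar>" if "z \<in> {a..b}" for z
    using prim_Hoelder[OF assms, of y z] prim_Hoelder[OF assms, of z y] y that
    by (cases "y \<le> z") (auto simp: abs_minus_commute)
  have "((\<lambda>z. L2norm {a<..<b} g * sqrt \<bar>z - y\<bar>) \<longlongrightarrow> L2norm {a<..<b} g * sqrt \<bar>y - y\<bar>) (at y within {a..b})"
    by (intro tendsto_intros)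
  then have "((\<lambda>z. L2norm {a<..<b} g * sqrt \<bar>z - y\<bar>) \<longlongrightarrow> 0) (at y within {a..b})" by simp
  then have "((\<lambda>z. prim {a<..<b} g z - prim {a<..<b} g y) \<longlongrightarrow> 0) (at y within {a..b})"
    by (rule Lim_null_comparison[rotated]) (auto simp: eventually_at_filter le)
  then show "(prim {a<..<b} g \<longlongrightarrow> prim {a<..<b} g y) (at y within {a..b})"
    by (simp add: LIM_zero_iff)
qed

lemma prim_add: "f \<in> L2 {a<..<b} \<Longrightarrow> g \<in> L2 {a<..<b} \<Longrightarrow>
    prim {a<..<b} (\<lambda>x. f x + g x) y = prim {a<..<b} f y + prim {a<..<b} g y"
  by (simp add: prim_def ip_add_left)

lemma prim_diff: "f \<in> L2 {a<..<b} \<Longrightarrow> g \<in> L2 {a<..<b} \<Longrightarrow>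
    prim {a<..<b} (\<lambda>x. f x - g x) y = prim {a<..<b} f y - prim {a<..<b} g y"
  by (simp add: prim_def ip_diff_left)

lemma prim_scale: "prim S (\<lambda>x. c * f x) y = c * prim S f y"
  by (simp add: prim_def ip_scale_left)

lemma prim_cong_AE: "AE x in lebesgue_on {a<..<b}. f x = g x \<Longrightarrow> f \<in> L2 {a<..<b} \<Longrightarrow> g \<in> L2 {a<..<b} \<Longrightarrow>
    prim {a<..<b} f y = prim {a<..<b} g y"
  unfolding prim_def by (rule ip_cong_AE) auto

lemma prim_FTC:
  assumes "a \<le> y" "y \<le> b"
    and der: "\<And>x. x \<in> {a..b} \<Longrightarrow> (f has_real_derivative f' x) (at x within {a..b})"
    and cont: "continuous_on {a..b} f'"
  shows "prim {a<..<b} f' y = f y - f a"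
proof -
  let ?h = "\<lambda>x. f' x * indicator {..y} x :: real"
  have "(f' has_integral f y - f a) {a..y}"
  proof (rule fundamental_theorem_of_calculus[OF assms(1)])
    fix x assume "x \<in> {a..y}"
    then show "(f has_vector_derivative f' x) (at x within {a..y})"
      using der[of x] assms(2)
      by (auto simp: has_real_derivative_iff_has_vector_derivative intro: has_vector_derivative_within_subset)
  qed
  then have "((\<lambda>x. if x \<in> {a..y} then f' x else 0) has_integral f y - f a) UNIV"
    by (simp only: has_integral_restrict_UNIV)
  \<comment> \<open>The two extensions by zero differ at most at end points, which are negligible
    for the gauge integral.\<close>
  then have "((\<lambda>x. if x \<in> {a<..<b} then ?h x else 0) has_integral f y - f a) UNIV"
    by (rule has_integral_spike[of "{a,b,y}", rotated -1])
       (use assms(1,2) in \<open>auto simp: indicator_def\<close>)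
  then have *: "(?h has_integral f y - f a) {a<..<b}"
    by (simp only: has_integral_restrict_UNIV)
  have "integrable (lebesgue_on {a<..<b}) ?h"
    by (rule L2_mult_integrable[OF L2_continuous[OF cont] L2_indicator]) auto
  then have "(?h has_integral (integral\<^sup>L (lebesgue_on {a<..<b}) ?h)) {a<..<b}"
    by (intro has_integral_integral_lebesgue_on) auto
  with * have "integral\<^sup>L (lebesgue_on {a<..<b}) ?h = f y - f a"
    by (rule has_integral_unique[rotated])
  then show ?thesis by (simp add: prim_def ip_def)
qed

section \<open>Density of test functions\<close>

lemma C1cI:
  assumes "\<And>x. (\<phi> has_real_derivative \<phi>' x) (at x)" "continuous_on UNIV \<phi>'"
    and "\<And>x. x \<notin> {c..d} \<Longrightarrow> \<phi> x = 0" "{c..d} \<subseteq> S"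
  shows "\<phi> \<in> C1c S"
proof -
  have "deriv \<phi> = \<phi>'"
    using assms(1) by (intro ext DERIV_imp_deriv)
  moreover have "\<phi> differentiable_on UNIV"
    unfolding differentiable_on_def real_differentiable_def using assms(1) by blast
  ultimately show ?thesis
    using assms(2-4) unfolding C1c_def by (auto intro!: exI[of _ "{c..d}"])
qed

lemma C1c_has_deriv: "\<phi> \<in> C1c S \<Longrightarrow> (\<phi> has_real_derivative deriv \<phi> x) (at x within X)"
proof -
  assume "\<phi> \<in> C1c S"
  then have "\<phi> differentiable at x"
    by (auto simp: C1c_def differentiable_on_def)
  then have "(\<phi> has_real_derivative deriv \<phi> x) (at x)"
    by (simp add: DERIV_deriv_iff_real_differentiable)
  then show ?thesis by (rule has_field_derivative_at_within)
qed

lemma C1c_continuous: "\<phi> \<in> C1c S \<Longrightarrow> continuous_on X \<phi>"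
  by (rule DERIV_continuous_on[OF C1c_has_deriv])

lemma C1c_continuous_deriv: "\<phi> \<in> C1c S \<Longrightarrow> continuous_on X (deriv \<phi>)"
  by (auto simp: C1c_def intro: continuous_on_subset)

lemma C1c_L2: "\<phi> \<in> C1c S \<Longrightarrow> \<phi> \<in> L2 {a<..<b}"
  by (intro L2_continuous C1c_continuous)

lemma C1c_deriv_L2: "\<phi> \<in> C1c S \<Longrightarrow> deriv \<phi> \<in> L2 {a<..<b}"
  by (intro L2_continuous C1c_continuous_deriv)

lemma C1c_outside: "\<phi> \<in> C1c S \<Longrightarrow> x \<notin> S \<Longrightarrow> \<phi> x = 0"
  by (auto simp: C1c_def)

section \<open>Cut-off functions and approximation by test functions\<close>

lemma DERIV_max_square: "((\<lambda>x. (max 0 x)\<^sup>2) has_real_derivative 2 * max 0 x) (at x)" for x :: real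
proof (cases x "0::real" rule: linorder_cases)
  case less
  have "((\<lambda>x. 0::real) has_real_derivative 0) (at x)" by simp
  moreover have "eventually (\<lambda>y. (0::real) = (max 0 y)\<^sup>2) (nhds x)"
    using eventually_nhds_in_open[of "{..<0}" x] less by (auto elim!: eventually_mono)
  ultimately have "((\<lambda>x. (max 0 x)\<^sup>2) has_real_derivative 0) (at x)"
    using DERIV_cong_ev[OF refl, of "\<lambda>_. 0" "\<lambda>x. (max 0 x)\<^sup>2" x 0 0] by blast
  then show ?thesis using less by simp
next
  case equal
  have "((\<lambda>h. ((max 0 (0 + h))\<^sup>2 - (max 0 0)\<^sup>2) / h) \<longlongrightarrow> (0::real)) (at 0)"
  proof (rule Lim_null_comparison)
    have "norm (((max 0 (0 + h))\<^sup>2 - (max 0 0)\<^sup>2) / h) \<le> \<bar>h\<bar>" for h :: real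
      by (auto simp: max_def power2_eq_square)
    then show "\<forall>\<^sub>F h in at 0. norm (((max 0 (0 + h))\<^sup>2 - (max 0 0)\<^sup>2) / h) \<le> \<bar>h::real\<bar>"
      by (intro always_eventually allI)
    show "((\<lambda>h. \<bar>h::real\<bar>) \<longlongrightarrow> 0) (at 0)"
      using tendsto_rabs[OF tendsto_ident_at[of "0::real" UNIV]] by simp
  qed
  then show ?thesis using equal by (simp add: DERIV_def)
next
  case greater
  have "((\<lambda>x. x\<^sup>2) has_real_derivative 2 * x) (at x)" by (auto intro!: derivative_eq_intros)
  moreover have "eventually (\<lambda>y. y\<^sup>2 = (max 0 y)\<^sup>2) (nhds x)"
    using eventually_nhds_in_open[of "{0<..}" x] greater by (auto elim!: eventually_mono)
  ultimately have "((\<lambda>x. (max 0 x)\<^sup>2) has_real_derivative 2 * x) (at x)"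
    using DERIV_cong_ev[OF refl, of "\<lambda>x. x\<^sup>2" "\<lambda>x. (max 0 x)\<^sup>2" x "2 * x" "2 * x"] by blast
  then show ?thesis using greater by simp
qed

text \<open>For N > 0 it is positive exactly on ]c,d[, and the squares make the joins at c and d
  continuously differentiable.\<close>

definition bump :: "real \<Rightarrow> real \<Rightarrow> real \<Rightarrow> real \<Rightarrow> real" where
  "bump N c d x = N * (max 0 (x - c))\<^sup>2 * (max 0 (d - x))\<^sup>2"

definition bump' :: "real \<Rightarrow> real \<Rightarrow> real \<Rightarrow> real \<Rightarrow> real" where
  "bump' N c d x = N * (2 * max 0 (x - c) * (max 0 (d - x))\<^sup>2 - (max 0 (x - c))\<^sup>2 * (2 * max 0 (d - x)))"

lemma bump_nonneg: "0 \<le> N \<Longrightarrow> 0 \<le> bump N c d x"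
  by (simp add: bump_def)

lemma DERIV_bump: "(bump N c d has_real_derivative bump' N c d x) (at x)"
proof -
  have 1: "((\<lambda>x. (max 0 (x - c))\<^sup>2) has_real_derivative 2 * max 0 (x - c) * 1) (at x)"
    by (rule DERIV_chain2[OF DERIV_max_square]) (auto intro!: derivative_eq_intros)
  have 2: "((\<lambda>x. (max 0 (d - x))\<^sup>2) has_real_derivative 2 * max 0 (d - x) * (-1)) (at x)"
    by (rule DERIV_chain2[OF DERIV_max_square]) (auto intro!: derivative_eq_intros)
  show ?thesis
    unfolding bump_def[abs_def] bump'_def mult.assoc
    by (rule derivative_eq_intros 1 2 refl)+ (simp add: algebra_simps)
qed

lemma continuous_bump': "continuous_on UNIV (bump' N c d)"
  unfolding bump'_def[abs_def] by (intro continuous_intros)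

text \<open>The map s/(1+s) sends the bump into [0,1[ without changing its support and sends large
  values close to 1. With N large the result is nearly 1 inside ]c,d[, and no plateau has to be
  constructed.\<close>

definition cutoff :: "real \<Rightarrow> real \<Rightarrow> real \<Rightarrow> real \<Rightarrow> real" where
  "cutoff N c d x = bump N c d x / (1 + bump N c d x)"

lemma cutoff_range: "0 \<le> N \<Longrightarrow> 0 \<le> cutoff N c d x \<and> cutoff N c d x \<le> 1"
  using bump_nonneg[of N c d x] by (simp add: cutoff_def)

lemma cutoff_outside: "x \<notin> {c..d} \<Longrightarrow> cutoff N c d x = 0"
  by (auto simp: cutoff_def bump_def)

lemma cutoff_mult_C1c:
  assumes p: "\<And>x. (p has_real_derivative p' x) (at x)" "continuous_on UNIV p'"
    and "0 \<le> N" "{c..d} \<subseteq> S"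
  shows "(\<lambda>x. p x * cutoff N c d x) \<in> C1c S"
proof (rule C1cI)
  have nz: "1 + bump N c d x \<noteq> 0" for x
    using bump_nonneg[OF assms(3), of c d x] by simp
  let ?D = "\<lambda>x. p' x * cutoff N c d x + (bump' N c d x * (1 + bump N c d x) - bump N c d x * bump' N c d x)
      / ((1 + bump N c d x) * (1 + bump N c d x)) * p x"
  show "((\<lambda>x. p x * cutoff N c d x) has_real_derivative ?D x) (at x)" for x
    unfolding cutoff_def
    by (rule derivative_eq_intros p DERIV_bump refl nz)+ simp
  have "continuous_on UNIV p" "continuous_on UNIV (bump N c d)"
    by (rule DERIV_continuous_on[OF p(1)], rule DERIV_continuous_on[OF DERIV_bump])
  then show "continuous_on UNIV ?D"
    unfolding cutoff_def by (intro continuous_intros continuous_bump' p) (auto simp: nz)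
qed (use assms cutoff_outside in auto)

text \<open>At a fixed x the bump is n times a factor that converges to ((x-a)(b-x))^2 > 0. It
  therefore tends to infinity, although its support stays inside ]a,b[.\<close>

lemma cutoff_tendsto_1:
  assumes "a < x" "x < b"
  shows "(\<lambda>n. cutoff (real n) (a + 1 / Suc n) (b - 1 / Suc n) x) \<longlonglongrightarrow> 1"
proof -
  define r where "r n = (max 0 (x - (a + 1 / Suc n)))\<^sup>2 * (max 0 (b - 1 / Suc n - x))\<^sup>2" for n
  have "r \<longlonglongrightarrow> (max 0 (x - (a + 0)))\<^sup>2 * (max 0 (b - 0 - x))\<^sup>2"
    unfolding r_def by (intro tendsto_intros LIMSEQ_Suc[OF lim_1_over_n])
  moreover have "0 < (max 0 (x - (a + 0)))\<^sup>2 * (max 0 (b - 0 - x))\<^sup>2"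
    using assms by simp
  ultimately have "filterlim (\<lambda>n. r n * real n) at_top sequentially"
    by (rule filterlim_tendsto_pos_mult_at_top[OF _ _ filterlim_real_sequentially])
  then have at: "filterlim (\<lambda>n. 1 + r n * real n) at_top sequentially"
    by (rule filterlim_tendsto_add_at_top[OF tendsto_const])
  have "(\<lambda>n. 1 - inverse (1 + r n * real n)) \<longlonglongrightarrow> 1 - 0"
    by (intro tendsto_intros tendsto_inverse_0_at_top at)
  moreover have "cutoff (real n) (a + 1 / Suc n) (b - 1 / Suc n) x = 1 - inverse (1 + r n * real n)" for n
  proof -
    have b: "bump (real n) (a + 1 / Suc n) (b - 1 / Suc n) x = r n * real n"
      by (simp add: bump_def r_def mult_ac)
    have "0 \<le> r n" by (simp add: r_def)
    then have "1 + r n * real n \<noteq> 0" by (smt (verit) mult_nonneg_nonneg of_nat_0_le_iff)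
    then show ?thesis unfolding cutoff_def b by (simp add: field_simps)
  qed
  ultimately show ?thesis by simp
qed

lemma L2norm_tendsto_0_dominated:
  assumes "\<And>n. U n \<in> L2 S" "u \<in> L2 S" "g \<in> L2 S"
    and "AE x in lebesgue_on S. (\<lambda>n. U n x) \<longlonglongrightarrow> u x"
    and "\<And>n. AE x in lebesgue_on S. \<bar>U n x - u x\<bar> \<le> \<bar>g x\<bar>"
  shows "(\<lambda>n. L2norm S (\<lambda>x. U n x - u x)) \<longlonglongrightarrow> 0"
proof -
  have "(\<lambda>n. LINT x|lebesgue_on S. (U n x - u x)\<^sup>2) \<longlonglongrightarrow> (LINT x|lebesgue_on S. 0)"
  proof (rule integral_dominated_convergence)
    show "integrable (lebesgue_on S) (\<lambda>x. (g x)\<^sup>2)" by (rule L2_square_integrable[OF assms(3)])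
    show "(\<lambda>x. (U n x - u x)\<^sup>2) \<in> borel_measurable (lebesgue_on S)" for n
      using L2_measurable[OF L2_diff[OF assms(1,2)]] by (rule borel_measurable_power)
    show "AE x in lebesgue_on S. (\<lambda>n. (U n x - u x)\<^sup>2) \<longlonglongrightarrow> 0"
      using assms(4)
    proof eventually_elim
      case (elim x)
      have "(\<lambda>n. (U n x - u x)\<^sup>2) \<longlonglongrightarrow> (u x - u x)\<^sup>2" by (intro tendsto_intros elim)
      then show ?case by simp
    qed
    show "AE x in lebesgue_on S. norm ((U n x - u x)\<^sup>2) \<le> (g x)\<^sup>2" for n
      using assms(5)[of n] by eventually_elim (simp add: abs_le_square_iff)
  qed simp
  then have "(\<lambda>n. sqrt (LINT x|lebesgue_on S. (U n x - u x)\<^sup>2)) \<longlonglongrightarrow> sqrt 0"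
    by (intro tendsto_real_sqrt) simp
  then show ?thesis
    by (simp add: L2norm_def ip_def power2_eq_square)
qed

text \<open>A measurable function is almost everywhere a limit of continuous ones. Clipping,
  Stone-Weierstrass and a cut-off turn these into C1 functions with compact support; polynomials
  supply the smoothness that is usually obtained by mollification. Dominated convergence gives
  convergence in L2.\<close>

lemma C1c_dense_bounded:
  assumes u: "u \<in> borel_measurable (lebesgue_on {a<..<b})" "\<And>x. x \<in> {a<..<b} \<Longrightarrow> \<bar>u x\<bar> \<le> M"
  obtains \<phi> where "\<And>n. \<phi> n \<in> C1c {a<..<b}" "(\<lambda>n. L2norm {a<..<b} (\<lambda>x. \<phi> n x - u x)) \<longlonglongrightarrow> 0"
proof -
  have "u measurable_on {a<..<b}"
    using u(1) by (simp add: measurable_on_iff_borel_measurable)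
  then obtain N g where N: "negligible N" and g: "\<And>n. continuous_on UNIV (g n)"
    and lim: "\<And>x. x \<notin> N \<Longrightarrow> (\<lambda>n. g n x) \<longlonglongrightarrow> (if x \<in> {a<..<b} then u x else 0)"
    unfolding measurable_on_def by blast
  \<comment> \<open>Clipping at |M| does not change the limit, since |u| \<le> M, and it yields the
    dominating constant 2|M| + 1 below; the extra 1 pays for the polynomial approximation.\<close>
  define h where "h n x = max (- \<bar>M\<bar>) (min \<bar>M\<bar> (g n x))" for n x
  have hcont: "continuous_on {a..b} (h n)" for n
    unfolding h_def by (intro continuous_intros continuous_on_subset[OF g]) auto
  have "\<exists>p. real_polynomial_function p \<and> (\<forall>x\<in>{a..b}. \<bar>h n x - p x\<bar> < 1 / Suc n)" for n
    using Stone_Weierstrass_real_polynomial_function[OF _ hcont, of "1 / Suc n"]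
    by (metis compact_Icc of_nat_0_less_iff zero_less_Suc zero_less_divide_1_iff)
  then obtain p where p: "\<And>n. real_polynomial_function (p n)"
    "\<And>n x. x \<in> {a..b} \<Longrightarrow> \<bar>h n x - p n x\<bar> < 1 / Suc n"
    by metis
  define \<phi> where "\<phi> n x = p n x * cutoff (real n) (a + 1 / Suc n) (b - 1 / Suc n) x" for n x
  have C1: "\<phi> n \<in> C1c {a<..<b}" for n
  proof -
    obtain p' where p': "real_polynomial_function p'" "\<And>x. (p n has_real_derivative p' x) (at x)"
      using has_real_derivative_polynomial_function[OF p(1)] by blast
    have pos: "0 < 1 / real (Suc n)" by simp
    have sub: "a < x" "x < b" if "a + 1 / real (Suc n) \<le> x" "x \<le> b - 1 / real (Suc n)" for x
      using that pos by linarith+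
    have "continuous_on UNIV p'"
      using p'(1) by (simp add: continuous_on_polymonial_function real_polynomial_function_eq)
    moreover have "{a + 1 / Suc n..b - 1 / Suc n} \<subseteq> {a<..<b}" using sub by fastforce
    ultimately show ?thesis
      unfolding \<phi>_def using p'(2) by (intro cutoff_mult_C1c) auto
  qed
  have bnd: "\<bar>\<phi> n x\<bar> \<le> \<bar>M\<bar> + 1" if "x \<in> {a<..<b}" for n x
  proof -
    have "\<bar>h n x\<bar> \<le> \<bar>M\<bar>" unfolding h_def by auto
    moreover have "1 / real (Suc n) \<le> 1" by simp
    moreover have "\<bar>h n x - p n x\<bar> < 1 / Suc n" using p(2)[of x n] that by auto
    ultimately have "\<bar>p n x\<bar> \<le> \<bar>M\<bar> + 1" by linarith
    moreover have "\<bar>\<phi> n x\<bar> \<le> \<bar>p n x\<bar> * 1"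
      unfolding \<phi>_def abs_mult
      using cutoff_range[of "real n" "a + 1 / Suc n" "b - 1 / Suc n" x]
      by (intro mult_left_mono) linarith+
    ultimately show ?thesis by simp
  qed
  have uL2: "u \<in> L2 {a<..<b}" by (rule L2_bounded[OF u])
  have "(\<lambda>n. L2norm {a<..<b} (\<lambda>x. \<phi> n x - u x)) \<longlonglongrightarrow> 0"
  proof (rule L2norm_tendsto_0_dominated[where g="\<lambda>x. 2 * \<bar>M\<bar> + 1"])
    have "AE x in lebesgue_on {a<..<b}. x \<notin> N"
    proof -
      have "N \<in> null_sets lebesgue" using N negligible_iff_null_sets by blast
      then have "AE x in lebesgue. x \<notin> N" by (rule AE_not_in)
      then show ?thesis by (subst AE_restrict_space_iff) auto
    qed
    then show "AE x in lebesgue_on {a<..<b}. (\<lambda>n. \<phi> n x) \<longlonglongrightarrow> u x"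
    proof (rule lebesgue_on_mono)
      fix x assume x: "x \<notin> N" "x \<in> {a<..<b}"
      have "(\<lambda>n. h n x) \<longlonglongrightarrow> max (- \<bar>M\<bar>) (min \<bar>M\<bar> (u x))"
        unfolding h_def using lim[OF x(1)] x(2) by (intro tendsto_intros) simp
      moreover have "max (- \<bar>M\<bar>) (min \<bar>M\<bar> (u x)) = u x" using u(2)[OF x(2)] by auto
      ultimately have hl: "(\<lambda>n. h n x) \<longlonglongrightarrow> u x" by simp
      have "(\<lambda>n. p n x - h n x) \<longlonglongrightarrow> 0"
      proof (rule Lim_null_comparison)
        show "\<forall>\<^sub>F n in sequentially. norm (p n x - h n x) \<le> 1 / Suc n"
          using p(2)[of x] x(2) by (auto simp: abs_minus_commute intro!: always_eventually less_imp_le)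
        show "(\<lambda>n. 1 / real (Suc n)) \<longlonglongrightarrow> 0" by (intro LIMSEQ_Suc[OF lim_1_over_n])
      qed
      then have "(\<lambda>n. p n x) \<longlonglongrightarrow> u x" using tendsto_add[OF _ hl] by fastforce
      then have "(\<lambda>n. \<phi> n x) \<longlonglongrightarrow> u x * 1"
        unfolding \<phi>_def using x(2) by (intro tendsto_mult cutoff_tendsto_1) auto
      then show "(\<lambda>n. \<phi> n x) \<longlonglongrightarrow> u x" by simp
    qed
    have "\<bar>\<phi> n x - u x\<bar> \<le> \<bar>2 * \<bar>M\<bar> + 1\<bar>" if "x \<in> {a<..<b}" for n x
      using bnd[OF that, of n] u(2)[OF that] by linarith
    then show "AE x in lebesgue_on {a<..<b}. \<bar>\<phi> n x - u x\<bar> \<le> \<bar>2 * \<bar>M\<bar> + 1\<bar>" for n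
      by (intro AE_I2) auto
  qed (rule C1c_L2[OF C1] uL2 L2_const)+
  with C1 show ?thesis by (rule that)
qed

text \<open>Clipping u at height n gives bounded functions converging to u; one test function within
  1/(n+1) of each is a diagonal choice.\<close>

lemma C1c_dense:
  assumes u: "u \<in> L2 {a<..<b}"
  obtains \<phi> where "\<And>n. \<phi> n \<in> C1c {a<..<b}" "(\<lambda>n. L2norm {a<..<b} (\<lambda>x. \<phi> n x - u x)) \<longlonglongrightarrow> 0"
proof -
  let ?S = "{a<..<b}"
  define U where "U n x = max (- real n) (min (real n) (u x))" for n x
  have Um: "U n \<in> borel_measurable (lebesgue_on ?S)" for n
    unfolding U_def using L2_measurable[OF u] by (intro borel_measurable_max borel_measurable_min) auto
  have Ub: "\<bar>U n x\<bar> \<le> real n" for n x unfolding U_def by auto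
  have UL2: "U n \<in> L2 ?S" for n using Um Ub by (rule L2_bounded)
  have lim: "(\<lambda>n. L2norm ?S (\<lambda>x. U n x - u x)) \<longlonglongrightarrow> 0"
  proof (rule L2norm_tendsto_0_dominated[OF UL2 u u])
    show "AE x in lebesgue_on ?S. (\<lambda>n. U n x) \<longlonglongrightarrow> u x"
    proof (rule AE_I2)
      fix x
      obtain m where m: "\<bar>u x\<bar> \<le> real m" using real_arch_simple by blast
      have "\<forall>\<^sub>F n in sequentially. U n x = u x"
        using eventually_ge_at_top[of m]
        by eventually_elim (use m in \<open>auto simp: U_def\<close>)
      then show "(\<lambda>n. U n x) \<longlonglongrightarrow> u x" by (rule tendsto_eventually)
    qed
    show "AE x in lebesgue_on ?S. \<bar>U n x - u x\<bar> \<le> \<bar>u x\<bar>" for n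
      by (rule AE_I2) (auto simp: U_def)
  qed
  have "\<exists>\<phi>\<in>C1c ?S. L2norm ?S (\<lambda>x. \<phi> x - U n x) < 1 / Suc n" for n
  proof -
    obtain \<psi> where \<psi>: "\<And>m. \<psi> m \<in> C1c ?S" "(\<lambda>m. L2norm ?S (\<lambda>x. \<psi> m x - U n x)) \<longlonglongrightarrow> 0"
      using C1c_dense_bounded[OF Um Ub] by metis
    have "\<forall>\<^sub>F m in sequentially. L2norm ?S (\<lambda>x. \<psi> m x - U n x) < 1 / Suc n"
      using \<psi>(2) by (rule order_tendstoD) simp
    then show ?thesis using \<psi>(1) by (auto simp: eventually_sequentially)
  qed
  then obtain \<phi> where \<phi>: "\<And>n. \<phi> n \<in> C1c ?S" "\<And>n. L2norm ?S (\<lambda>x. \<phi> n x - U n x) < 1 / Suc n"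
    by metis
  have "(\<lambda>n. L2norm ?S (\<lambda>x. \<phi> n x - u x)) \<longlonglongrightarrow> 0"
  proof (rule Lim_null_comparison)
    have "L2norm ?S (\<lambda>x. \<phi> n x - u x) \<le> 1 / Suc n + L2norm ?S (\<lambda>x. U n x - u x)" for n
      using L2norm_triangle_diff[OF C1c_L2[OF \<phi>(1)] UL2 u, of n n] \<phi>(2)[of n] by linarith
    then show "\<forall>\<^sub>F n in sequentially. norm (L2norm ?S (\<lambda>x. \<phi> n x - u x)) \<le> 1 / Suc n + L2norm ?S (\<lambda>x. U n x - u x)"
      by (intro always_eventually) simp
    show "(\<lambda>n. 1 / real (Suc n) + L2norm ?S (\<lambda>x. U n x - u x)) \<longlonglongrightarrow> 0"
      using tendsto_add[OF LIMSEQ_Suc[OF lim_1_over_n] lim] by simp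
  qed
  with \<phi>(1) show ?thesis by (rule that)
qed

section \<open>Integration by parts and the du Bois-Reymond lemma\<close>

text \<open>Test functions approximate g itself, so (g,g) is a limit of zeros.\<close>

lemma fundamental_lemma:
  assumes g: "g \<in> L2 {a<..<b}" and 0: "\<And>\<phi>. \<phi> \<in> C1c {a<..<b} \<Longrightarrow> ip {a<..<b} g \<phi> = 0"
  shows "AE x in lebesgue_on {a<..<b}. g x = 0"
proof -
  obtain \<phi> where \<phi>: "\<And>n. \<phi> n \<in> C1c {a<..<b}" "(\<lambda>n. L2norm {a<..<b} (\<lambda>x. \<phi> n x - g x)) \<longlonglongrightarrow> 0"
    using C1c_dense[OF g] by metis
  have "(\<lambda>n. ip {a<..<b} (\<phi> n) g) \<longlonglongrightarrow> ip {a<..<b} g g"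
    by (rule tendsto_ip_left[OF g C1c_L2[OF \<phi>(1)] \<phi>(2) g])
  moreover have "ip {a<..<b} (\<phi> n) g = 0" for n
    using 0[OF \<phi>(1)] by (simp add: ip_commute)
  ultimately have "ip {a<..<b} g g = 0" using LIMSEQ_unique[OF _ tendsto_const] by fastforce
  then show ?thesis by (rule ip_eq_0_imp_AE[OF g])
qed

lemma prim_L2: "g \<in> L2 {a<..<b} \<Longrightarrow> prim {a<..<b} g \<in> L2 {a<..<b}"
  by (rule L2_continuous[OF continuous_on_prim])

lemma L2norm_prim_le:
  assumes "g \<in> L2 {a<..<b}" "a \<le> b"
  shows "L2norm {a<..<b} (prim {a<..<b} g) \<le> (b - a) * L2norm {a<..<b} g"
proof -
  let ?c = "L2norm {a<..<b} g * sqrt (b - a)"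
  have "L2norm {a<..<b} (prim {a<..<b} g) \<le> L2norm {a<..<b} (\<lambda>x. ?c)"
  proof (rule L2norm_mono[OF prim_L2[OF assms(1)] L2_const], rule AE_I2)
    fix x assume "x \<in> space (lebesgue_on {a<..<b})"
    then have "\<bar>prim {a<..<b} g x\<bar> \<le> ?c" using prim_bound[OF assms(1), of x] by simp
    then show "\<bar>prim {a<..<b} g x\<bar> \<le> \<bar>?c\<bar>" by linarith
  qed
  also have "\<dots> = (b - a) * L2norm {a<..<b} g"
    unfolding L2norm_const[OF assms(2)] using assms(2) by (simp add: abs_mult)
  finally show ?thesis .
qed

text \<open>For test functions this is the product rule with classical antiderivatives. Each term is
  continuous in the L2 norms of f and g, so density of test functions gives the general
  case.\<close>

lemma prim_ibp:
  assumes f: "f \<in> L2 {a<..<b}" and g: "g \<in> L2 {a<..<b}" and ab: "a \<le> b"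
  shows "ip {a<..<b} (prim {a<..<b} f) g + ip {a<..<b} f (prim {a<..<b} g)
    = prim {a<..<b} f b * prim {a<..<b} g b"
proof -
  let ?S = "{a<..<b}" and ?P = "prim {a<..<b}"
  obtain \<phi> where \<phi>: "\<And>n. \<phi> n \<in> C1c ?S" "(\<lambda>n. L2norm ?S (\<lambda>x. \<phi> n x - f x)) \<longlonglongrightarrow> 0"
    using C1c_dense[OF f] by metis
  obtain \<psi> where \<psi>: "\<And>n. \<psi> n \<in> C1c ?S" "(\<lambda>n. L2norm ?S (\<lambda>x. \<psi> n x - g x)) \<longlonglongrightarrow> 0"
    using C1c_dense[OF g] by metis
  have smooth: "ip ?S (?P \<phi>) \<psi> + ip ?S \<phi> (?P \<psi>) = ?P \<phi> b * ?P \<psi> b"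
    if CC: "\<phi> \<in> C1c ?S" "\<psi> \<in> C1c ?S" for \<phi> \<psi>
  proof -
    have anti: "\<exists>F. (\<forall>x\<in>{a..b}. (F has_real_derivative \<phi> x) (at x within {a..b})) \<and> F a = 0"
      if C: "\<phi> \<in> C1c ?S" for \<phi>
    proof -
      obtain F where "\<And>x. x \<in> {a..b} \<Longrightarrow> (F has_vector_derivative \<phi> x) (at x within {a..b})"
        using antiderivative_continuous[OF C1c_continuous[OF C]] by blast
      then show ?thesis
        by (intro exI[of _ "\<lambda>x. F x - F a"])
           (auto simp: has_real_derivative_iff_has_vector_derivative intro!: derivative_eq_intros)
    qed
    obtain F where F: "\<And>x. x \<in> {a..b} \<Longrightarrow> (F has_real_derivative \<phi> x) (at x within {a..b})" "F a = 0"
      using anti[OF CC(1)] by blast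
    obtain G where G: "\<And>x. x \<in> {a..b} \<Longrightarrow> (G has_real_derivative \<psi> x) (at x within {a..b})" "G a = 0"
      using anti[OF CC(2)] by blast
    have cF: "continuous_on {a..b} F" "continuous_on {a..b} G"
      by (rule DERIV_continuous_on[OF F(1)], assumption, rule DERIV_continuous_on[OF G(1)], assumption)
    note c = cF C1c_continuous[OF CC(1), of "{a..b}"] C1c_continuous[OF CC(2), of "{a..b}"]
    have PF: "?P \<phi> y = F y" if "y \<in> {a..b}" for y
      using prim_FTC[of a y b F \<phi>] F c(3) that by auto
    have PG: "?P \<psi> y = G y" if "y \<in> {a..b}" for y
      using prim_FTC[of a y b G \<psi>] G c(4) that by auto
    have "?P (\<lambda>x. \<phi> x * G x + \<psi> x * F x) b = F b * G b - F a * G a"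
    proof (rule prim_FTC[of a b b "\<lambda>x. F x * G x"])
      show "((\<lambda>x. F x * G x) has_real_derivative \<phi> x * G x + \<psi> x * F x) (at x within {a..b})"
        if "x \<in> {a..b}" for x
        using DERIV_mult'[OF F(1)[OF that] G(1)[OF that]] by (simp add: algebra_simps)
      show "continuous_on {a..b} (\<lambda>x. \<phi> x * G x + \<psi> x * F x)" by (intro continuous_intros c)
    qed (use ab in auto)
    moreover have "?P (\<lambda>x. \<phi> x * G x + \<psi> x * F x) b = ip ?S F \<psi> + ip ?S \<phi> G"
    proof -
      have i: "(\<lambda>x. \<phi> x * G x) \<in> L2 ?S" "(\<lambda>x. \<psi> x * F x) \<in> L2 ?S"
        by (intro L2_continuous continuous_intros c)+
      have "?P (\<lambda>x. \<phi> x * G x + \<psi> x * F x) b = ip ?S (\<lambda>x. \<phi> x * G x) (\<lambda>x. 1) + ip ?S (\<lambda>x. \<psi> x * F x) (\<lambda>x. 1)"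
        unfolding prim_right by (rule ip_add_left) (use i in auto)
      then show ?thesis by (simp add: ip_def mult.commute)
    qed
    moreover have "ip ?S F \<psi> = ip ?S (?P \<phi>) \<psi>" "ip ?S \<phi> G = ip ?S \<phi> (?P \<psi>)"
      by (auto intro!: ip_cong simp: PF PG)
    ultimately show ?thesis using F(2) G(2) PF[of b] PG[of b] ab by simp
  qed
  have conv: "(\<lambda>n. L2norm ?S (\<lambda>x. ?P (\<phi> n) x - ?P f x)) \<longlonglongrightarrow> 0"
    if "\<And>n. \<phi> n \<in> C1c ?S" "(\<lambda>n. L2norm ?S (\<lambda>x. \<phi> n x - f x)) \<longlonglongrightarrow> 0" "f \<in> L2 ?S" for \<phi> f
  proof (rule Lim_null_comparison)
    have "L2norm ?S (\<lambda>x. ?P (\<phi> n) x - ?P f x) \<le> (b - a) * L2norm ?S (\<lambda>x. \<phi> n x - f x)" for n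
      using L2norm_prim_le[OF L2_diff[OF C1c_L2[OF that(1)] that(3)] ab]
      by (simp add: prim_diff[OF C1c_L2[OF that(1)] that(3)] cong: L2norm_cong)
    then show "\<forall>\<^sub>F n in sequentially. norm (L2norm ?S (\<lambda>x. ?P (\<phi> n) x - ?P f x)) \<le> (b - a) * L2norm ?S (\<lambda>x. \<phi> n x - f x)"
      by simp
    show "(\<lambda>n. (b - a) * L2norm ?S (\<lambda>x. \<phi> n x - f x)) \<longlonglongrightarrow> 0"
      using tendsto_mult_left[OF that(2), of "b - a"] by simp
  qed
  have convb: "(\<lambda>n. ?P (\<phi> n) b) \<longlonglongrightarrow> ?P f b"
    if "\<And>n. \<phi> n \<in> C1c ?S" "(\<lambda>n. L2norm ?S (\<lambda>x. \<phi> n x - f x)) \<longlonglongrightarrow> 0" "f \<in> L2 ?S" for \<phi> f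
    unfolding prim_right by (rule tendsto_ip_left[OF that(3) C1c_L2[OF that(1)] that(2) L2_const])
  have "(\<lambda>n. ip ?S (?P (\<phi> n)) (\<psi> n) + ip ?S (\<phi> n) (?P (\<psi> n))) \<longlonglongrightarrow> ip ?S (?P f) g + ip ?S f (?P g)"
    by (intro tendsto_add tendsto_ip prim_L2 C1c_L2[OF \<phi>(1)] C1c_L2[OF \<psi>(1)] f g \<phi>(2) \<psi>(2)
        conv[OF \<phi> f] conv[OF \<psi> g])
  moreover have "(\<lambda>n. ?P (\<phi> n) b * ?P (\<psi> n) b) \<longlonglongrightarrow> ?P f b * ?P g b"
    by (intro tendsto_mult convb[OF \<phi> f] convb[OF \<psi> g])
  ultimately show ?thesis
    using smooth[OF \<phi>(1) \<psi>(1)] LIMSEQ_unique by (simp, blast)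
qed

text \<open>The functions \<open>c\<close> below are the continuous representatives of the elements of \<open>H\<^sup>1(]a,b[)\<close>, and \<open>g\<close> is
  their weak derivative.\<close>

definition ac :: "real \<Rightarrow> real \<Rightarrow> (real \<Rightarrow> real) \<Rightarrow> (real \<Rightarrow> real) \<Rightarrow> bool" where
  "ac a b c g \<longleftrightarrow> g \<in> L2 {a<..<b} \<and> (\<forall>y\<in>{a..b}. c y = c a + prim {a<..<b} g y)"

section \<open>Rules for absolutely continuous functions\<close>

lemma ac_L2_deriv: "ac a b c g \<Longrightarrow> g \<in> L2 {a<..<b}"
  unfolding ac_def by blast

lemma ac_eq: "ac a b c g \<Longrightarrow> y \<in> {a..b} \<Longrightarrow> c y = c a + prim {a<..<b} g y"
  unfolding ac_def by blast

lemma ac_continuous: "ac a b c g \<Longrightarrow> continuous_on {a..b} c"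
proof -
  assume c: "ac a b c g"
  have "continuous_on {a..b} (\<lambda>y. c a + prim {a<..<b} g y)"
    by (intro continuous_intros ac_L2_deriv[OF c])
  then show ?thesis
    by (rule continuous_on_eq) (rule ac_eq[OF c, symmetric])
qed

lemma ac_L2: "ac a b c g \<Longrightarrow> c \<in> L2 {a<..<b}"
  by (intro L2_continuous ac_continuous)

lemma ac_add: "ac a b c g \<Longrightarrow> ac a b d h \<Longrightarrow> ac a b (\<lambda>x. c x + d x) (\<lambda>x. g x + h x)"
proof -
  assume A: "ac a b c g" "ac a b d h"
  have "c y + d y = c a + d a + prim {a<..<b} (\<lambda>x. g x + h x) y" if "y \<in> {a..b}" for y
    using ac_eq[OF A(1) that] ac_eq[OF A(2) that] ac_L2_deriv[OF A(1)] ac_L2_deriv[OF A(2)]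
    by (simp only: prim_add)
  then show ?thesis using A unfolding ac_def by blast
qed

lemma ac_diff: "ac a b c g \<Longrightarrow> ac a b d h \<Longrightarrow> ac a b (\<lambda>x. c x - d x) (\<lambda>x. g x - h x)"
proof -
  assume A: "ac a b c g" "ac a b d h"
  have "c y - d y = c a - d a + prim {a<..<b} (\<lambda>x. g x - h x) y" if "y \<in> {a..b}" for y
    using ac_eq[OF A(1) that] ac_eq[OF A(2) that] ac_L2_deriv[OF A(1)] ac_L2_deriv[OF A(2)]
    by (simp only: prim_diff)
  then show ?thesis using A unfolding ac_def by blast
qed

lemma ac_scale: "ac a b c g \<Longrightarrow> ac a b (\<lambda>x. s * c x) (\<lambda>x. s * g x)"
proof -
  assume A: "ac a b c g"
  have "s * c y = s * c a + prim {a<..<b} (\<lambda>x. s * g x) y" if "y \<in> {a..b}" for y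
    using ac_eq[OF A that] by (simp only: prim_scale distrib_left)
  then show ?thesis using A unfolding ac_def by blast
qed

lemma ac_zero: "ac a b (\<lambda>x. 0) (\<lambda>x. 0)"
  by (simp add: ac_def prim_def ip_def)

lemma ac_sum: "(\<And>i. i \<in> I \<Longrightarrow> ac a b (c i) (g i)) \<Longrightarrow> ac a b (\<lambda>x. \<Sum>i\<in>I. c i x) (\<lambda>x. \<Sum>i\<in>I. g i x)"
  by (induction I rule: infinite_finite_induct) (auto intro: ac_zero ac_add)

lemma ac_cong_deriv: "ac a b c g \<Longrightarrow> AE x in lebesgue_on {a<..<b}. g x = h x \<Longrightarrow> h \<in> L2 {a<..<b} \<Longrightarrow> ac a b c h"
  unfolding ac_def using prim_cong_AE[where f = g and g = h] by metis

lemma ac_C1: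
  assumes "\<And>x. x \<in> {a..b} \<Longrightarrow> (f has_real_derivative f' x) (at x within {a..b})" "continuous_on {a..b} f'"
  shows "ac a b f f'"
  unfolding ac_def using prim_FTC[OF _ _ assms] L2_continuous[OF assms(2)] by auto

lemma ac_ibp:
  assumes c: "ac a b c g" and d: "ac a b d h" and ab: "a \<le> b"
  shows "ip {a<..<b} c h + ip {a<..<b} g d = c b * d b - c a * d a"
proof -
  let ?S = "{a<..<b}"
  note g = ac_L2_deriv[OF c] and h = ac_L2_deriv[OF d]
  have 1: "ip ?S c h = ip ?S (\<lambda>x. c a + prim ?S g x) h"
    by (rule ip_cong) (auto intro: ac_eq[OF c])
  have 2: "ip ?S g d = ip ?S g (\<lambda>x. d a + prim ?S h x)"
    by (rule ip_cong) (auto intro: ac_eq[OF d])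
  have k: "ip ?S (\<lambda>x. k) f = k * prim ?S f b" for k f
    unfolding prim_right by (simp add: ip_def)
  have "ip ?S c h + ip ?S g d = c a * prim ?S h b + d a * prim ?S g b + prim ?S g b * prim ?S h b"
    unfolding 1 2 using g h k[of "c a" h] k[of "d a" g] prim_ibp[OF g h ab]
    by (simp add: ip_add_left ip_add_right prim_L2 ip_commute[of ?S g "\<lambda>_. d a"])
  also have "\<dots> = c b * d b - c a * d a"
    using ac_eq[OF c, of b] ac_eq[OF d, of b] ab by (simp add: algebra_simps)
  finally show ?thesis .
qed

lemma C1c_ac: "\<phi> \<in> C1c S \<Longrightarrow> ac a b \<phi> (deriv \<phi>)"
  by (intro ac_C1 C1c_has_deriv C1c_continuous_deriv)

lemma ac_has_weak_deriv:
  assumes "ac a b c g" "a \<le> b" shows "has_weak_deriv {a<..<b} c g"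
  unfolding has_weak_deriv_def
proof
  fix \<phi> assume "\<phi> \<in> C1c {a<..<b}"
  then show "ip {a<..<b} c (deriv \<phi>) = - ip {a<..<b} g \<phi>"
    using ac_ibp[OF assms(1) C1c_ac[of \<phi> "{a<..<b}"] assms(2)]
    by (simp add: C1c_outside[of \<phi> "{a<..<b}" a] C1c_outside[of \<phi> "{a<..<b}" b])
qed

section \<open>Test functions with prescribed mean\<close>

lemma C1c_support:
  assumes "\<phi> \<in> C1c {a<..<b}" "a < b"
  obtains c d where "a < c" "c \<le> d" "d < b" "\<And>x. x \<notin> {c..d} \<Longrightarrow> \<phi> x = 0"
proof -
  obtain K where K: "compact K" "K \<subseteq> {a<..<b}" "\<And>x. x \<notin> K \<Longrightarrow> \<phi> x = 0"
    using assms(1) by (auto simp: C1c_def)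
  show thesis
  proof (cases "K = {}")
    case True
    then show thesis using K that[of "(a + b) / 2" "(a + b) / 2"] assms(2) by auto
  next
    case False
    obtain c where c: "c \<in> K" "\<And>x. x \<in> K \<Longrightarrow> c \<le> x"
      using compact_attains_inf[OF K(1) False] by blast
    obtain d where d: "d \<in> K" "\<And>x. x \<in> K \<Longrightarrow> x \<le> d"
      using compact_attains_sup[OF K(1) False] by blast
    show thesis
    proof (rule that[of c d])
      show "\<phi> x = 0" if "x \<notin> {c..d}" for x
        using K(3) c(2) d(2) that by (meson atLeastAtMost_iff)
    qed (use c d K(2) in auto)
  qed
qed

lemma C1c_diff: "\<phi> \<in> C1c S \<Longrightarrow> \<psi> \<in> C1c S \<Longrightarrow> (\<lambda>x. \<phi> x - c * \<psi> x) \<in> C1c S"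
proof -
  assume \<phi>: "\<phi> \<in> C1c S" and \<psi>: "\<psi> \<in> C1c S"
  have D: "((\<lambda>x. \<phi> x - c * \<psi> x) has_real_derivative deriv \<phi> x - c * deriv \<psi> x) (at x)" for x
    by (intro derivative_intros C1c_has_deriv[OF \<phi>] C1c_has_deriv[OF \<psi>])
       (rule DERIV_cmult[OF C1c_has_deriv[OF \<psi>]])
  then have "deriv (\<lambda>x. \<phi> x - c * \<psi> x) = (\<lambda>x. deriv \<phi> x - c * deriv \<psi> x)"
    by (intro ext DERIV_imp_deriv)
  moreover have "(\<lambda>x. \<phi> x - c * \<psi> x) differentiable_on UNIV"
    unfolding differentiable_on_def real_differentiable_def using D by blast
  moreover have "continuous_on UNIV (\<lambda>x. deriv \<phi> x - c * deriv \<psi> x)"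
    by (intro continuous_intros C1c_continuous_deriv[OF \<phi>] C1c_continuous_deriv[OF \<psi>])
  moreover obtain K L where "compact K" "K \<subseteq> S" "\<forall>x. x \<notin> K \<longrightarrow> \<phi> x = 0"
      "compact L" "L \<subseteq> S" "\<forall>x. x \<notin> L \<longrightarrow> \<psi> x = 0"
    using \<phi> \<psi> unfolding C1c_def by blast
  then have "\<exists>K. compact K \<and> K \<subseteq> S \<and> (\<forall>x. x \<notin> K \<longrightarrow> \<phi> x - c * \<psi> x = 0)"
    by (intro exI[of _ "K \<union> L"]) auto
  ultimately show ?thesis unfolding C1c_def by simp
qed

text \<open>A zero mean makes the antiderivative take the same constant value to the left and to the
  right of the support of \<eta>; subtracting that value restores compact support.\<close>

lemma C1c_antiderivative:
  assumes \<eta>: "\<eta> \<in> C1c {a<..<b}" and ab: "a < b" and 0: "ip {a<..<b} \<eta> (\<lambda>x. 1) = 0"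
  obtains \<phi> where "\<phi> \<in> C1c {a<..<b}" "deriv \<phi> = \<eta>"
proof -
  have "isCont \<eta> x" for x
    using C1c_continuous[OF \<eta>, of UNIV] by (simp add: continuous_on_eq_continuous_at)
  then obtain F where "\<And>x. (F has_vector_derivative \<eta> x) (at x)"
    using einterval_antiderivative[of "-\<infinity>" "\<infinity>" \<eta>] by auto
  then have F: "(F has_real_derivative \<eta> x) (at x within X)" for x X
    by (auto simp: has_real_derivative_iff_has_vector_derivative intro: has_vector_derivative_at_within)
  obtain c d where cd: "a < c" "c \<le> d" "d < b" "\<And>x. x \<notin> {c..d} \<Longrightarrow> \<eta> x = 0"
    using C1c_support[OF \<eta> ab] by metis
  have const: "F x = F y" if xy: "x < y" "\<And>z. x < z \<Longrightarrow> z < y \<Longrightarrow> \<eta> z = 0" for x y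
  proof -
    obtain z where "x < z" "z < y" "F y - F x = (y - x) * \<eta> z"
      using MVT2[OF xy(1), of F \<eta>] F by blast
    then show ?thesis using xy(2) by simp
  qed
  have "F b - F a = 0"
    using prim_FTC[of a b b F \<eta>] F C1c_continuous[OF \<eta>] ab 0 by (simp add: prim_right)
  moreover have "F x = F a" if "x < c" for x
  proof -
    have "\<eta> z = 0" if "z < c" for z using cd(4)[of z] that by simp
    then show ?thesis using const[of x a] const[of a x] cd(1) that by (metis less_trans linorder_neqE)
  qed
  moreover have "F x = F b" if "d < x" for x
  proof -
    have "\<eta> z = 0" if "d < z" for z using cd(4)[of z] that by simp
    then show ?thesis using const[of x b] const[of b x] cd(3) that by (metis less_trans linorder_neqE)
  qed
  ultimately have out: "F x - F a = 0" if "x \<notin> {c..d}" for x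
    using that by (metis atLeastAtMost_iff diff_self eq_iff_diff_eq_0 not_le)
  have D: "((\<lambda>x. F x - F a) has_real_derivative \<eta> x) (at x)" for x
    using F[of x UNIV] by (auto intro!: derivative_eq_intros)
  have "{c..d} \<subseteq> {a<..<b}" using cd(1-3) by auto
  with D C1c_continuous[OF \<eta>] out have "(\<lambda>x. F x - F a) \<in> C1c {a<..<b}" by (rule C1cI)
  moreover have "deriv (\<lambda>x. F x - F a) = \<eta>" using D by (intro ext DERIV_imp_deriv)
  ultimately show thesis by (rule that)
qed

text \<open>Test functions converging to 1 in L2 have means converging to b - a > 0, so one of them
  can be normalised and no explicit integral is computed.\<close>

lemma C1c_unit_mass:
  assumes "a < b"
  obtains \<zeta> where "\<zeta> \<in> C1c {a<..<b}" "ip {a<..<b} \<zeta> (\<lambda>x. 1) = 1"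
proof -
  let ?S = "{a<..<b}"
  obtain \<phi> where \<phi>: "\<And>n. \<phi> n \<in> C1c ?S" "(\<lambda>n. L2norm ?S (\<lambda>x. \<phi> n x - 1)) \<longlonglongrightarrow> 0"
    using C1c_dense[OF L2_const] by metis
  have "(\<lambda>n. ip ?S (\<phi> n) (\<lambda>x. 1)) \<longlonglongrightarrow> ip ?S (\<lambda>x. 1) (\<lambda>x. 1)"
    by (rule tendsto_ip_left[OF L2_const C1c_L2[OF \<phi>(1)] \<phi>(2) L2_const])
  moreover have "ip ?S (\<lambda>x. 1) (\<lambda>x. 1) = b - a"
    using assms L2norm_square[of ?S "\<lambda>x. 1"] by (simp add: L2norm_const)
  ultimately have "\<forall>\<^sub>F n in sequentially. 0 < ip ?S (\<phi> n) (\<lambda>x. 1)"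
    using assms by (auto intro: order_tendstoD)
  then obtain n where n: "0 < ip ?S (\<phi> n) (\<lambda>x. 1)" by (auto simp: eventually_sequentially)
  \<comment> \<open>With c = 1 and d = 0 the supporting interval is empty.\<close>
  have "(\<lambda>x. 0) \<in> C1c ?S" by (rule C1cI[where \<phi>' = "\<lambda>_. 0" and c=1 and d=0]) auto
  then have "(\<lambda>x. 0 - (- 1 / ip ?S (\<phi> n) (\<lambda>x. 1)) * \<phi> n x) \<in> C1c ?S"
    by (rule C1c_diff[OF _ \<phi>(1)])
  moreover have "ip ?S (\<lambda>x. 0 - (- 1 / ip ?S (\<phi> n) (\<lambda>x. 1)) * \<phi> n x) (\<lambda>x. 1) = 1"
    using ip_scale_left[of ?S "1 / ip ?S (\<phi> n) (\<lambda>x. 1)" "\<phi> n" "\<lambda>x. 1"] n by simp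
  ultimately show thesis by (rule that)
qed

text \<open>The difference v of u and the primitive of g has weak derivative 0. Subtracting from a
  test function its mean times a fixed unit mass \<zeta> leaves the derivative of a test function,
  so pairing with v sees only the mean, as pairing with a constant does. That constant is k =
  (v,\<zeta>).\<close>

lemma du_Bois_Reymond:
  assumes ab: "a < b" and u: "u \<in> L2 {a<..<b}" and g: "g \<in> L2 {a<..<b}"
    and w: "has_weak_deriv {a<..<b} u g"
  obtains k where "AE x in lebesgue_on {a<..<b}. u x = k + prim {a<..<b} g x"
proof -
  let ?S = "{a<..<b}"
  obtain \<zeta> where \<zeta>: "\<zeta> \<in> C1c ?S" "ip ?S \<zeta> (\<lambda>x. 1) = 1" using C1c_unit_mass[OF ab] by blast
  define v where "v x = u x - prim ?S g x" for x
  have v: "v \<in> L2 ?S" unfolding v_def by (intro L2_diff u prim_L2 g)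
  have "ac a b (prim ?S g) g" using g by (simp add: ac_def)
  then have "has_weak_deriv ?S (prim ?S g) g" using ab by (intro ac_has_weak_deriv) auto
  then have 0: "ip ?S v (deriv \<phi>) = 0" if "\<phi> \<in> C1c ?S" for \<phi>
    unfolding v_def using w that u prim_L2[OF g] C1c_deriv_L2[OF that, of a b]
    by (simp add: ip_diff_left has_weak_deriv_def)
  define k where "k = ip ?S v \<zeta>"
  have "AE x in lebesgue_on ?S. v x - k = 0"
  proof (rule fundamental_lemma)
    show "(\<lambda>x. v x - k) \<in> L2 ?S" using v by (intro L2_diff L2_const)
    fix \<eta> assume \<eta>: "\<eta> \<in> C1c ?S"
    define m where "m = ip ?S \<eta> (\<lambda>x. 1)"
    have \<eta>': "(\<lambda>x. \<eta> x - m * \<zeta> x) \<in> C1c ?S" by (rule C1c_diff[OF \<eta> \<zeta>(1)])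
    have s: "(\<lambda>x. m * \<zeta> x) \<in> L2 ?S" by (intro L2_scale C1c_L2[OF \<zeta>(1)])
    have "ip ?S (\<lambda>x. \<eta> x - m * \<zeta> x) (\<lambda>x. 1) = 0"
      using ip_diff_left[OF C1c_L2[OF \<eta>] s L2_const] \<zeta>(2) by (simp add: ip_scale_left m_def)
    then obtain \<phi> where "\<phi> \<in> C1c ?S" "deriv \<phi> = (\<lambda>x. \<eta> x - m * \<zeta> x)"
      using C1c_antiderivative[OF \<eta>' ab] by blast
    then have "ip ?S v (\<lambda>x. \<eta> x - m * \<zeta> x) = 0" using 0 by metis
    then have "ip ?S v \<eta> = m * k"
      using ip_diff_right[OF C1c_L2[OF \<eta>] s v] by (simp add: ip_scale_right k_def)
    moreover have "ip ?S (\<lambda>x. k) \<eta> = k * m" by (simp add: m_def ip_def)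
    ultimately show "ip ?S (\<lambda>x. v x - k) \<eta> = 0"
      using ip_diff_left[OF v L2_const C1c_L2[OF \<eta>]] by simp
  qed
  then have "AE x in lebesgue_on ?S. u x = k + prim ?S g x"
    by eventually_elim (simp add: v_def)
  then show thesis by (rule that)
qed

text \<open>The square of c - d is continuous with vanishing primitive, so a classical
  antiderivative of it is constant. The derivative of that antiderivative, which is the square
  itself, is then 0 at every point, end points included.\<close>

lemma continuous_AE_eq:
  fixes c d :: "real \<Rightarrow> real"
  assumes "a < b" "continuous_on {a..b} c" "continuous_on {a..b} d"
    and "AE x in lebesgue_on {a<..<b}. c x = d x" "y \<in> {a..b}"
  shows "c y = d y"
proof -
  let ?e = "\<lambda>x. (c x - d x)\<^sup>2"
  have ce: "continuous_on {a..b} ?e" by (intro continuous_intros assms)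
  have "prim {a<..<b} ?e z = 0" for z
  proof -
    have "AE x in lebesgue_on {a<..<b}. ?e x = 0" using assms(4) by eventually_elim simp
    then have "prim {a<..<b} ?e z = prim {a<..<b} (\<lambda>x. 0) z"
      by (rule prim_cong_AE[OF _ L2_continuous[OF ce] L2_zero])
    then show ?thesis by (simp add: prim_def ip_def)
  qed
  moreover obtain F where F: "\<And>x. x \<in> {a..b} \<Longrightarrow> (F has_real_derivative ?e x) (at x within {a..b})"
    using antiderivative_continuous[OF ce] by (auto simp: has_real_derivative_iff_has_vector_derivative)
  ultimately have Fc: "F z = F a" if "z \<in> {a..b}" for z
    using prim_FTC[OF _ _ F ce, of z] that by auto
  have "(F has_real_derivative 0) (at y within {a..b})"
    using has_field_derivative_transform_within[OF DERIV_const[of "F a"] zero_less_one assms(5), of F] Fc[symmetric]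
    by blast
  moreover have "at y within {a..b} \<noteq> bot"
    using assms(1,5) by (simp add: trivial_limit_within islimpt_Icc)
  ultimately have "?e y = 0"
    using F[OF assms(5)] has_field_derivative_unique by metis
  then show ?thesis by simp
qed

section \<open>Weak derivatives and continuous representatives\<close>

lemma weak_deriv_unique:
  assumes "has_weak_deriv {a<..<b} u g" "has_weak_deriv {a<..<b} u h" "g \<in> L2 {a<..<b}" "h \<in> L2 {a<..<b}"
  shows "AE x in lebesgue_on {a<..<b}. g x = h x"
proof -
  have "AE x in lebesgue_on {a<..<b}. g x - h x = 0"
  proof (rule fundamental_lemma)
    show "(\<lambda>x. g x - h x) \<in> L2 {a<..<b}" using assms by (intro L2_diff)
    fix \<phi> assume \<phi>: "\<phi> \<in> C1c {a<..<b}"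
    have "ip {a<..<b} g \<phi> = ip {a<..<b} h \<phi>"
      using assms(1,2) \<phi> unfolding has_weak_deriv_def by fastforce
    then show "ip {a<..<b} (\<lambda>x. g x - h x) \<phi> = 0"
      using ip_diff_left[OF assms(3,4) C1c_L2[OF \<phi>]] by simp
  qed
  then show ?thesis by eventually_elim simp
qed

text \<open>\<open>wD\<close> is chosen by \<open>SOME\<close> and is determined only up to null
  sets; comparisons with a concrete derivative g go through the almost-everywhere equality proved
  here.\<close>

lemma wD_works:
  assumes "g \<in> L2 {a<..<b}" "has_weak_deriv {a<..<b} u g"
  shows "wD {a<..<b} u \<in> L2 {a<..<b}" "has_weak_deriv {a<..<b} u (wD {a<..<b} u)"
    "AE x in lebesgue_on {a<..<b}. wD {a<..<b} u x = g x"
proof -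
  have *: "wD {a<..<b} u \<in> L2 {a<..<b} \<and> has_weak_deriv {a<..<b} u (wD {a<..<b} u)"
    unfolding wD_def by (rule someI[of _ g]) (use assms in simp)
  then show "wD {a<..<b} u \<in> L2 {a<..<b}" "has_weak_deriv {a<..<b} u (wD {a<..<b} u)" by auto
  show "AE x in lebesgue_on {a<..<b}. wD {a<..<b} u x = g x"
    using * assms by (intro weak_deriv_unique) auto
qed

lemma has_weak_deriv_cong_AE:
  assumes "has_weak_deriv {a<..<b} u g" "AE x in lebesgue_on {a<..<b}. u x = u' x"
    and "u \<in> L2 {a<..<b}" "u' \<in> L2 {a<..<b}"
  shows "has_weak_deriv {a<..<b} u' g"
  unfolding has_weak_deriv_def
proof
  fix \<phi> assume \<phi>: "\<phi> \<in> C1c {a<..<b}"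
  have "ip {a<..<b} u (deriv \<phi>) = ip {a<..<b} u' (deriv \<phi>)"
    by (rule ip_cong_AE[OF assms(2) _ assms(3,4) C1c_deriv_L2[OF \<phi>] C1c_deriv_L2[OF \<phi>]]) simp
  then show "ip {a<..<b} u' (deriv \<phi>) = - ip {a<..<b} g \<phi>"
    using assms(1) \<phi> by (simp add: has_weak_deriv_def)
qed

lemma Hs_L2: "u \<in> Hs m S \<Longrightarrow> u \<in> L2 S"
  by (cases m) auto

lemma Hs_cong_AE:
  "u \<in> Hs m {a<..<b} \<Longrightarrow> AE x in lebesgue_on {a<..<b}. u x = u' x \<Longrightarrow> u' \<in> L2 {a<..<b} \<Longrightarrow> u' \<in> Hs m {a<..<b}"
  by (cases m) (auto intro: has_weak_deriv_cong_AE)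

lemma Hs_Suc_wD:
  assumes "u \<in> Hs (Suc m) {a<..<b}"
  shows "wD {a<..<b} u \<in> Hs m {a<..<b}" "has_weak_deriv {a<..<b} u (wD {a<..<b} u)"
proof -
  obtain g where g: "g \<in> Hs m {a<..<b}" "has_weak_deriv {a<..<b} u g"
    using assms by auto
  note w = wD_works[OF Hs_L2[OF g(1)] g(2)]
  show "has_weak_deriv {a<..<b} u (wD {a<..<b} u)" by (rule w(2))
  have "AE x in lebesgue_on {a<..<b}. g x = wD {a<..<b} u x" using w(3) by eventually_elim simp
  then show "wD {a<..<b} u \<in> Hs m {a<..<b}" by (rule Hs_cong_AE[OF g(1) _ w(1)])
qed

lemma wD_iter_Hs: "u \<in> Hs (i + m) {a<..<b} \<Longrightarrow> (wD {a<..<b} ^^ i) u \<in> Hs m {a<..<b}"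
proof (induction i arbitrary: m)
  case (Suc i)
  have "u \<in> Hs (i + Suc m) {a<..<b}" using Suc.prems by (simp only: add_Suc_right add_Suc)
  then have "(wD {a<..<b} ^^ i) u \<in> Hs (Suc m) {a<..<b}" by (rule Suc.IH)
  then show ?case using Hs_Suc_wD(1) by simp
qed simp

lemma Hnorm_nonneg [simp]: "0 \<le> Hnorm m S u"
  by (simp add: Hnorm_def sum_nonneg)

lemma L2norm_wD_le_Hnorm: "j \<le> m \<Longrightarrow> L2norm S ((wD S ^^ j) u) \<le> Hnorm m S u"
  unfolding Hnorm_def
  by (rule real_le_rsqrt) (rule member_le_sum[of j "{..m}" "\<lambda>j. (L2norm S ((wD S ^^ j) u))\<^sup>2"], auto)

lemma Hs_rep:
  assumes "u \<in> Hs (Suc m) {a<..<b}" "a < b"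
  obtains c where "ac a b c (wD {a<..<b} u)" "AE x in lebesgue_on {a<..<b}. u x = c x"
proof -
  note w = Hs_Suc_wD[OF assms(1)]
  obtain k where "AE x in lebesgue_on {a<..<b}. u x = k + prim {a<..<b} (wD {a<..<b} u) x"
    using du_Bois_Reymond[OF assms(2) Hs_L2[OF assms(1)] Hs_L2[OF w(1)] w(2)] by blast
  moreover have "ac a b (\<lambda>x. k + prim {a<..<b} (wD {a<..<b} u) x) (wD {a<..<b} u)"
    unfolding ac_def using Hs_L2[OF w(1)] by simp
  ultimately show thesis using that by blast
qed

lemma ac_wD:
  assumes "ac a b c g" "a \<le> b" "AE x in lebesgue_on {a<..<b}. u x = c x" "u \<in> L2 {a<..<b}"
  shows "u \<in> Hs 1 {a<..<b}" "AE x in lebesgue_on {a<..<b}. wD {a<..<b} u x = g x" "wD {a<..<b} u \<in> L2 {a<..<b}"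
proof -
  have "AE x in lebesgue_on {a<..<b}. c x = u x" using assms(3) by eventually_elim simp
  then have w: "has_weak_deriv {a<..<b} u g"
    by (rule has_weak_deriv_cong_AE[OF ac_has_weak_deriv[OF assms(1,2)] _ ac_L2[OF assms(1)] assms(4)])
  note g = ac_L2_deriv[OF assms(1)]
  show "u \<in> Hs 1 {a<..<b}" using w g assms(4) by auto
  show "AE x in lebesgue_on {a<..<b}. wD {a<..<b} u x = g x" "wD {a<..<b} u \<in> L2 {a<..<b}"
    using wD_works[OF g w] by auto
qed

lemma ac_wD_self:
  assumes "ac a b c g" "a \<le> b"
  shows "c \<in> Hs 1 {a<..<b}" "AE x in lebesgue_on {a<..<b}. wD {a<..<b} c x = g x" "wD {a<..<b} c \<in> L2 {a<..<b}"
  using ac_wD[OF assms _ ac_L2[OF assms(1)]] by auto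

lemma ac_bound_norm:
  assumes "ac a b c g" "a \<le> b" "c a = 0"
  shows "L2norm {a<..<b} c \<le> (b - a) * L2norm {a<..<b} g"
proof -
  have "L2norm {a<..<b} c = L2norm {a<..<b} (prim {a<..<b} g)"
    by (rule L2norm_cong) (use ac_eq[OF assms(1)] assms(3) in auto)
  then show ?thesis using L2norm_prim_le[OF ac_L2_deriv[OF assms(1)] assms(2)] by simp
qed

section \<open>Functions vanishing at both end points\<close>

lemma Hnorm_1: "Hnorm 1 S u = sqrt ((L2norm S u)\<^sup>2 + (L2norm S (wD S u))\<^sup>2)"
  by (simp add: Hnorm_def)

text \<open>Subtracting a test function does not change the boundary term c(b)w(b) - c(a)w(a), and
  by parts this term is at most the H1 norm of \<open>u - \<phi> n\<close> times a constant, which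
  tends to 0.\<close>

lemma H10_rep:
  assumes u: "u \<in> H10 {a<..<b}" and ab: "a < b"
  obtains c where "ac a b c (wD {a<..<b} u)" "AE x in lebesgue_on {a<..<b}. u x = c x" "c a = 0" "c b = 0"
proof -
  let ?S = "{a<..<b}"
  obtain \<phi> where uH: "u \<in> Hs 1 ?S" and \<phi>: "\<And>n. \<phi> n \<in> C1c ?S"
    and lim: "(\<lambda>n. Hnorm 1 ?S (\<lambda>x. u x - \<phi> n x)) \<longlonglongrightarrow> 0"
    using u unfolding H10_def by blast
  obtain c where c: "ac a b c (wD ?S u)" "AE x in lebesgue_on ?S. u x = c x"
    using Hs_rep[OF uH[unfolded One_nat_def] ab] by blast
  have key: "c b * w b - c a * w a = 0" if w: "ac a b w w'" for w w'
  proof -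
    note L = ac_L2[OF w] ac_L2_deriv[OF w]
    have eq: "ip ?S (\<lambda>x. u x - \<phi> n x) w' + ip ?S (wD ?S (\<lambda>x. u x - \<phi> n x)) w = c b * w b - c a * w a"
      and L2s: "(\<lambda>x. u x - \<phi> n x) \<in> L2 ?S" "wD ?S (\<lambda>x. u x - \<phi> n x) \<in> L2 ?S" for n
    proof -
      have d: "ac a b (\<lambda>x. c x - \<phi> n x) (\<lambda>x. wD ?S u x - deriv (\<phi> n) x)"
        by (intro ac_diff c C1c_ac[OF \<phi>])
      have ae: "AE x in lebesgue_on ?S. u x - \<phi> n x = c x - \<phi> n x"
        using c(2) by eventually_elim simp
      show uL: "(\<lambda>x. u x - \<phi> n x) \<in> L2 ?S" by (intro L2_diff Hs_L2[OF uH] C1c_L2[OF \<phi>])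
      note a = ac_wD[OF d less_imp_le[OF ab] ae uL]
      show "wD ?S (\<lambda>x. u x - \<phi> n x) \<in> L2 ?S" by (rule a(3))
      have "ip ?S (\<lambda>x. u x - \<phi> n x) w' = ip ?S (\<lambda>x. c x - \<phi> n x) w'"
        by (rule ip_cong_AE[OF ae _ uL ac_L2[OF d] L(2) L(2)]) simp
      moreover have "ip ?S (wD ?S (\<lambda>x. u x - \<phi> n x)) w = ip ?S (\<lambda>x. wD ?S u x - deriv (\<phi> n) x) w"
        by (rule ip_cong_AE[OF a(2) _ a(3) ac_L2_deriv[OF d] L(1) L(1)]) simp
      moreover have "\<phi> n a = 0" "\<phi> n b = 0" using C1c_outside[OF \<phi>] by auto
      ultimately show "ip ?S (\<lambda>x. u x - \<phi> n x) w' + ip ?S (wD ?S (\<lambda>x. u x - \<phi> n x)) w = c b * w b - c a * w a"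
        using ac_ibp[OF d w less_imp_le[OF ab]] by simp
    qed
    have "\<bar>c b * w b - c a * w a\<bar> \<le> Hnorm 1 ?S (\<lambda>x. u x - \<phi> n x) * (L2norm ?S w' + L2norm ?S w)" for n
    proof -
      have "L2norm ?S (\<lambda>x. u x - \<phi> n x) \<le> Hnorm 1 ?S (\<lambda>x. u x - \<phi> n x)"
        "L2norm ?S (wD ?S (\<lambda>x. u x - \<phi> n x)) \<le> Hnorm 1 ?S (\<lambda>x. u x - \<phi> n x)"
        using L2norm_wD_le_Hnorm[of 0 1 ?S "\<lambda>x. u x - \<phi> n x"] L2norm_wD_le_Hnorm[of 1 1 ?S "\<lambda>x. u x - \<phi> n x"]
        by simp_all
      then have "L2norm ?S (\<lambda>x. u x - \<phi> n x) * L2norm ?S w' \<le> Hnorm 1 ?S (\<lambda>x. u x - \<phi> n x) * L2norm ?S w'"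
        "L2norm ?S (wD ?S (\<lambda>x. u x - \<phi> n x)) * L2norm ?S w \<le> Hnorm 1 ?S (\<lambda>x. u x - \<phi> n x) * L2norm ?S w"
        by (auto intro: mult_right_mono)
      then show ?thesis
        using ip_Cauchy_Schwarz[OF L2s(1)[of n] L(2)] ip_Cauchy_Schwarz[OF L2s(2)[of n] L(1)] eq[of n]
        unfolding distrib_left by linarith
    qed
    moreover have "(\<lambda>n. Hnorm 1 ?S (\<lambda>x. u x - \<phi> n x) * (L2norm ?S w' + L2norm ?S w)) \<longlonglongrightarrow> 0"
      by (rule tendsto_mult_left_zero[OF lim])
    ultimately have "\<bar>c b * w b - c a * w a\<bar> \<le> 0"
      by (intro LIMSEQ_le_const[of _ 0]) auto
    then show ?thesis by simp
  qed
  \<comment> \<open>The weights x - a and x - b each vanish at one end and so isolate the value of c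
    at the other.\<close>
  have 1: "ac a b (\<lambda>x. x - k) (\<lambda>x. 1)" for k
    by (rule ac_C1) (auto intro!: derivative_eq_intros)
  have "c b = 0" "c a = 0" using key[OF 1, of a] key[OF 1, of b] ab by auto
  with c show thesis using that by blast
qed

text \<open>Approximating g by test functions \<psi> is not enough, because a primitive of \<psi>
  has compact support only if its mean is 0. The means \<open>m n\<close> tend to c(b) - c(a) = 0,
  so subtracting \<open>m n\<close> times a fixed unit mass corrects them at vanishing cost.\<close>

lemma H10_I:
  assumes c: "ac a b c g" and ab: "a < b" and 0: "c a = 0" "c b = 0"
  shows "c \<in> H10 {a<..<b}"
proof -
  let ?S = "{a<..<b}"
  have le: "a \<le> b" using ab by simp
  note g = ac_L2_deriv[OF c]
  obtain \<psi> where \<psi>: "\<And>n. \<psi> n \<in> C1c ?S" "(\<lambda>n. L2norm ?S (\<lambda>x. \<psi> n x - g x)) \<longlonglongrightarrow> 0"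
    using C1c_dense[OF g] by metis
  obtain \<zeta> where \<zeta>: "\<zeta> \<in> C1c ?S" "ip ?S \<zeta> (\<lambda>x. 1) = 1" using C1c_unit_mass[OF ab] by blast
  define m where "m n = ip ?S (\<psi> n) (\<lambda>x. 1)" for n
  have "m \<longlonglongrightarrow> ip ?S g (\<lambda>x. 1)"
    unfolding m_def by (rule tendsto_ip_left[OF g C1c_L2[OF \<psi>(1)] \<psi>(2) L2_const])
  moreover have "ip ?S g (\<lambda>x. 1) = 0"
    using ac_eq[OF c, of b] 0 ab by (simp add: prim_right)
  ultimately have m0: "m \<longlonglongrightarrow> 0" by simp
  have "\<exists>\<phi>\<in>C1c ?S. deriv \<phi> = (\<lambda>x. \<psi> n x - m n * \<zeta> x)" for n
  proof -
    have "(\<lambda>x. \<psi> n x - m n * \<zeta> x) \<in> C1c ?S" by (rule C1c_diff[OF \<psi>(1) \<zeta>(1)])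
    moreover have "ip ?S (\<lambda>x. \<psi> n x - m n * \<zeta> x) (\<lambda>x. 1) = 0"
      using ip_diff_left[OF C1c_L2[OF \<psi>(1)[of n]] L2_scale[OF C1c_L2[OF \<zeta>(1)]] L2_const] \<zeta>(2)
      by (simp add: ip_scale_left m_def)
    ultimately show ?thesis using C1c_antiderivative[OF _ ab] by metis
  qed
  then obtain \<phi> where \<phi>: "\<And>n. \<phi> n \<in> C1c ?S" "\<And>n. deriv (\<phi> n) = (\<lambda>x. \<psi> n x - m n * \<zeta> x)"
    by metis
  have "(\<lambda>n. Hnorm 1 ?S (\<lambda>x. c x - \<phi> n x)) \<longlonglongrightarrow> 0"
  proof -
    define e where "e n = L2norm ?S (\<lambda>x. \<psi> n x - g x) + \<bar>m n\<bar> * L2norm ?S \<zeta>" for n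
    have e0: "e \<longlonglongrightarrow> 0"
      using tendsto_add[OF \<psi>(2) tendsto_mult[OF tendsto_rabs[OF m0] tendsto_const[of "L2norm ?S \<zeta>"]]]
      by (simp add: e_def[abs_def])
    \<comment> \<open>The factor b - a is the Poincare constant for functions vanishing at a; the 1
      accounts for the derivative.\<close>
    have le2: "Hnorm 1 ?S (\<lambda>x. c x - \<phi> n x) \<le> (b - a + 1) * e n" for n
    proof -
      have d: "ac a b (\<lambda>x. c x - \<phi> n x) (\<lambda>x. g x - deriv (\<phi> n) x)"
        by (intro ac_diff c C1c_ac[OF \<phi>(1)])
      have "L2norm ?S (wD ?S (\<lambda>x. c x - \<phi> n x)) = L2norm ?S (\<lambda>x. g x - deriv (\<phi> n) x)"
        using ac_wD_self[OF d le] ac_L2_deriv[OF d] by (intro L2norm_cong_AE)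
      moreover have "L2norm ?S (\<lambda>x. g x - deriv (\<phi> n) x) \<le> e n"
      proof -
        have "L2norm ?S (\<lambda>x. (g x - \<psi> n x) + m n * \<zeta> x) \<le> L2norm ?S (\<lambda>x. g x - \<psi> n x) + L2norm ?S (\<lambda>x. m n * \<zeta> x)"
          by (intro L2norm_triangle L2_diff g C1c_L2[OF \<psi>(1)] L2_scale C1c_L2[OF \<zeta>(1)])
        also have "\<dots> = e n" by (simp add: e_def L2norm_scale L2norm_minus_commute[of ?S g])
        finally show ?thesis by (simp add: \<phi>(2) algebra_simps)
      qed
      ultimately have 1: "L2norm ?S (wD ?S (\<lambda>x. c x - \<phi> n x)) \<le> e n" and
        2: "L2norm ?S (\<lambda>x. g x - deriv (\<phi> n) x) \<le> e n" by simp_all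
      have "L2norm ?S (\<lambda>x. c x - \<phi> n x) \<le> (b - a) * L2norm ?S (\<lambda>x. g x - deriv (\<phi> n) x)"
        using C1c_outside[OF \<phi>(1)[of n], of a] 0 by (intro ac_bound_norm[OF d le]) simp
      also have "\<dots> \<le> (b - a) * e n" using 2 ab by (intro mult_left_mono) auto
      finally have 3: "L2norm ?S (\<lambda>x. c x - \<phi> n x) \<le> (b - a) * e n" .
      have "Hnorm 1 ?S (\<lambda>x. c x - \<phi> n x) \<le> L2norm ?S (\<lambda>x. c x - \<phi> n x) + L2norm ?S (wD ?S (\<lambda>x. c x - \<phi> n x))"
        unfolding Hnorm_1 by (rule sqrt_sum_squares_le_sum) auto
      also have "\<dots> \<le> (b - a) * e n + e n" using 1 3 by (rule add_mono[rotated])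
      finally show ?thesis by (simp add: algebra_simps)
    qed
    show ?thesis
    proof (rule Lim_null_comparison)
      show "\<forall>\<^sub>F n in sequentially. norm (Hnorm 1 ?S (\<lambda>x. c x - \<phi> n x)) \<le> (b - a + 1) * e n"
        using le2 by (intro always_eventually) (simp add: abs_of_nonneg)
      show "(\<lambda>n. (b - a + 1) * e n) \<longlonglongrightarrow> 0" by (rule tendsto_mult_right_zero[OF e0])
    qed
  qed
  then show ?thesis
    unfolding H10_def using ac_wD_self(1)[OF c le] \<phi>(1) by blast
qed

text \<open>On [a,b] the function c differs by a constant from a classical antiderivative of
  d.\<close>

lemma ac_has_real_derivative:
  assumes c: "ac a b c g" and d: "continuous_on {a..b} d"
    and ae: "AE x in lebesgue_on {a<..<b}. g x = d x" and x: "x \<in> {a..b}"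
  shows "(c has_real_derivative d x) (at x within {a..b})"
proof -
  obtain F where F: "\<And>x. x \<in> {a..b} \<Longrightarrow> (F has_real_derivative d x) (at x within {a..b})"
    using antiderivative_continuous[OF d] by (auto simp: has_real_derivative_iff_has_vector_derivative)
  have eq: "c a + (F y - F a) = c y" if "y \<in> {a..b}" for y
  proof -
    have "c y = c a + prim {a<..<b} d y"
      using ac_eq[OF c that] prim_cong_AE[OF ae ac_L2_deriv[OF c] L2_continuous[OF d]] by simp
    then show ?thesis using prim_FTC[OF _ _ F d, of y] that by simp
  qed
  have "((\<lambda>y. c a + (F y - F a)) has_real_derivative d x) (at x within {a..b})"
    using F[OF x] by (auto intro!: derivative_eq_intros)
  then show ?thesis
    by (rule has_field_derivative_transform_within[OF _ zero_less_one x]) (rule eq)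
qed

text \<open>Sobolev regularity k + 1 becomes k classical derivatives, the last of which,
  \<open>C k\<close>, is absolutely continuous: the form in which Rolle's theorem and the Hoelder
  estimate apply.\<close>

lemma Hs_rep_chain:
  assumes u: "u \<in> Hs (Suc k) {a<..<b}" and ab: "a < b"
  obtains C where "\<And>j. j \<le> k \<Longrightarrow> ac a b (C j) ((wD {a<..<b} ^^ Suc j) u)"
    "\<And>j. j \<le> k \<Longrightarrow> AE x in lebesgue_on {a<..<b}. (wD {a<..<b} ^^ j) u x = C j x"
    "\<And>j x. j < k \<Longrightarrow> x \<in> {a..b} \<Longrightarrow> (C j has_real_derivative C (Suc j) x) (at x within {a..b})"
proof -
  let ?S = "{a<..<b}"
  have "\<exists>c. ac a b c ((wD ?S ^^ Suc j) u) \<and> (AE x in lebesgue_on ?S. (wD ?S ^^ j) u x = c x)" if "j \<le> k" for j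
  proof -
    have "j + Suc (k - j) = Suc k" using that by simp
    then have "u \<in> Hs (j + Suc (k - j)) ?S" using u by (simp only:)
    then have "(wD ?S ^^ j) u \<in> Hs (Suc (k - j)) ?S" by (rule wD_iter_Hs)
    then obtain c where "ac a b c (wD ?S ((wD ?S ^^ j) u))" "AE x in lebesgue_on ?S. (wD ?S ^^ j) u x = c x"
      by (rule Hs_rep[OF _ ab])
    then show ?thesis unfolding funpow.simps o_apply by blast
  qed
  then obtain C where C: "\<And>j. j \<le> k \<Longrightarrow> ac a b (C j) ((wD ?S ^^ Suc j) u)"
    "\<And>j. j \<le> k \<Longrightarrow> AE x in lebesgue_on ?S. (wD ?S ^^ j) u x = C j x"
    by metis
  have "(C j has_real_derivative C (Suc j) x) (at x within {a..b})" if "j < k" "x \<in> {a..b}" for j x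
    using that by (intro ac_has_real_derivative[OF C(1) ac_continuous[OF C(1)] C(2)]) auto
  with C show thesis by (rule that)
qed

section \<open>Finite element spaces\<close>

lemma partition_less: "is_partition n x \<Longrightarrow> i < j \<Longrightarrow> j \<le> n \<Longrightarrow> x i < x j"
proof (induction j)
  case (Suc j)
  then have "x j < x (Suc j)" by (simp add: is_partition_def)
  then show ?case using Suc by (cases "i = j") auto
qed simp

lemma partition_le: "is_partition n x \<Longrightarrow> i \<le> j \<Longrightarrow> j \<le> n \<Longrightarrow> x i \<le> x j"
  using partition_less[of n x i j] by (cases "i = j") auto

lemma partition_range: "is_partition n x \<Longrightarrow> j \<le> n \<Longrightarrow> 0 \<le> x j \<and> x j \<le> 1"
  using partition_le[of n x 0 j] partition_le[of n x j n] by (auto simp: is_partition_def)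

text \<open>Elements open on the left and closed on the right are disjoint, so together with
  \<open>partition_piece_unique\<close> sums over elements need no correction at break
  points.\<close>

lemma partition_cover:
  assumes "is_partition n x" "0 < y" "y \<le> 1"
  obtains j where "j < n" "x j < y" "y \<le> x (Suc j)"
proof -
  have "\<exists>j<m. x j < y \<and> y \<le> x (Suc j)" if "m \<le> n" "y \<le> x m" for m
    using that
  proof (induction m)
    case 0
    then show ?case using assms by (simp add: is_partition_def)
  next
    case (Suc m)
    then show ?case by (cases "y \<le> x m") (auto intro: less_SucI)
  qed
  from this[of n] show thesis using assms that by (auto simp: is_partition_def)
qed

lemma partition_cover_closed:
  assumes "is_partition n x" "y \<in> {0..1}"
  obtains j where "j < n" "y \<in> {x j..x (Suc j)}"
proof (cases "y = 0")
  case True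
  have "0 < n" "x 0 = 0" using assms(1) by (auto simp: is_partition_def)
  moreover have "0 \<le> x (Suc 0)" using partition_range[OF assms(1), of "Suc 0"] \<open>0 < n\<close> by simp
  ultimately show thesis using True by (intro that[of 0]) auto
next
  case False
  then show thesis using partition_cover[OF assms(1), of y] assms(2) that by force
qed

lemma partition_piece_unique:
  assumes "is_partition n x" "i < n" "j < n" "x i < y" "y \<le> x (Suc i)" "x j < y" "y \<le> x (Suc j)"
  shows "i = j"
proof (rule ccontr)
  assume "i \<noteq> j"
  then consider "Suc i \<le> j" | "Suc j \<le> i" by linarith
  then show False
    using partition_le[OF assms(1), of "Suc i" j] partition_le[OF assms(1), of "Suc j" i] assms
    by cases auto
qed

lemma mesh_ge: "j < n \<Longrightarrow> x (Suc j) - x j \<le> mesh n x"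
  unfolding mesh_def by (rule Max_ge) auto

lemma mesh_pos: "is_partition n x \<Longrightarrow> 0 < mesh n x"
  using mesh_ge[of 0 n x] partition_less[of n x 0 1] by (auto simp: is_partition_def)

lemma Sh_zero: "(\<lambda>y. 0) \<in> Sh k n x"
  by (auto simp: Sh_def intro!: exI[of _ "0 :: real poly"])

lemma Sh_add: "W \<in> Sh k n x \<Longrightarrow> Z \<in> Sh k n x \<Longrightarrow> (\<lambda>y. W y + Z y) \<in> Sh k n x"
  unfolding Sh_def
proof (intro CollectI conjI allI impI; elim CollectE conjE)
  fix j
  assume "\<forall>j<n. \<exists>p. degree p \<le> k \<and> (\<forall>y\<in>{x j..x (Suc j)}. W y = poly p y)"
    "\<forall>j<n. \<exists>p. degree p \<le> k \<and> (\<forall>y\<in>{x j..x (Suc j)}. Z y = poly p y)" "j < n"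
  then obtain p q where "degree p \<le> k" "\<forall>y\<in>{x j..x (Suc j)}. W y = poly p y"
    "degree q \<le> k" "\<forall>y\<in>{x j..x (Suc j)}. Z y = poly q y" by meson
  then show "\<exists>p. degree p \<le> k \<and> (\<forall>y\<in>{x j..x (Suc j)}. W y + Z y = poly p y)"
    by (intro exI[of _ "p + q"]) (auto intro: degree_add_le)
qed (auto intro: continuous_on_add)

lemma Sh_scale: "W \<in> Sh k n x \<Longrightarrow> (\<lambda>y. c * W y) \<in> Sh k n x"
  unfolding Sh_def
proof (intro CollectI conjI allI impI; elim CollectE conjE)
  fix j
  assume "\<forall>j<n. \<exists>p. degree p \<le> k \<and> (\<forall>y\<in>{x j..x (Suc j)}. W y = poly p y)" "j < n"
  then obtain p where "degree p \<le> k" "\<forall>y\<in>{x j..x (Suc j)}. W y = poly p y" by meson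
  then show "\<exists>p. degree p \<le> k \<and> (\<forall>y\<in>{x j..x (Suc j)}. c * W y = poly p y)"
    by (intro exI[of _ "smult c p"]) (auto intro: order_trans[OF degree_smult_le])
qed (auto intro: continuous_on_mult_left)

lemma Sh_diff: "W \<in> Sh k n x \<Longrightarrow> Z \<in> Sh k n x \<Longrightarrow> (\<lambda>y. W y - Z y) \<in> Sh k n x"
  using Sh_add[of W k n x "\<lambda>y. (-1) * Z y"] Sh_scale[of Z k n x "-1"] by simp

lemma Sh_sum: "(\<And>i. i \<in> I \<Longrightarrow> W i \<in> Sh k n x) \<Longrightarrow> (\<lambda>y. \<Sum>i\<in>I. W i y) \<in> Sh k n x"
  by (induction I rule: infinite_finite_induct) (auto intro: Sh_zero Sh_add)

text \<open>\<open>J\<close> sends a point to the first element containing it. Continuity comes from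
  pasting over the finite closed cover by elements; the matching condition makes the value at a
  break point independent of the element chosen.\<close>

lemma Sh_glue:
  assumes part: "is_partition n x" and deg: "\<And>j. j < n \<Longrightarrow> degree (p j) \<le> k"
    and match: "\<And>j. Suc j < n \<Longrightarrow> poly (p j) (x (Suc j)) = poly (p (Suc j)) (x (Suc j))"
    and bd: "poly (p 0) 0 = 0" "poly (p (n - 1)) 1 = 0"
  obtains W where "W \<in> Sh k n x" "\<And>j y. j < n \<Longrightarrow> y \<in> {x j..x (Suc j)} \<Longrightarrow> W y = poly (p j) y"
proof -
  define J where "J y = (LEAST j. j < n \<and> y \<le> x (Suc j))" for y
  define W where "W y = poly (p (J y)) y" for y
  have n: "0 < n" "x 0 = 0" "x n = 1" using part by (auto simp: is_partition_def)
  have eq: "W y = poly (p j) y" if j: "j < n" "y \<in> {x j..x (Suc j)}" for j y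
  proof -
    have Jy: "J y < n \<and> y \<le> x (Suc (J y))" unfolding J_def
      by (rule LeastI[of _ j]) (use j in auto)
    have le: "J y \<le> j" unfolding J_def by (rule Least_le) (use j in auto)
    show ?thesis
    proof (cases "J y = j")
      case False
      then have lt: "J y < j" using le by simp
      then have "x (Suc (J y)) \<le> x j" using j by (intro partition_le[OF part]) auto
      \<comment> \<open>A point lying in two elements is a common break point, and strict
        monotonicity forces the two elements to be neighbours.\<close>
      then have y: "y = x (Suc (J y))" "y = x j" using Jy j by auto
      have "Suc (J y) = j"
        using partition_less[OF part, of "Suc (J y)" j] y lt j by (cases "Suc (J y) = j") auto
      then show ?thesis using match[of "J y"] y(1) j unfolding W_def by metis
    qed (simp add: W_def)
  qed
  have U: "{0..1} = (\<Union>j\<in>{..<n}. {x j..x (Suc j)})"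
  proof
    show "{0..1} \<subseteq> (\<Union>j\<in>{..<n}. {x j..x (Suc j)})"
      using partition_cover_closed[OF part] by blast
    show "(\<Union>j\<in>{..<n}. {x j..x (Suc j)}) \<subseteq> {0..1}"
    proof
      fix y assume "y \<in> (\<Union>j\<in>{..<n}. {x j..x (Suc j)})"
      then obtain j where "j < n" "x j \<le> y" "y \<le> x (Suc j)" by auto
      then show "y \<in> {0..1}"
        using partition_range[OF part, of j] partition_range[OF part, of "Suc j"] by auto
    qed
  qed
  have "continuous_on (\<Union>j\<in>{..<n}. {x j..x (Suc j)}) W"
  proof (rule continuous_on_closed_Union)
    fix j assume "j \<in> {..<n}"
    then show "continuous_on {x j..x (Suc j)} W"
      using eq[of j] continuous_on_poly[OF continuous_on_id, of "{x j..x (Suc j)}" "p j"]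
      by (intro continuous_on_eq[of _ "poly (p j)" W]) auto
  qed auto
  then have "continuous_on {0..1} W" by (simp only: U)
  moreover have "W 0 = 0" using eq[of 0 0] n bd partition_less[OF part, of 0 "Suc 0"] by simp
  moreover have "W 1 = 0"
    using eq[of "n - 1" 1] n bd partition_less[OF part, of "n - 1" n] by simp
  ultimately have "W \<in> Sh k n x" unfolding Sh_def using eq deg by blast
  with eq show thesis using that by blast
qed

text \<open>The fundamental theorem applies on each element. Consecutive elements share the value of
  W at their break point, so the increments telescope and W is a primitive of its piecewise
  derivative.\<close>

lemma Sh_pieces:
  assumes W: "W \<in> Sh k n x" and part: "is_partition n x"
  obtains p g where "\<And>j. j < n \<Longrightarrow> degree (p j) \<le> k"
    "\<And>j y. j < n \<Longrightarrow> y \<in> {x j..x (Suc j)} \<Longrightarrow> W y = poly (p j) y"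
    "ac 0 1 W g" "\<And>j y. j < n \<Longrightarrow> y \<in> {x j<..x (Suc j)} \<Longrightarrow> g y = poly (pderiv (p j)) y"
proof -
  obtain p where p: "\<And>j. j < n \<Longrightarrow> degree (p j) \<le> k"
    "\<And>j y. j < n \<Longrightarrow> y \<in> {x j..x (Suc j)} \<Longrightarrow> W y = poly (p j) y"
  proof -
    have "\<forall>j<n. \<exists>p. degree p \<le> k \<and> (\<forall>y\<in>{x j..x (Suc j)}. W y = poly p y)"
      using W unfolding Sh_def by blast
    then show thesis using that by metis
  qed
  define g where "g y = (\<Sum>j<n. poly (pderiv (p j)) y * indicator {x j<..x (Suc j)} y)" for y
  have g: "g \<in> L2 Om"
    unfolding g_def
    by (intro L2_sum L2_mult_indicator[OF L2_continuous]) (auto intro: continuous_on_poly)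
  have geq: "g y = poly (pderiv (p j)) y" if j: "j < n" "y \<in> {x j<..x (Suc j)}" for j y
  proof -
    have "poly (pderiv (p i)) y * indicator {x i<..x (Suc i)} y = 0" if "i \<in> {..<n} - {j}" for i
      using partition_piece_unique[OF part, of i j y] j that by (auto simp: indicator_def)
    then have "g y = (\<Sum>i\<in>{j}. poly (pderiv (p i)) y * indicator {x i<..x (Suc i)} y)"
      unfolding g_def using j by (intro sum.mono_neutral_right) auto
    then show ?thesis using j by (simp add: indicator_def)
  qed
  have step: "prim Om g y - prim Om g (x j) = W y - W (x j)" if j: "j < n" "y \<in> {x j..x (Suc j)}" for j y
  proof -
    have r: "0 \<le> x j" "x (Suc j) \<le> 1"
      using partition_range[OF part, of j] partition_range[OF part, of "Suc j"] j by auto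
    have a: "ac 0 1 (poly (p j)) (poly (pderiv (p j)))"
      by (rule ac_C1) (auto intro: continuous_on_poly has_field_derivative_at_within poly_DERIV)
    have "prim Om g y - prim Om g (x j) = ip Om g (indicator {x j<..y})"
      using j by (intro prim_diff_eq g) auto
    also have "\<dots> = ip Om (poly (pderiv (p j))) (indicator {x j<..y})"
      unfolding ip_def by (rule Bochner_Integration.integral_cong) (use geq j in \<open>auto simp: indicator_def\<close>)
    also have "\<dots> = prim Om (poly (pderiv (p j))) y - prim Om (poly (pderiv (p j))) (x j)"
      using j by (intro prim_diff_eq[symmetric] ac_L2_deriv[OF a]) auto
    also have "\<dots> = poly (p j) y - poly (p j) (x j)"
      using ac_eq[OF a, of y] ac_eq[OF a, of "x j"] r j by simp
    also have "\<dots> = W y - W (x j)" using p(2)[OF j(1), of y] p(2)[OF j(1), of "x j"] j by simp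
    finally show ?thesis .
  qed
  have n: "0 < n" "x 0 = 0" "x n = 1" using part by (auto simp: is_partition_def)
  have node: "j \<le> n \<Longrightarrow> prim Om g (x j) = W (x j)" for j
  proof (induction j)
    case 0
    then show ?case using n W by (simp add: Sh_def)
  next
    case (Suc j)
    then show ?case using step[of j "x (Suc j)"] partition_le[OF part, of j "Suc j"] by simp
  qed
  have "W y = W 0 + prim Om g y" if y: "y \<in> {0..1}" for y
  proof -
    obtain j where "j < n" "y \<in> {x j..x (Suc j)}" using partition_cover_closed[OF part y] by blast
    then show ?thesis using step[of j y] node[of j] W by (simp add: Sh_def)
  qed
  then have "ac 0 1 W g" unfolding ac_def using g by blast
  with p geq show thesis using that by blast
qed

lemma Sh_ac:
  assumes "W \<in> Sh k n x" "is_partition n x" shows "ac 0 1 W (wD Om W)"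
proof -
  obtain g where g: "ac 0 1 W g" using Sh_pieces[OF assms] by metis
  note w = ac_wD_self[OF g zero_le_one]
  have "AE y in lebesgue_on Om. g y = wD Om W y" using w(2) by eventually_elim simp
  then show ?thesis by (rule ac_cong_deriv[OF g _ w(3)])
qed

lemma Sh_boundary: "W \<in> Sh k n x \<Longrightarrow> W 0 = 0" "W \<in> Sh k n x \<Longrightarrow> W 1 = 0"
  unfolding Sh_def by blast+

lemma Sh_H10: "W \<in> Sh k n x \<Longrightarrow> is_partition n x \<Longrightarrow> W \<in> H10 Om"
  by (rule H10_I[OF Sh_ac zero_less_one Sh_boundary])

section \<open>Lagrange nodes and the nodal basis\<close>

lemma lagrange_nodesD:
  assumes "lagrange_nodes k n x P"
  shows "finite P" "\<And>p. p \<in> P \<Longrightarrow> 0 < p \<and> p < 1"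
    "\<And>j. j < n \<Longrightarrow> x j \<in> P \<union> {0, 1}" "\<And>j. j < n \<Longrightarrow> x (Suc j) \<in> P \<union> {0, 1}"
    "\<And>j. j < n \<Longrightarrow> card ((P \<union> {0, 1}) \<inter> {x j..x (Suc j)}) = k + 1"
proof -
  have A: "finite P" "P \<subseteq> {0<..<1}"
    "\<And>j. j < n \<Longrightarrow> {x j, x (Suc j)} \<subseteq> P \<union> {0, 1} \<and> card ((P \<union> {0, 1}) \<inter> {x j..x (Suc j)}) = k + 1"
    using assms unfolding lagrange_nodes_def by simp_all
  show "finite P" by (rule A(1))
  show "0 < p \<and> p < 1" if "p \<in> P" for p using subsetD[OF A(2) that] by simp
  fix j assume j: "j < n"
  have B: "{x j, x (Suc j)} \<subseteq> P \<union> {0, 1}" using A(3)[OF j] by (rule conjunct1)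
  show "x j \<in> P \<union> {0, 1}" by (rule subsetD[OF B]) simp
  show "x (Suc j) \<in> P \<union> {0, 1}" by (rule subsetD[OF B]) simp
  show "card ((P \<union> {0, 1}) \<inter> {x j..x (Suc j)}) = k + 1" using A(3)[OF j] by (rule conjunct2)
qed

text \<open>On an element containing p one takes the usual product of (y - q)/(p - q) over its other
  k points, elsewhere 0. Neighbouring pieces agree at a break point because interior break points
  are nodes.\<close>

lemma lagrange_basis_exists:
  assumes part: "is_partition n x" and nodes: "lagrange_nodes k n x P" and p: "p \<in> P"
  obtains \<phi> where "\<phi> \<in> Sh k n x" "\<And>q. q \<in> P \<Longrightarrow> \<phi> q = (if q = p then 1 else 0)"
proof -
  define N where "N j = (P \<union> {0, 1}) \<inter> {x j..x (Suc j)}" for j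
  define f where "f j = (if p \<in> N j then \<Prod>q\<in>N j - {p}. smult (1 / (p - q)) [:- q, 1:] else 0)" for j
  have fin: "finite (N j)" for j using lagrange_nodesD(1)[OF nodes] by (simp add: N_def)
  have n: "0 < n" "x 0 = 0" "x n = 1" using part by (auto simp: is_partition_def)
  have card: "card (N j) = k + 1" "x j \<in> N j" "x (Suc j) \<in> N j" if "j < n" for j
    using lagrange_nodesD(3-5)[OF nodes that] partition_le[OF part, of j "Suc j"] that
    unfolding N_def by (simp_all only: Int_iff atLeastAtMost_iff order_refl simp_thms)
  have deg: "degree (f j) \<le> k" if "j < n" for j
  proof (cases "p \<in> N j")
    case True
    have "degree (\<Prod>q\<in>N j - {p}. smult (1 / (p - q)) [:- q, 1:])
        \<le> (\<Sum>q\<in>N j - {p}. degree (smult (1 / (p - q)) [:- q, 1:]))"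
      using fin by (intro degree_prod_sum_le[unfolded o_def]) auto
    also have "\<dots> \<le> (\<Sum>q\<in>N j - {p}. 1)"
      by (intro sum_mono order_trans[OF degree_smult_le]) simp
    also have "\<dots> = k" using True card(1)[OF that] fin by simp
    finally show ?thesis using True by (simp add: f_def)
  qed (simp add: f_def)
  have val: "poly (f j) r = (if r = p then 1 else 0)" if "r \<in> N j" for j r
  proof (cases "r = p")
    case True
    have "(\<Prod>q\<in>N j - {p}. poly (smult (1 / (p - q)) [:- q, 1:]) p) = 1"
      by (rule prod.neutral) (auto simp flip: diff_divide_distrib)
    then show ?thesis using that True by (simp only: f_def poly_prod if_True refl)
  next
    case False
    then have "(\<Prod>q\<in>N j - {p}. poly (smult (1 / (p - q)) [:- q, 1:]) r) = 0"
      using that fin[of j] by (intro prod_zero bexI[of _ r]) auto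
    then show ?thesis using False by (simp only: f_def poly_prod if_False poly_0 split: if_split) simp
  qed
  have p01: "0 < p" "p < 1" using lagrange_nodesD(2)[OF nodes p] by auto
  obtain W where W: "W \<in> Sh k n x" "\<And>j y. j < n \<Longrightarrow> y \<in> {x j..x (Suc j)} \<Longrightarrow> W y = poly (f j) y"
  proof (rule Sh_glue[OF part deg])
    show "poly (f j) (x (Suc j)) = poly (f (Suc j)) (x (Suc j))" if "Suc j < n" for j
      using val card that by (metis Suc_lessD)
    show "poly (f 0) 0 = 0" using val[of 0 0] card(2)[of 0] n p01 by auto
    show "poly (f (n - 1)) 1 = 0" using val[of 1 "n - 1"] card(3)[of "n - 1"] n p01 by auto
  qed auto
  have "W q = (if q = p then 1 else 0)" if "q \<in> P" for q
  proof -
    have "q \<in> {0..1}" using lagrange_nodesD(2)[OF nodes that] by simp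
    then obtain j where j: "j < n" "q \<in> {x j..x (Suc j)}" using partition_cover_closed[OF part] by blast
    then have "q \<in> N j" using that by (simp add: N_def)
    then show ?thesis using W(2)[OF j] val by simp
  qed
  with W(1) show thesis by (rule that)
qed

lemma lagrange_basis:
  assumes "is_partition n x" "lagrange_nodes k n x P" "p \<in> P"
  shows "lagrange_basis k n x P p \<in> Sh k n x"
    "\<And>q. q \<in> P \<Longrightarrow> lagrange_basis k n x P p q = (if q = p then 1 else 0)"
proof -
  have "\<exists>\<phi>. \<phi> \<in> Sh k n x \<and> (\<forall>q\<in>P. \<phi> q = (if q = p then 1 else 0))"
    using lagrange_basis_exists[OF assms] by metis
  from someI_ex[OF this] show "lagrange_basis k n x P p \<in> Sh k n x"
    "\<And>q. q \<in> P \<Longrightarrow> lagrange_basis k n x P p q = (if q = p then 1 else 0)"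
    unfolding lagrange_basis_def by blast+
qed

lemma lagrange_combination:
  assumes "is_partition n x" "lagrange_nodes k n x P"
  defines "I \<equiv> \<lambda>u y. \<Sum>p\<in>P. u p * lagrange_basis k n x P p y"
  shows "I u \<in> Sh k n x" "q \<in> P \<Longrightarrow> I u q = u q"
proof -
  note b = lagrange_basis[OF assms(1,2)]
  show "I u \<in> Sh k n x" unfolding I_def by (intro Sh_sum Sh_scale b)
  assume q: "q \<in> P"
  have "I u q = (\<Sum>p\<in>P. if p = q then u p else 0)"
    unfolding I_def by (rule sum.cong) (use b(2) q in auto)
  then show "I u q = u q" using q lagrange_nodesD(1)[OF assms(2)] by simp
qed

text \<open>Counting 0 and 1, where members of \<open>Sh\<close> vanish by definition, each element
  carries k + 1 zeros of a polynomial of degree at most k.\<close>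

lemma Sh_zero_on_nodes:
  assumes W: "W \<in> Sh k n x" and part: "is_partition n x" and nodes: "lagrange_nodes k n x P"
    and 0: "\<And>p. p \<in> P \<Longrightarrow> W p = 0" and y: "y \<in> {0..1}"
  shows "W y = 0"
proof -
  obtain j where j: "j < n" "y \<in> {x j..x (Suc j)}" using partition_cover_closed[OF part y] by blast
  let ?N = "(P \<union> {0, 1}) \<inter> {x j..x (Suc j)}"
  obtain p where p: "degree p \<le> k" "\<And>y. y \<in> {x j..x (Suc j)} \<Longrightarrow> W y = poly p y"
    using W j(1) unfolding Sh_def by blast
  have card: "card ?N = k + 1" using lagrange_nodesD(5)[OF nodes j(1)] .
  have "poly p z = 0" if "z \<in> ?N" for z
    using that p(2)[of z] 0[of z] W by (auto simp: Sh_def)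
  then have "?N \<subseteq> {z. poly p z = 0}" by auto
  moreover have "p = 0"
  proof (rule ccontr)
    assume "p \<noteq> 0"
    then have "card ?N \<le> degree p"
      using card_mono[OF poly_roots_finite[OF \<open>p \<noteq> 0\<close>]] card_poly_roots_bound[OF \<open>p \<noteq> 0\<close>]
        \<open>?N \<subseteq> _\<close> by (meson order_trans)
    then show False using card p(1) by simp
  qed
  ultimately show ?thesis using p(2)[OF j(2)] by simp
qed

lemma Sh_eq_lagrange:
  assumes W: "W \<in> Sh k n x" and "is_partition n x" "lagrange_nodes k n x P" "y \<in> {0..1}"
  shows "W y = (\<Sum>p\<in>P. W p * lagrange_basis k n x P p y)"
proof -
  note c = lagrange_combination[OF assms(2,3)]
  have "W y - (\<Sum>p\<in>P. W p * lagrange_basis k n x P p y) = 0"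
    by (rule Sh_zero_on_nodes[OF Sh_diff[OF W c(1)] assms(2,3) _ assms(4)]) (simp add: c(2))
  then show ?thesis by simp
qed

section \<open>Interpolation error\<close>

text \<open>Zeros are added in increasing order. Between the new zero b and the previous largest
  zero m the mean value theorem gives one zero of \<open>f'\<close>, so only one zero is lost per
  derivative.\<close>

lemma Rolle_card:
  fixes f f' :: "real \<Rightarrow> real"
  assumes der: "\<And>y. y \<in> {s..t} \<Longrightarrow> (f has_real_derivative f' y) (at y within {s..t})"
    and Z: "finite Z" "Z \<subseteq> {s..t}" "\<And>z. z \<in> Z \<Longrightarrow> f z = 0"
  obtains Z' where "finite Z'" "Z' \<subseteq> {s..t}" "card Z' = card Z - 1" "\<And>z. z \<in> Z' \<Longrightarrow> f' z = 0"
proof -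
  \<comment> \<open>The last conjunct places each point found so far strictly below some element of
    Z; the next point lies beyond the largest element and is therefore new. For empty Z the
    truncated difference is 0.\<close>
  have "\<exists>Z'. finite Z' \<and> card Z' = card Z - 1 \<and> (\<forall>z\<in>Z'. z \<in> {s..t} \<and> f' z = 0 \<and> (\<exists>a\<in>Z. z < a))"
    using Z
  proof (induction Z rule: finite_linorder_max_induct)
    case empty
    then show ?case by (intro exI[of _ "{}"]) simp
  next
    case (insert b A)
    then obtain Z' where Z': "finite Z'" "card Z' = card A - 1"
      "\<And>z. z \<in> Z' \<Longrightarrow> z \<in> {s..t} \<and> f' z = 0 \<and> (\<exists>a\<in>A. z < a)" by auto
    show ?case
    proof (cases "A = {}")
      case True
      then show ?thesis by (intro exI[of _ "{}"]) simp
    next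
      case False
      define m where "m = Max A"
      have m: "m \<in> A" "m < b" "\<And>a. a \<in> A \<Longrightarrow> a \<le> m"
        using False insert.hyps by (auto simp: m_def)
      have st: "s \<le> m" "b \<le> t" using m insert.prems(1) by auto
      have "\<exists>y\<in>{m<..<b}. f b - f m = f' y * (b - m)"
      proof (rule mvt_simple[OF m(2)])
        fix y assume "m \<le> y" "y \<le> b"
        then have "y \<in> {s..t}" "{m..b} \<subseteq> {s..t}" using st by auto
        then have "(f has_real_derivative f' y) (at y within {m..b})"
          using DERIV_subset[OF der] by blast
        then show "(f has_derivative (\<lambda>h. f' y * h)) (at y within {m..b})"
          by (simp add: has_field_derivative_def)
      qed
      then obtain y where y: "m < y" "y < b" "f b - f m = f' y * (b - m)" by auto
      have "f b = 0" "f m = 0" using insert.prems(2) m(1) by auto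
      then have "f' y = 0" using y m(2) by simp
      moreover have "y \<notin> Z'" using Z'(3)[of y] m(3) y(1) by force
      moreover have "0 < card A" using False insert.hyps by (simp add: card_gt_0_iff)
      ultimately show ?thesis
        using Z' y st insert.hyps m(2)
        by (intro exI[of _ "insert y Z'"]) (auto intro: less_imp_le)
    qed
  qed
  then obtain Z' where "finite Z'" "card Z' = card Z - 1" "\<forall>z\<in>Z'. z \<in> {s..t} \<and> f' z = 0 \<and> (\<exists>a\<in>Z. z < a)"
    by blast
  then show thesis by (intro that[of Z']) blast+
qed

text \<open>\<open>E i\<close> is the \<open>i\<close>-th derivative of an error with \<open>k + 1\<close> zeros. By Rolle each \<open>E i\<close> with \<open>i \<le> k\<close> has a
  zero, so integrating once gains a factor \<open>h\<close> and no other constant: this is why neither \<open>k\<close> nor the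
  position of the nodes enters the final bound.\<close>

lemma derivative_chain_bound:
  fixes E :: "nat \<Rightarrow> real \<Rightarrow> real"
  assumes der: "\<And>i y. i < k \<Longrightarrow> y \<in> {s..t} \<Longrightarrow> (E i has_real_derivative E (Suc i) y) (at y within {s..t})"
    and Z: "finite Z" "Z \<subseteq> {s..t}" "card Z = k + 1" "\<And>z. z \<in> Z \<Longrightarrow> E 0 z = 0"
    and M: "\<And>y z. y \<in> {s..t} \<Longrightarrow> z \<in> {s..t} \<Longrightarrow> \<bar>E k y - E k z\<bar> \<le> M" and h: "t - s \<le> h"
    and iy: "i \<le> k" "y \<in> {s..t}"
  shows "\<bar>E i y\<bar> \<le> h ^ (k - i) * M"
proof -
  have "\<exists>Z. finite Z \<and> Z \<subseteq> {s..t} \<and> card Z = k + 1 - i \<and> (\<forall>z\<in>Z. E i z = 0)" if "i \<le> k" for i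
    using that
  proof (induction i)
    case 0
    then show ?case using Z by auto
  next
    case (Suc i)
    then obtain Z where "finite Z" "Z \<subseteq> {s..t}" "card Z = k + 1 - i" "\<And>z. z \<in> Z \<Longrightarrow> E i z = 0" by auto
    then obtain Z' where "finite Z'" "Z' \<subseteq> {s..t}" "card Z' = card Z - 1" "\<And>z. z \<in> Z' \<Longrightarrow> E (Suc i) z = 0"
      using Rolle_card[of s t "E i" "E (Suc i)" Z] der[of i] Suc.prems by (metis Suc_le_lessD)
    then show ?case using \<open>card Z = k + 1 - i\<close> by (intro exI[of _ Z']) auto
  qed
  then have zero: "\<exists>z\<in>{s..t}. E i z = 0" if "i \<le> k" for i
    using that by (metis Suc_diff_le Suc_eq_plus1 card.empty equals0I nat.simps(3) subset_iff)
  \<comment> \<open>Here d counts the integrations from level k downwards. Level k is bounded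
    because \<open>E k\<close> has a zero and oscillates by at most M.\<close>
  have main: "\<bar>E (k - d) y\<bar> \<le> h ^ d * M" if "d \<le> k" "y \<in> {s..t}" for d y
    using that
  proof (induction d arbitrary: y)
    case 0
    obtain z where "z \<in> {s..t}" "E k z = 0" using zero[of k] by auto
    then show ?case using M[OF 0(2), of z] by simp
  next
    case (Suc d)
    let ?i = "k - Suc d"
    have i: "?i < k" "Suc ?i = k - d" using Suc.prems by auto
    obtain z where z: "z \<in> {s..t}" "E ?i z = 0" using zero[of ?i] by auto
    have "norm (E ?i y - E ?i z) \<le> (h ^ d * M) * norm (y - z)"
    proof (rule field_differentiable_bound[of "{s..t}" _ "E (Suc ?i)"])
      show "(E ?i has_real_derivative E (Suc ?i) y) (at y within {s..t})" if "y \<in> {s..t}" for y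
        using der[OF i(1) that] .
      show "norm (E (Suc ?i) y) \<le> h ^ d * M" if "y \<in> {s..t}" for y
        using Suc.IH[of y] Suc.prems that unfolding i(2) by simp
    qed (use z Suc.prems in auto)
    also have "\<dots> \<le> (h ^ d * M) * h"
    proof (rule mult_left_mono)
      show "norm (y - z) \<le> h" using h z(1) Suc.prems(2) by auto
      show "0 \<le> h ^ d * M" using order_trans[OF abs_ge_zero Suc.IH] Suc.prems by simp
    qed
    finally show ?case using z(2) by (simp add: mult_ac)
  qed
  have "k - (k - i) = i" using iy(1) by simp
  then show ?thesis using main[OF diff_le_self iy(2), of i] by (simp only:)
qed

text \<open>The element is taken half-open so that the localised functions have disjoint supports
  and their squared norms add up to the global one.\<close>

definition loc :: "(nat \<Rightarrow> real) \<Rightarrow> (real \<Rightarrow> real) \<Rightarrow> nat \<Rightarrow> real \<Rightarrow> real" where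
  "loc x g j y = g y * indicator {x j<..x (Suc j)} y"

lemma loc_L2: "g \<in> L2 Om \<Longrightarrow> loc x g j \<in> L2 Om"
  unfolding loc_def[abs_def] by (rule L2_mult_indicator) auto

lemma ip_partition:
  assumes part: "is_partition n x" and g: "g \<in> L2 Om"
  shows "ip Om g g = (\<Sum>j<n. ip Om (loc x g j) (loc x g j))"
proof -
  have "(\<Sum>j<n. ip Om (loc x g j) (loc x g j)) = (LINT y|lebesgue_on Om. (\<Sum>j<n. loc x g j y * loc x g j y))"
    unfolding ip_def
    by (intro Bochner_Integration.integral_sum[symmetric] L2_mult_integrable loc_L2 g)
  also have "\<dots> = ip Om g g"
    unfolding ip_def
  proof (rule Bochner_Integration.integral_cong[OF refl])
    fix y assume "y \<in> space (lebesgue_on Om)"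
    then have y: "0 < y" "y \<le> 1" by auto
    obtain i where i: "i < n" "x i < y" "y \<le> x (Suc i)" using partition_cover[OF part y] by blast
    have "loc x g j y * loc x g j y = 0" if "j \<in> {..<n} - {i}" for j
      using partition_piece_unique[OF part, of i j y] i that by (auto simp: loc_def indicator_def)
    then have "(\<Sum>j<n. loc x g j y * loc x g j y) = (\<Sum>j\<in>{i}. loc x g j y * loc x g j y)"
      using i by (intro sum.mono_neutral_right) auto
    then show "(\<Sum>j<n. loc x g j y * loc x g j y) = g y * g y"
      using i by (simp add: loc_def)
  qed
  finally show ?thesis by simp
qed

text \<open>Cauchy-Schwarz is applied after cutting g down to one element. Squares of local norms
  can be summed over the mesh without a factor counting the elements, which the global norm would
  produce.\<close>

lemma prim_local_Hoelder:
  assumes part: "is_partition n x" and j: "j < n" and g: "g \<in> L2 Om"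
    and "y \<in> {x j..x (Suc j)}" "z \<in> {x j..x (Suc j)}"
  shows "\<bar>prim Om g y - prim Om g z\<bar> \<le> L2norm Om (loc x g j) * sqrt (x (Suc j) - x j)"
proof -
  have r: "0 \<le> x j" "x (Suc j) \<le> 1"
    using partition_range[OF part, of j] partition_range[OF part, of "Suc j"] j by auto
  have *: "\<bar>prim Om g d - prim Om g c\<bar> \<le> L2norm Om (loc x g j) * sqrt (x (Suc j) - x j)"
    if cd: "c \<le> d" "x j \<le> c" "d \<le> x (Suc j)" for c d
  proof -
    have "prim Om g d - prim Om g c = ip Om g (indicator {c<..d})"
      by (rule prim_diff_eq[OF g cd(1)])
    also have "\<dots> = ip Om (loc x g j) (indicator {c<..d})"
      unfolding ip_def loc_def
      by (rule Bochner_Integration.integral_cong) (use cd in \<open>auto simp: indicator_def\<close>)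
    finally have "\<bar>prim Om g d - prim Om g c\<bar> \<le> L2norm Om (loc x g j) * L2norm Om (indicator {c<..d})"
      using ip_Cauchy_Schwarz[OF loc_L2[OF g, of x j] L2_indicator, of "{c<..d}"] by simp
    also have "L2norm Om (indicator {c<..d}) = sqrt (d - c)"
      using cd r by (intro L2norm_indicator) auto
    also have "L2norm Om (loc x g j) * sqrt (d - c) \<le> L2norm Om (loc x g j) * sqrt (x (Suc j) - x j)"
      using cd by (intro mult_left_mono) auto
    finally show ?thesis .
  qed
  show ?thesis using *[of y z] *[of z y] assms(4,5) by (cases "y \<le> z") (auto simp: abs_minus_commute)
qed

text \<open>The pointwise bound already contains the square root of the element length. Integrating
  its square over the element supplies the second root, hence a full power of the mesh size, and the
  squares of the local norms add up exactly.\<close>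

lemma piecewise_norm_bound:
  assumes part: "is_partition n x" and w: "w \<in> L2 Om" and g: "g \<in> L2 Om" and H: "0 \<le> H"
    and le: "\<And>j y. j < n \<Longrightarrow> y \<in> {x j<..x (Suc j)} \<Longrightarrow>
      \<bar>w y\<bar> \<le> H * (L2norm Om (loc x g j) * sqrt (x (Suc j) - x j))"
  shows "L2norm Om w \<le> H * mesh n x * L2norm Om g"
proof (rule power2_le_imp_le)
  have "(L2norm Om w)\<^sup>2 = (\<Sum>j<n. (L2norm Om (loc x w j))\<^sup>2)"
    by (simp add: L2norm_square ip_partition[OF part w])
  also have "\<dots> \<le> (\<Sum>j<n. (H * mesh n x * L2norm Om (loc x g j))\<^sup>2)"
  proof (intro sum_mono power_mono)
    fix j assume "j \<in> {..<n}"
    then have j: "j < n" by simp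
    let ?h = "x (Suc j) - x j" and ?N = "L2norm Om (loc x g j)"
    have h: "0 \<le> ?h" "?h \<le> mesh n x" using partition_le[OF part, of j "Suc j"] mesh_ge[OF j] j by auto
    have r: "0 \<le> x j" "x (Suc j) \<le> 1"
      using partition_range[OF part, of j] partition_range[OF part, of "Suc j"] j by auto
    have "L2norm Om (loc x w j) \<le> L2norm Om (\<lambda>y. (H * (?N * sqrt ?h)) * indicator {x j<..x (Suc j)} y)"
    proof (rule L2norm_mono[OF loc_L2[OF w] L2_scale[OF L2_indicator]])
      have "\<bar>loc x w j y\<bar> \<le> \<bar>H * (?N * sqrt ?h) * indicator {x j<..x (Suc j)} y\<bar>" for y
        using le[OF j, of y] by (auto simp: loc_def indicator_def intro: order_trans)
      then show "AE y in lebesgue_on Om. \<bar>loc x w j y\<bar> \<le> \<bar>H * (?N * sqrt ?h) * indicator {x j<..x (Suc j)} y\<bar>"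
        by (intro AE_I2)
    qed simp
    also have "\<dots> = H * (?N * sqrt ?h) * sqrt ?h"
      using L2norm_indicator[of 0 "x j" "x (Suc j)" 1] r h H by (simp add: L2norm_scale)
    also have "\<dots> = H * ?h * ?N" using h by simp
    also have "\<dots> \<le> H * mesh n x * ?N"
      using h H by (intro mult_right_mono mult_left_mono) auto
    finally show "L2norm Om (loc x w j) \<le> H * mesh n x * ?N" .
  qed simp
  also have "\<dots> = (H * mesh n x * L2norm Om g)\<^sup>2"
    by (simp add: power_mult_distrib L2norm_square ip_partition[OF part g] sum_distrib_left)
  finally show "(L2norm Om w)\<^sup>2 \<le> (H * mesh n x * L2norm Om g)\<^sup>2" .
  show "0 \<le> H * mesh n x * L2norm Om g" using H mesh_pos[OF part] by simp
qed

lemma ac_deriv_unique: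
  assumes c: "ac a b c g" and d: "ac a b d h" and "a < b" and eq: "\<And>y. y \<in> {a..b} \<Longrightarrow> c y = d y"
  shows "AE y in lebesgue_on {a<..<b}. g y = h y"
proof -
  have "AE y in lebesgue_on {a<..<b}. c y = d y" by (rule AE_I2) (simp add: eq)
  then have "AE y in lebesgue_on {a<..<b}. wD {a<..<b} c y = h y"
    using assms(3) by (intro ac_wD(2)[OF d _ _ ac_L2[OF c]]) auto
  moreover have "AE y in lebesgue_on {a<..<b}. wD {a<..<b} c y = g y"
    using assms(3) by (intro ac_wD_self(2)[OF c]) auto
  ultimately show ?thesis by eventually_elim simp
qed

text \<open>On each element the error has k + 1 zeros, so the Rolle chain bounds its i-th derivative
  by h^(k-i) times the oscillation of the k-th, which costs a local norm times the square root of
  the length. For i = 0 and i = 1 the last power of h comes from summing the squares.\<close>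

lemma interpolation_error:
  assumes part: "is_partition n x" and nodes: "lagrange_nodes k n x P" and k: "1 \<le> k"
    and u: "u \<in> Hs (Suc k) Om" and c: "ac 0 1 c (wD Om u)" "AE y in lebesgue_on Om. u y = c y"
    and c0: "c 0 = 0" "c 1 = 0" and I: "I \<in> Sh k n x" "\<And>q. q \<in> P \<Longrightarrow> I q = c q"
  defines "D \<equiv> L2norm Om ((wD Om ^^ Suc k) u)"
  shows "L2norm Om (\<lambda>y. c y - I y) \<le> mesh n x ^ (k + 1) * D"
    "L2norm Om (\<lambda>y. wD Om u y - wD Om I y) \<le> mesh n x ^ k * D"
proof -
  obtain C where C: "\<And>j. j \<le> k \<Longrightarrow> ac 0 1 (C j) ((wD Om ^^ Suc j) u)"
    "\<And>j. j \<le> k \<Longrightarrow> AE x in lebesgue_on Om. (wD Om ^^ j) u x = C j x"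
    "\<And>j x. j < k \<Longrightarrow> x \<in> {0..1} \<Longrightarrow> (C j has_real_derivative C (Suc j) x) (at x within {0..1})"
    using Hs_rep_chain[OF u zero_less_one] by blast
  let ?g = "(wD Om ^^ Suc k) u"
  have g: "?g \<in> L2 Om" using ac_L2_deriv[OF C(1)[OF order_refl]] .
  have cC: "c y = C 0 y" if "y \<in> {0..1}" for y
  proof (rule continuous_AE_eq[OF zero_less_one ac_continuous[OF c(1)] ac_continuous[OF C(1)[OF le0]] _ that])
    show "AE x in lebesgue_on Om. c x = C 0 x"
      using c(2) C(2)[OF le0] by eventually_elim simp
  qed
  obtain p r where p: "\<And>j. j < n \<Longrightarrow> degree (p j) \<le> k"
    "\<And>j y. j < n \<Longrightarrow> y \<in> {x j..x (Suc j)} \<Longrightarrow> I y = poly (p j) y"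
    "ac 0 1 I r" "\<And>j y. j < n \<Longrightarrow> y \<in> {x j<..x (Suc j)} \<Longrightarrow> r y = poly (pderiv (p j)) y"
    using Sh_pieces[OF I(1) part] by blast
  have bound: "\<bar>C i y - poly ((pderiv ^^ i) (p j)) y\<bar>
      \<le> mesh n x ^ (k - i) * (L2norm Om (loc x ?g j) * sqrt (x (Suc j) - x j))"
    if j: "j < n" and i: "i \<le> k" and y: "y \<in> {x j..x (Suc j)}" for i j y
  proof -
    let ?E = "\<lambda>i y. C i y - poly ((pderiv ^^ i) (p j)) y"
    let ?Z = "(P \<union> {0, 1}) \<inter> {x j..x (Suc j)}"
    have sub: "{x j..x (Suc j)} \<subseteq> {0..1}"
      using partition_range[OF part, of j] partition_range[OF part, of "Suc j"] j by auto
    show ?thesis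
    proof (rule derivative_chain_bound[where E = ?E and Z = ?Z and s = "x j" and t = "x (Suc j)"])
      fix i y assume i: "i < k" and y: "y \<in> {x j..x (Suc j)}"
      have "(C i has_real_derivative C (Suc i) y) (at y within {x j..x (Suc j)})"
        by (rule DERIV_subset[OF C(3)[OF i subsetD[OF sub y]] sub])
      moreover have "(poly ((pderiv ^^ i) (p j)) has_real_derivative poly ((pderiv ^^ Suc i) (p j)) y)
          (at y within {x j..x (Suc j)})"
        unfolding funpow.simps o_apply by (rule has_field_derivative_at_within[OF poly_DERIV])
      ultimately show "(?E i has_real_derivative ?E (Suc i) y) (at y within {x j..x (Suc j)})"
        by (rule DERIV_diff)
    next
      show "finite ?Z" using lagrange_nodesD(1)[OF nodes] by simp
      show "card ?Z = k + 1" by (rule lagrange_nodesD(5)[OF nodes j])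
      fix z assume z: "z \<in> ?Z"
      have "I z = c z" using z I c0 Sh_boundary[OF I(1)] by auto
      then show "?E 0 z = 0" using p(2)[OF j, of z] cC[of z] z sub by auto
    next
      fix y z assume yz: "y \<in> {x j..x (Suc j)}" "z \<in> {x j..x (Suc j)}"
      \<comment> \<open>The k-th derivative of the interpolant is constant on the element, so the
        oscillation of the k-th error derivative is that of \<open>C k\<close>, a primitive of the
        top derivative of u up to a constant.\<close>
      have "degree ((pderiv ^^ k) (p j)) = 0"
        using p(1)[OF j] by (simp add: degree_higher_pderiv)
      then obtain b where "(pderiv ^^ k) (p j) = [:b:]" by (metis degree_eq_zeroE)
      then have "?E k y - ?E k z = prim Om ?g y - prim Om ?g z"
        using ac_eq[OF C(1)[OF order_refl], of y] ac_eq[OF C(1)[OF order_refl], of z] yz sub by auto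
      then show "\<bar>?E k y - ?E k z\<bar> \<le> L2norm Om (loc x ?g j) * sqrt (x (Suc j) - x j)"
        using prim_local_Hoelder[OF part j g yz] by simp
    qed (use mesh_ge[OF j] i y in auto)
  qed
  have mp: "0 \<le> mesh n x" using mesh_pos[OF part] by simp
  have "L2norm Om (\<lambda>y. c y - I y) \<le> mesh n x ^ k * mesh n x * L2norm Om ?g"
  proof (rule piecewise_norm_bound[OF part _ g])
    show "(\<lambda>y. c y - I y) \<in> L2 Om" by (intro L2_diff ac_L2[OF c(1)] ac_L2[OF p(3)])
    fix j y assume j: "j < n" and y: "y \<in> {x j<..x (Suc j)}"
    have "y \<in> {0..1}"
      using partition_range[OF part, of j] partition_range[OF part, of "Suc j"] j y by auto
    then show "\<bar>c y - I y\<bar> \<le> mesh n x ^ k * (L2norm Om (loc x ?g j) * sqrt (x (Suc j) - x j))"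
      using bound[OF j le0, of y] y cC[of y] p(2)[OF j, of y] by simp
  qed (use mp in simp)
  then show "L2norm Om (\<lambda>y. c y - I y) \<le> mesh n x ^ (k + 1) * D"
    by (simp add: D_def mult_ac)
  have wL: "(\<lambda>y. wD Om u y - wD Om I y) \<in> L2 Om"
    by (intro L2_diff ac_L2_deriv[OF c(1)] ac_L2_deriv[OF Sh_ac[OF I(1) part]])
  have CL: "(\<lambda>y. C 1 y - r y) \<in> L2 Om"
    by (intro L2_diff ac_L2[OF C(1)[OF k]] ac_L2_deriv[OF p(3)])
  have "L2norm Om (\<lambda>y. wD Om u y - wD Om I y) = L2norm Om (\<lambda>y. C 1 y - r y)"
  proof (rule L2norm_cong_AE[OF _ wL CL])
    have "AE y in lebesgue_on Om. wD Om u y = C 1 y" using C(2)[OF k] by simp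
    moreover have "AE y in lebesgue_on Om. wD Om I y = r y" by (rule ac_wD_self(2)[OF p(3) zero_le_one])
    ultimately show "AE y in lebesgue_on Om. wD Om u y - wD Om I y = C 1 y - r y"
      by eventually_elim simp
  qed
  \<comment> \<open>One differentiation leaves h^(k-1) pointwise, and summation over the elements
    restores h^k. The subtraction is genuine because k \<ge> 1.\<close>
  also have "\<dots> \<le> mesh n x ^ (k - 1) * mesh n x * L2norm Om ?g"
  proof (rule piecewise_norm_bound[OF part CL g])
    fix j y assume j: "j < n" and y: "y \<in> {x j<..x (Suc j)}"
    then show "\<bar>C 1 y - r y\<bar> \<le> mesh n x ^ (k - 1) * (L2norm Om (loc x ?g j) * sqrt (x (Suc j) - x j))"
      using bound[OF j k, of y] p(4)[OF j y] by simp
  qed (use mp in simp)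
  also have "\<dots> = mesh n x ^ k * D"
    using k power_Suc2[of "mesh n x" "k - 1"] by (simp add: D_def)
  finally show "L2norm Om (\<lambda>y. wD Om u y - wD Om I y) \<le> mesh n x ^ k * D" .
qed

section \<open>Orthonormal bases and the Ritz projection\<close>

text \<open>The form B is abstract because two bases are wanted: one orthonormal for the L2 product,
  one for the product of derivatives. Functions are compared on K only, since members of
  \<open>Sh\<close> are arbitrary outside [0,1].\<close>

lemma Gram_Schmidt:
  fixes B :: "(real \<Rightarrow> real) \<Rightarrow> (real \<Rightarrow> real) \<Rightarrow> real"
  assumes add: "\<And>f g. f \<in> X \<Longrightarrow> g \<in> X \<Longrightarrow> (\<lambda>y. f y + g y) \<in> X"
    and scale: "\<And>f c. f \<in> X \<Longrightarrow> (\<lambda>y. c * f y) \<in> X" and zero: "(\<lambda>y. 0) \<in> X"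
    and B_add: "\<And>f g h. f \<in> X \<Longrightarrow> g \<in> X \<Longrightarrow> h \<in> X \<Longrightarrow> B (\<lambda>y. f y + g y) h = B f h + B g h"
    and B_scale: "\<And>f c h. f \<in> X \<Longrightarrow> h \<in> X \<Longrightarrow> B (\<lambda>y. c * f y) h = c * B f h"
    and B_sym: "\<And>f g. B f g = B g f" and B_nonneg: "\<And>f. 0 \<le> B f f"
    and B_cong: "\<And>f g h. f \<in> X \<Longrightarrow> g \<in> X \<Longrightarrow> h \<in> X \<Longrightarrow> (\<And>y. y \<in> K \<Longrightarrow> f y = g y) \<Longrightarrow> B f h = B g h"
    and B_def: "\<And>f y. f \<in> X \<Longrightarrow> B f f = 0 \<Longrightarrow> y \<in> K \<Longrightarrow> f y = 0"
    and A: "finite A" "A \<subseteq> X" and span: "\<And>f. f \<in> X \<Longrightarrow> \<exists>w. \<forall>y\<in>K. f y = (\<Sum>a\<in>A. w a * a y)"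
  obtains m and \<phi> :: "nat \<Rightarrow> real \<Rightarrow> real" where "\<And>i. i < m \<Longrightarrow> \<phi> i \<in> X"
    "\<And>i j. i < m \<Longrightarrow> j < m \<Longrightarrow> B (\<phi> i) (\<phi> j) = (if i = j then 1 else 0)"
    "\<And>f y. f \<in> X \<Longrightarrow> y \<in> K \<Longrightarrow> f y = (\<Sum>i<m. B f (\<phi> i) * \<phi> i y)"
proof -
  have sumX: "(\<lambda>y. \<Sum>i\<in>I. c i * \<phi> i y) \<in> X" if "\<And>i. i \<in> I \<Longrightarrow> \<phi> i \<in> X" for I :: "nat set" and c \<phi>
    using that by (induction I rule: infinite_finite_induct) (auto intro!: zero add scale)
  have B_sum: "B (\<lambda>y. \<Sum>i\<in>I. c i * \<phi> i y) h = (\<Sum>i\<in>I. c i * B (\<phi> i) h)"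
    if "finite I" "\<And>i. i \<in> I \<Longrightarrow> \<phi> i \<in> X" "h \<in> X" for I :: "nat set" and c \<phi> h
    using that
  proof (induction I rule: finite_induct)
    case empty
    have "B (\<lambda>y. 0 * 0) h = 0" using B_scale[OF zero empty(2), of 0] by simp
    then show ?case by simp
  next
    case (insert i I)
    then have "B (\<lambda>y. c i * \<phi> i y + (\<Sum>i\<in>I. c i * \<phi> i y)) h = c i * B (\<phi> i) h + B (\<lambda>y. \<Sum>i\<in>I. c i * \<phi> i y) h"
      by (subst B_add) (auto intro!: sumX scale simp: B_scale)
    then show ?case using insert by simp
  qed
  have "\<exists>(m::nat) \<phi>. (\<forall>i<m. \<phi> i \<in> X) \<and> (\<forall>i<m. \<forall>j<m. B (\<phi> i) (\<phi> j) = (if i = j then 1 else 0)) \<and>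
      (\<forall>a\<in>A. \<exists>b. \<forall>y\<in>K. a y = (\<Sum>i<m. b i * \<phi> i y))"
    using A
  proof (induction A rule: finite_induct)
    case empty
    show ?case by (intro exI[of _ "0::nat"]) simp
  next
    case (insert a A)
    have "A \<subseteq> X" and a: "a \<in> X" using insert.prems by simp_all
    from insert.IH[OF this(1)] obtain m and \<phi> :: "nat \<Rightarrow> real \<Rightarrow> real"
      where 0: "(\<forall>i<m. \<phi> i \<in> X) \<and> (\<forall>i<m. \<forall>j<m. B (\<phi> i) (\<phi> j) = (if i = j then 1 else 0)) \<and>
      (\<forall>a\<in>A. \<exists>b. \<forall>y\<in>K. a y = (\<Sum>i<m. b i * \<phi> i y))" by (elim exE)
    from 0 have \<phi>: "\<phi> i \<in> X" "j < m \<Longrightarrow> B (\<phi> i) (\<phi> j) = (if i = j then 1 else 0)" if "i < m" for i j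
      using that by simp_all
    from 0 have sp: "\<exists>b. \<forall>y\<in>K. a y = (\<Sum>i<m. b i * \<phi> i y)" if "a \<in> A" for a
      using that by blast
    define s where "s y = (\<Sum>i<m. B a (\<phi> i) * \<phi> i y)" for y
    define d where "d y = a y + (-1) * s y" for y
    have s: "s \<in> X" unfolding s_def by (rule sumX) (use \<phi>(1) in auto)
    have d: "d \<in> X" unfolding d_def by (intro add scale a s)
    have Bs: "B s (\<phi> j) = B a (\<phi> j)" if "j < m" for j
    proof -
      have "B s (\<phi> j) = (\<Sum>i<m. B a (\<phi> i) * B (\<phi> i) (\<phi> j))"
        unfolding s_def by (rule B_sum) (use \<phi>(1) that in auto)
      also have "\<dots> = (\<Sum>i<m. if i = j then B a (\<phi> i) else 0)"
        by (rule sum.cong) (use \<phi>(2) that in auto)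
      finally show ?thesis using that by simp
    qed
    have Bd: "B d (\<phi> j) = 0" if "j < m" for j
    proof -
      have "B d (\<phi> j) = B a (\<phi> j) + (-1) * B s (\<phi> j)"
        unfolding d_def using a s \<phi>(1)[OF that] by (simp only: B_add scale B_scale)
      then show ?thesis using Bs[OF that] by simp
    qed
    show ?case
    \<comment> \<open>If the residual has norm 0, a already lies in the span on K and the system is
      kept; this discards linearly dependent generators.\<close>
    proof (cases "B d d = 0")
      case True
      then have "a y = (\<Sum>i<m. B a (\<phi> i) * \<phi> i y)" if "y \<in> K" for y
        using B_def[OF d True that] by (simp add: d_def s_def)
      then have "\<exists>b. \<forall>y\<in>K. a y = (\<Sum>i<m. b i * \<phi> i y)"
        by (intro exI[of _ "\<lambda>i. B a (\<phi> i)"]) blast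
      then have "\<forall>a\<in>insert a A. \<exists>b. \<forall>y\<in>K. a y = (\<Sum>i<m. b i * \<phi> i y)"
        using 0 by simp
      then show ?thesis using 0 by (intro exI[of _ m] exI[of _ \<phi>]) simp
    next
      case False
      then have pos: "0 < B d d" using B_nonneg[of d] by simp
      define r where "r = sqrt (B d d)"
      have r: "r > 0" "r * r = B d d" using pos by (auto simp: r_def)
      define e where "e y = (1 / r) * d y" for y
      have e: "e \<in> X" unfolding e_def by (rule scale[OF d])
      have Be: "B e h = (1 / r) * B d h" if "h \<in> X" for h unfolding e_def by (rule B_scale[OF d that])
      have Bee: "B e e = 1"
        proof -
        have "B e e = 1 / r * (1 / r * B d d)" using Be[OF e] Be[OF d] B_sym[of d e] by simp
        also have "\<dots> = 1" unfolding r(2)[symmetric] using r(1) by simp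
        finally show ?thesis .
      qed
      define \<psi> where "\<psi> = \<phi>(m := e)"
      have 1: "\<forall>i<Suc m. \<psi> i \<in> X" using \<phi>(1) e by (auto simp: \<psi>_def less_Suc_eq)
      have Be0: "B e (\<phi> j) = 0" "B (\<phi> j) e = 0" if "j < m" for j
      proof -
        show "B e (\<phi> j) = 0" using Be[OF \<phi>(1)[OF that]] Bd[OF that] by simp
        then show "B (\<phi> j) e = 0" using B_sym[of "\<phi> j" e] by simp
      qed
      have 2: "\<forall>i<Suc m. \<forall>j<Suc m. B (\<psi> i) (\<psi> j) = (if i = j then 1 else 0)"
      proof (intro allI impI)
        fix i j assume "i < Suc m" "j < Suc m"
        then show "B (\<psi> i) (\<psi> j) = (if i = j then 1 else 0)"
          by (cases "i = m"; cases "j = m") (simp_all add: \<psi>_def Bee Be0 \<phi>(2) less_Suc_eq)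
      qed
      have "\<exists>b. \<forall>y\<in>K. a' y = (\<Sum>i<Suc m. b i * \<psi> i y)" if a': "a' \<in> insert a A" for a'
      proof (cases "a' = a")
        case True
        have "a y = (\<Sum>i<Suc m. ((\<lambda>i. B a (\<phi> i))(m := r)) i * \<psi> i y)" for y
          using r(1) by (simp add: \<psi>_def e_def d_def s_def)
        then show ?thesis using True by blast
      next
        case False
        then obtain b where b: "\<forall>y\<in>K. a' y = (\<Sum>i<m. b i * \<phi> i y)" using sp a' by blast
        have "\<forall>y\<in>K. a' y = (\<Sum>i<Suc m. (b(m := 0)) i * \<psi> i y)"
          using b by (simp add: \<psi>_def)
        then show ?thesis by blast
      qed
      then show ?thesis using 1 2 by blast
    qed
  qed
  then obtain m and \<phi> :: "nat \<Rightarrow> real \<Rightarrow> real"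
    where 0: "(\<forall>i<m. \<phi> i \<in> X) \<and> (\<forall>i<m. \<forall>j<m. B (\<phi> i) (\<phi> j) = (if i = j then 1 else 0)) \<and>
      (\<forall>a\<in>A. \<exists>b. \<forall>y\<in>K. a y = (\<Sum>i<m. b i * \<phi> i y))" by (elim exE)
  from 0 have \<phi>: "\<phi> i \<in> X" "j < m \<Longrightarrow> B (\<phi> i) (\<phi> j) = (if i = j then 1 else 0)" if "i < m" for i j
    using that by simp_all
  from 0 have sp: "\<forall>a\<in>A. \<exists>b. \<forall>y\<in>K. a y = (\<Sum>i<m. b i * \<phi> i y)" by blast
  obtain b where b: "\<And>a y. a \<in> A \<Longrightarrow> y \<in> K \<Longrightarrow> a y = (\<Sum>i<m. b a i * \<phi> i y)"
    using bchoice[OF sp] by blast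
  have "f y = (\<Sum>i<m. B f (\<phi> i) * \<phi> i y)" if f: "f \<in> X" and y: "y \<in> K" for f y
  proof -
    obtain w where w: "\<forall>y\<in>K. f y = (\<Sum>a\<in>A. w a * a y)" using span[OF f] by blast
    \<comment> \<open>The coefficients with respect to the generators are regrouped first;
      orthonormality then identifies them with \<open>B f (\<phi> i)\<close>.\<close>
    define q where "q i = (\<Sum>a\<in>A. w a * b a i)" for i
    have fq: "f y = (\<Sum>i<m. q i * \<phi> i y)" if "y \<in> K" for y
    proof -
      have "f y = (\<Sum>a\<in>A. w a * (\<Sum>i<m. b a i * \<phi> i y))"
        using w that b by simp
      also have "\<dots> = (\<Sum>i<m. q i * \<phi> i y)"
        unfolding q_def sum_distrib_left sum_distrib_right
        by (subst sum.swap) (simp add: mult.assoc)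
      finally show ?thesis .
    qed
    have "B f (\<phi> j) = q j" if "j < m" for j
    proof -
      have "B f (\<phi> j) = B (\<lambda>y. \<Sum>i<m. q i * \<phi> i y) (\<phi> j)"
        by (rule B_cong[OF f _ \<phi>(1)[OF that] fq]) (auto intro!: sumX \<phi>(1))
      also have "\<dots> = (\<Sum>i<m. q i * B (\<phi> i) (\<phi> j))"
        by (rule B_sum) (use \<phi>(1) that in auto)
      also have "\<dots> = (\<Sum>i<m. if i = j then q i else 0)"
        by (rule sum.cong) (use \<phi>(2) that in auto)
      finally show ?thesis using that by simp
    qed
    then show ?thesis using fq[OF y] by simp
  qed
  with \<phi> show thesis by (rule that)
qed

section \<open>Orthonormal bases of the finite element space\<close>

lemma Sh_L2: "W \<in> Sh k n x \<Longrightarrow> W \<in> L2 Om"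
  by (rule L2_continuous) (simp add: Sh_def)

lemma Sh_span:
  assumes "is_partition n x" "lagrange_nodes k n x P"
  obtains A where "finite A" "A \<subseteq> Sh k n x"
    "\<And>W. W \<in> Sh k n x \<Longrightarrow> \<exists>w. \<forall>y\<in>{0..1}. W y = (\<Sum>a\<in>A. w a * a y)"
proof -
  let ?L = "lagrange_basis k n x P"
  have inj: "inj_on ?L P"
  proof (rule inj_onI)
    fix p q assume "p \<in> P" "q \<in> P" "?L p = ?L q"
    then show "p = q" using lagrange_basis(2)[OF assms, of p p] lagrange_basis(2)[OF assms, of q p]
      by (simp split: if_splits)
  qed
  show thesis
  proof (rule that[of "?L ` P"])
    show "finite (?L ` P)" using lagrange_nodesD(1)[OF assms(2)] by simp
    show "?L ` P \<subseteq> Sh k n x" using lagrange_basis(1)[OF assms] by blast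
    fix W assume W: "W \<in> Sh k n x"
    have "W y = (\<Sum>a\<in>?L ` P. W (the_inv_into P ?L a) * a y)" if "y \<in> {0..1}" for y
      unfolding Sh_eq_lagrange[OF W assms that]
      by (subst sum.reindex[OF inj]) (simp add: the_inv_into_f_f[OF inj])
    then show "\<exists>w. \<forall>y\<in>{0..1}. W y = (\<Sum>a\<in>?L ` P. w a * a y)"
      by (intro exI[of _ "\<lambda>a. W (the_inv_into P ?L a)"] ballI)
  qed
qed

lemma Sh_L2_definite:
  assumes "W \<in> Sh k n x" "ip Om W W = 0" "y \<in> {0..1}" shows "W y = 0"
proof (rule continuous_AE_eq[OF zero_less_one _ _ _ assms(3)])
  show "continuous_on {0..1} W" using assms(1) unfolding Sh_def by blast
  show "AE y in lebesgue_on Om. W y = 0" by (rule ip_eq_0_imp_AE[OF Sh_L2[OF assms(1)] assms(2)])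
qed simp

lemma Sh_wD_L2: "W \<in> Sh k n x \<Longrightarrow> is_partition n x \<Longrightarrow> wD Om W \<in> L2 Om"
  by (rule ac_L2_deriv[OF Sh_ac])

lemma Sh_H1_definite:
  assumes W: "W \<in> Sh k n x" and part: "is_partition n x" and 0: "ip Om (wD Om W) (wD Om W) = 0"
    and y: "y \<in> {0..1}"
  shows "W y = 0"
proof -
  note w = Sh_wD_L2[OF W part]
  have "AE y in lebesgue_on Om. wD Om W y = 0" by (rule ip_eq_0_imp_AE[OF w 0])
  then have "prim Om (wD Om W) y = prim Om (\<lambda>x. 0) y" by (rule prim_cong_AE[OF _ w L2_zero])
  then show ?thesis
    using ac_eq[OF Sh_ac[OF W part] y] Sh_boundary(1)[OF W] by (simp add: prim_def ip_def)
qed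

lemma Sh_wD_eqI:
  assumes "W \<in> Sh k n x" "is_partition n x" "ac 0 1 Z g" "\<And>y. y \<in> {0..1} \<Longrightarrow> W y = Z y"
  shows "AE y in lebesgue_on Om. wD Om W y = g y"
  by (rule ac_deriv_unique[OF Sh_ac[OF assms(1,2)] assms(3) zero_less_one assms(4)])

lemma Sh_L2_orthonormal_basis:
  assumes part: "is_partition n x" and nodes: "lagrange_nodes k n x P"
  obtains m and \<phi> :: "nat \<Rightarrow> real \<Rightarrow> real" where "\<And>i. i < m \<Longrightarrow> \<phi> i \<in> Sh k n x"
    "\<And>i j. i < m \<Longrightarrow> j < m \<Longrightarrow> ip Om (\<phi> i) (\<phi> j) = (if i = j then 1 else 0)"
    "\<And>W y. W \<in> Sh k n x \<Longrightarrow> y \<in> {0..1} \<Longrightarrow> W y = (\<Sum>i<m. ip Om W (\<phi> i) * \<phi> i y)"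
proof -
  obtain A where A: "finite A" "A \<subseteq> Sh k n x"
    "\<And>W. W \<in> Sh k n x \<Longrightarrow> \<exists>w. \<forall>y\<in>{0..1}. W y = (\<Sum>a\<in>A. w a * a y)"
    using Sh_span[OF assms] by blast
  show thesis
  proof (rule Gram_Schmidt[of "Sh k n x" "ip Om" "{0..1}" A])
    show "ip Om (\<lambda>y. f y + g y) h = ip Om f h + ip Om g h"
      if "f \<in> Sh k n x" "g \<in> Sh k n x" "h \<in> Sh k n x" for f g h
      using that by (intro ip_add_left Sh_L2)
    show "ip Om f h = ip Om g h" if "\<And>y. y \<in> {0..1} \<Longrightarrow> f y = g y" for f g h
      using that by (intro ip_cong) auto
    show "(\<lambda>y. f y + g y) \<in> Sh k n x" if "f \<in> Sh k n x" "g \<in> Sh k n x" for f g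
      using that by (rule Sh_add)
    show "(\<lambda>y. c * f y) \<in> Sh k n x" if "f \<in> Sh k n x" for f c using that by (rule Sh_scale)
    show "(\<lambda>y. 0) \<in> Sh k n x" by (rule Sh_zero)
    show "finite A" "A \<subseteq> Sh k n x" by (fact A)+
    show "\<exists>w. \<forall>y\<in>{0..1}. f y = (\<Sum>a\<in>A. w a * a y)" if "f \<in> Sh k n x" for f
      using that by (rule A(3))
    show "ip Om (\<lambda>y. c * f y) h = c * ip Om f h" for f c h by (rule ip_scale_left)
    show "ip Om f g = ip Om g f" for f g by (rule ip_commute)
    show "0 \<le> ip Om f f" for f by (rule ip_self_nonneg)
    show "f y = 0" if "f \<in> Sh k n x" "ip Om f f = 0" "y \<in> {0..1}" for f y
      using that by (rule Sh_L2_definite)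
  qed (rule that)
qed

text \<open>Orthonormality for the product of derivatives turns the Ritz projection into a finite
  Fourier sum, so that its existence and its dependence on time are explicit.\<close>

lemma Sh_H1_orthonormal_basis:
  assumes part: "is_partition n x" and nodes: "lagrange_nodes k n x P"
  obtains m and \<phi> :: "nat \<Rightarrow> real \<Rightarrow> real" where "\<And>i. i < m \<Longrightarrow> \<phi> i \<in> Sh k n x"
    "\<And>i j. i < m \<Longrightarrow> j < m \<Longrightarrow> ip Om (wD Om (\<phi> i)) (wD Om (\<phi> j)) = (if i = j then 1 else 0)"
    "\<And>W y. W \<in> Sh k n x \<Longrightarrow> y \<in> {0..1} \<Longrightarrow> W y = (\<Sum>i<m. ip Om (wD Om W) (wD Om (\<phi> i)) * \<phi> i y)"
proof -
  obtain A where A: "finite A" "A \<subseteq> Sh k n x"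
    "\<And>W. W \<in> Sh k n x \<Longrightarrow> \<exists>w. \<forall>y\<in>{0..1}. W y = (\<Sum>a\<in>A. w a * a y)"
    using Sh_span[OF assms] by blast
  show thesis
  proof (rule Gram_Schmidt[of "Sh k n x" "\<lambda>f g. ip Om (wD Om f) (wD Om g)" "{0..1}" A])
    fix f g h assume F: "f \<in> Sh k n x" "g \<in> Sh k n x" "h \<in> Sh k n x"
    note a = ac_add[OF Sh_ac[OF F(1) part] Sh_ac[OF F(2) part]]
    have "ip Om (wD Om (\<lambda>y. f y + g y)) (wD Om h) = ip Om (\<lambda>y. wD Om f y + wD Om g y) (wD Om h)"
      by (rule ip_cong_AE[OF Sh_wD_eqI[OF Sh_add[OF F(1,2)] part a refl] _
            Sh_wD_L2[OF Sh_add[OF F(1,2)] part] ac_L2_deriv[OF a]]) (auto intro: Sh_wD_L2[OF F(3) part])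
    then show "ip Om (wD Om (\<lambda>y. f y + g y)) (wD Om h) = ip Om (wD Om f) (wD Om h) + ip Om (wD Om g) (wD Om h)"
      using ip_add_left[OF Sh_wD_L2[OF F(1) part] Sh_wD_L2[OF F(2) part] Sh_wD_L2[OF F(3) part]] by simp
  next
    fix f c h assume F: "f \<in> Sh k n x" "h \<in> Sh k n x"
    note a = ac_scale[OF Sh_ac[OF F(1) part], of c]
    have "ip Om (wD Om (\<lambda>y. c * f y)) (wD Om h) = ip Om (\<lambda>y. c * wD Om f y) (wD Om h)"
      by (rule ip_cong_AE[OF Sh_wD_eqI[OF Sh_scale[OF F(1)] part a refl] _
            Sh_wD_L2[OF Sh_scale[OF F(1)] part] ac_L2_deriv[OF a]]) (auto intro: Sh_wD_L2[OF F(2) part])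
    then show "ip Om (wD Om (\<lambda>y. c * f y)) (wD Om h) = c * ip Om (wD Om f) (wD Om h)"
      by (simp add: ip_scale_left)
  next
    fix f g h assume F: "f \<in> Sh k n x" "g \<in> Sh k n x" "h \<in> Sh k n x" "\<And>y. y \<in> {0..1} \<Longrightarrow> f y = g y"
    show "ip Om (wD Om f) (wD Om h) = ip Om (wD Om g) (wD Om h)"
      by (rule ip_cong_AE[OF Sh_wD_eqI[OF F(1) part Sh_ac[OF F(2) part] F(4)] _
            Sh_wD_L2[OF F(1) part] Sh_wD_L2[OF F(2) part]]) (auto intro: Sh_wD_L2[OF F(3) part])
  next
    show "(\<lambda>y. f y + g y) \<in> Sh k n x" if "f \<in> Sh k n x" "g \<in> Sh k n x" for f g
      using that by (rule Sh_add)
    show "(\<lambda>y. c * f y) \<in> Sh k n x" if "f \<in> Sh k n x" for f c using that by (rule Sh_scale)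
    show "(\<lambda>y. 0) \<in> Sh k n x" by (rule Sh_zero)
    show "finite A" "A \<subseteq> Sh k n x" by (fact A)+
    show "\<exists>w. \<forall>y\<in>{0..1}. f y = (\<Sum>a\<in>A. w a * a y)" if "f \<in> Sh k n x" for f
      using that by (rule A(3))
    show "ip Om (wD Om f) (wD Om g) = ip Om (wD Om g) (wD Om f)" for f g by (rule ip_commute)
    show "0 \<le> ip Om (wD Om f) (wD Om f)" for f by (rule ip_self_nonneg)
    show "f y = 0" if "f \<in> Sh k n x" "ip Om (wD Om f) (wD Om f) = 0" "y \<in> {0..1}" for f y
      by (rule Sh_H1_definite[OF that(1) part that(2,3)])
  qed (rule that)
qed

section \<open>Hat functions and the Ritz error\<close>

lemma partition_ends:
  assumes "is_partition n x" shows "0 < n" "x 0 = 0" "x n = 1"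
  using assms unfolding is_partition_def by auto

text \<open>Since 1/(s(1-s)) = 1/s + 1/(1-s), the derivative is 1/s to the left of s and -1/(1-s) to
  the right. Pairing it with the derivative of a function vanishing at 0 and 1 returns a multiple of
  the value of that function at s.\<close>

lemma hat_in_Sh:
  assumes part: "is_partition n x" and k: "1 \<le> k" and j: "0 < j" "j < n"
  defines "s \<equiv> x j"
  shows "(\<lambda>y. min (y / s) ((1 - y) / (1 - s))) \<in> Sh k n x"
    "ac 0 1 (\<lambda>y. min (y / s) ((1 - y) / (1 - s))) (\<lambda>y. 1 / (s * (1 - s)) * indicator {..s} y - 1 / (1 - s))"
proof -
  let ?W = "\<lambda>y. min (y / s) ((1 - y) / (1 - s))"
  have s: "0 < s" "s < 1"
    using partition_less[OF part, of 0 j] partition_less[OF part, of j n] j partition_ends[OF part]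
    by (simp_all add: s_def)
  have left: "?W y = y / s" if "y \<le> s" for y
  proof -
    have "y / s \<le> 1" "1 \<le> (1 - y) / (1 - s)" using that s by auto
    then show ?thesis by simp
  qed
  have right: "?W y = (1 - y) / (1 - s)" if "s \<le> y" for y
  proof -
    have "1 \<le> y / s" "(1 - y) / (1 - s) \<le> 1" using that s by auto
    then show ?thesis by simp
  qed
  show "?W \<in> Sh k n x"
    unfolding Sh_def
  proof (intro CollectI conjI allI impI)
    show "continuous_on {0..1} ?W" using s by (intro continuous_intros) auto
    show "?W 0 = 0" "?W 1 = 0" using left[of 0] right[of 1] s by auto
    fix i assume i: "i < n"
    show "\<exists>p. degree p \<le> k \<and> (\<forall>y\<in>{x i..x (Suc i)}. ?W y = poly p y)"
    proof (cases "i < j")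
      case True
      then have "x (Suc i) \<le> s" using partition_le[OF part, of "Suc i" j] j by (simp add: s_def)
      then have "\<forall>y\<in>{x i..x (Suc i)}. ?W y = poly [:0, 1 / s:] y" using left by auto
      then show ?thesis using k by (intro exI[of _ "[:0, 1 / s:]"]) simp
    next
      case False
      then have "s \<le> x i" using partition_le[OF part, of j i] i by (simp add: s_def)
      then have "\<forall>y\<in>{x i..x (Suc i)}. ?W y = poly [:1 / (1 - s), - 1 / (1 - s):] y"
        using right by (auto simp: diff_divide_distrib)
      then show ?thesis using k by (intro exI[of _ "[:1 / (1 - s), - 1 / (1 - s):]"]) simp
    qed
  qed
  show "ac 0 1 ?W (\<lambda>y. 1 / (s * (1 - s)) * indicator {..s} y - 1 / (1 - s))"
    unfolding ac_def
  proof (intro conjI ballI)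
    have i: "(\<lambda>y. 1 / (s * (1 - s)) * indicator {..s} y) \<in> L2 Om" by (intro L2_scale L2_indicator) auto
    then show "(\<lambda>y. 1 / (s * (1 - s)) * indicator {..s} y - 1 / (1 - s)) \<in> L2 Om" by (rule L2_diff[OF _ L2_const])
    fix y :: real assume y: "y \<in> {0..1}"
    have c: "prim Om (\<lambda>y. c) y = c * y" if "y \<in> {0..1}" for c y
      using prim_FTC[of 0 y 1 "\<lambda>y. c * y" "\<lambda>y. c"] that by (auto intro!: derivative_eq_intros)
    have "prim Om (indicator {..s}) y = ip Om (\<lambda>y. 1) (indicator {..min s y})"
      unfolding prim_def ip_def by (rule Bochner_Integration.integral_cong) (auto simp: indicator_def)
    also have "\<dots> = min s y" using c[of "min s y" 1] y s by (simp add: prim_def)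
    finally have p: "prim Om (\<lambda>y. 1 / (s * (1 - s)) * indicator {..s} y - 1 / (1 - s)) y
        = 1 / (s * (1 - s)) * min s y - 1 / (1 - s) * y"
      unfolding prim_diff[OF i L2_const] prim_scale using c[OF y] by simp
    have "1 / (s * (1 - s)) = 1 / s + 1 / (1 - s)" using s by (simp add: field_simps)
    then have "1 / (s * (1 - s)) * min s y - 1 / (1 - s) * y = (1 / s + 1 / (1 - s)) * min s y - 1 / (1 - s) * y"
      by (simp only:)
    also have "(1 / s + 1 / (1 - s)) * min s y - 1 / (1 - s) * y = ?W y"
    proof (cases "y \<le> s")
      case True
      then have "(1 / s + 1 / (1 - s)) * min s y - 1 / (1 - s) * y = y / s"
        by (simp add: distrib_right)
      then show ?thesis using left[OF True] by simp
    next
      case False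
      then have "(1 / s + 1 / (1 - s)) * min s y - 1 / (1 - s) * y = 1 + (s - y) / (1 - s)"
        using s(1) by (simp add: distrib_right diff_divide_distrib)
      also have "1 + (s - y) / (1 - s) = (1 - y) / (1 - s)" using s(2) by (simp add: field_simps)
      finally have "(1 / s + 1 / (1 - s)) * min s y - 1 / (1 - s) * y = (1 - y) / (1 - s)" .
      then show ?thesis using right[of y] False by simp
    qed
    finally show "?W y = ?W 0 + prim Om (\<lambda>y. 1 / (s * (1 - s)) * indicator {..s} y - 1 / (1 - s)) y"
      unfolding p using left[of 0] s by simp
  qed
qed

text \<open>In one dimension the Ritz projection agrees with the function at the break points (test with the
  hat function peaking there), which replaces the Aubin-Nitsche duality argument.\<close>

lemma ritz_error:
  assumes part: "is_partition n x" and nodes: "lagrange_nodes k n x P" and k: "1 \<le> k"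
    and u: "u \<in> Hs (Suc k) Om" and c: "ac 0 1 c (wD Om u)" "AE y in lebesgue_on Om. u y = c y"
    and c0: "c 0 = 0" "c 1 = 0" and R: "R \<in> Sh k n x"
    and orth: "\<And>W. W \<in> Sh k n x \<Longrightarrow> ip Om (wD Om u) (wD Om W) = ip Om (wD Om R) (wD Om W)"
  shows "L2norm Om (\<lambda>y. c y - R y) \<le> mesh n x ^ (k + 1) * L2norm Om ((wD Om ^^ Suc k) u)"
proof -
  let ?g = "wD Om u" and ?r = "wD Om R" and ?D = "L2norm Om ((wD Om ^^ Suc k) u)"
  let ?I = "\<lambda>y. \<Sum>p\<in>P. c p * lagrange_basis k n x P p y"
  note g = ac_L2_deriv[OF c(1)] and r = Sh_wD_L2[OF R part]
  have I: "?I \<in> Sh k n x" "\<And>q. q \<in> P \<Longrightarrow> ?I q = c q" using lagrange_combination[OF part nodes] by auto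
  note i = Sh_wD_L2[OF I(1) part]
  have orth': "ip Om (\<lambda>y. ?g y - ?r y) (wD Om W) = 0" if "W \<in> Sh k n x" for W
    using orth[OF that] ip_diff_left[OF g r Sh_wD_L2[OF that part]] by simp
  have gr: "(\<lambda>y. ?g y - ?r y) \<in> L2 Om" and gi: "(\<lambda>y. ?g y - wD Om ?I y) \<in> L2 Om"
    by (intro L2_diff g r i)+
  \<comment> \<open>Orthogonality allows \<open>?r\<close> in the second factor to be replaced by
    the derivative of the interpolant; Cauchy-Schwarz then gives best approximation in the
    derivative norm.\<close>
  have "(L2norm Om (\<lambda>y. ?g y - ?r y))\<^sup>2 = ip Om (\<lambda>y. ?g y - ?r y) (\<lambda>y. ?g y - wD Om ?I y)"
    using orth'[OF R] orth'[OF I(1)] ip_diff_right[OF g r gr] ip_diff_right[OF g i gr]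
    by (simp add: L2norm_square)
  also have "\<dots> \<le> L2norm Om (\<lambda>y. ?g y - ?r y) * L2norm Om (\<lambda>y. ?g y - wD Om ?I y)"
    using ip_Cauchy_Schwarz[OF gr gi] by linarith
  finally have "L2norm Om (\<lambda>y. ?g y - ?r y) \<le> L2norm Om (\<lambda>y. ?g y - wD Om ?I y)"
    by (cases "L2norm Om (\<lambda>y. ?g y - ?r y) = 0")
       (auto simp: power2_eq_square less_le)
  also have "\<dots> \<le> mesh n x ^ k * ?D"
    by (rule interpolation_error(2)[OF part nodes k u c c0 I])
  finally have e1: "L2norm Om (\<lambda>y. ?g y - ?r y) \<le> mesh n x ^ k * ?D" .
  have e: "ac 0 1 (\<lambda>y. c y - R y) (\<lambda>y. ?g y - ?r y)" by (rule ac_diff[OF c(1) Sh_ac[OF R part]])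
  have e_prim: "c y - R y = prim Om (\<lambda>y. ?g y - ?r y) y" if "y \<in> {0..1}" for y
    using ac_eq[OF e that] c0(1) Sh_boundary(1)[OF R] by simp
  have node: "c (x j) - R (x j) = 0" if "j < n" for j
  proof (cases "j = 0")
    case True
    then show ?thesis using partition_ends(2)[OF part] c0 Sh_boundary(1)[OF R] by simp
  next
    case False
    let ?s = "x j"
    have s: "0 < ?s" "?s < 1"
      using partition_less[OF part, of 0 j] partition_less[OF part, of j n] that False partition_ends[OF part]
      by simp_all
    note h = hat_in_Sh[OF part k, of j]
    have W: "(\<lambda>y. min (y / ?s) ((1 - y) / (1 - ?s))) \<in> Sh k n x" using h(1) False that by simp
    have Wa: "ac 0 1 (\<lambda>y. min (y / ?s) ((1 - y) / (1 - ?s))) (\<lambda>y. 1 / (?s * (1 - ?s)) * indicator {..?s} y - 1 / (1 - ?s))"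
      using h(2) False that by simp
    \<comment> \<open>The hat derivative splits into an indicator and a constant. The indicator
      returns the error at \<open>?s\<close>, the constant the error at 1, which is 0.\<close>
    have "0 = ip Om (\<lambda>y. ?g y - ?r y) (wD Om (\<lambda>y. min (y / ?s) ((1 - y) / (1 - ?s))))"
      using orth'[OF W] by simp
    also have "\<dots> = ip Om (\<lambda>y. ?g y - ?r y) (\<lambda>y. 1 / (?s * (1 - ?s)) * indicator {..?s} y - 1 / (1 - ?s))"
      by (rule ip_cong_AE[OF _ Sh_wD_eqI[OF W part Wa refl] gr gr Sh_wD_L2[OF W part] ac_L2_deriv[OF Wa]]) simp
    also have "\<dots> = 1 / (?s * (1 - ?s)) * ip Om (\<lambda>y. ?g y - ?r y) (indicator {..?s})
        - 1 / (1 - ?s) * ip Om (\<lambda>y. ?g y - ?r y) (\<lambda>y. 1)"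
      using ip_diff_right[OF L2_scale[OF L2_indicator] L2_const gr, of "{..?s}" "1 / (?s * (1 - ?s))" "1 / (1 - ?s)"]
        ip_scale_right[of Om "\<lambda>y. ?g y - ?r y" "1 / (?s * (1 - ?s))" "indicator {..?s}"]
        ip_scale_right[of Om "\<lambda>y. ?g y - ?r y" "1 / (1 - ?s)" "\<lambda>y. 1"] by simp
    also have "ip Om (\<lambda>y. ?g y - ?r y) (\<lambda>y. 1) = 0"
      using e_prim[of 1] c0 Sh_boundary(2)[OF R] by (simp add: prim_right)
    also have "ip Om (\<lambda>y. ?g y - ?r y) (indicator {..?s}) = c ?s - R ?s"
      using e_prim[of ?s] s by (simp add: prim_def)
    finally show ?thesis using s by simp
  qed
  \<comment> \<open>On each element the error starts from 0 at the left break point, so one more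
    integration gains the missing power of h with constant 1.\<close>
  have "L2norm Om (\<lambda>y. c y - R y) \<le> 1 * mesh n x * L2norm Om (\<lambda>y. ?g y - ?r y)"
  proof (rule piecewise_norm_bound[OF part ac_L2[OF e] gr])
    fix j y assume j: "j < n" and y: "y \<in> {x j<..x (Suc j)}"
    have r01: "x j \<in> {0..1}" "y \<in> {0..1}"
      using partition_range[OF part, of j] partition_range[OF part, of "Suc j"] j y by auto
    have "c y - R y = prim Om (\<lambda>y. ?g y - ?r y) y - prim Om (\<lambda>y. ?g y - ?r y) (x j)"
      using e_prim[OF r01(1)] e_prim[OF r01(2)] node[OF j] by simp
    then show "\<bar>c y - R y\<bar> \<le> 1 * (L2norm Om (loc x (\<lambda>y. ?g y - ?r y) j) * sqrt (x (Suc j) - x j))"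
      using prim_local_Hoelder[OF part j gr, of y "x j"] y by simp
  qed simp
  also have "\<dots> \<le> 1 * mesh n x * (mesh n x ^ k * ?D)"
    using mesh_pos[OF part] e1 by (intro mult_left_mono) auto
  finally show ?thesis by (simp add: mult_ac)
qed

section \<open>Functions of time\<close>

text \<open>Lebesgue measure is complete, so changing f on a null set cannot destroy
  measurability.\<close>

lemma measurable_lebesgue_on_AE:
  fixes f g :: "real \<Rightarrow> real"
  assumes f: "f \<in> borel_measurable (lebesgue_on {a<..<b})" and ae: "AE x in lebesgue_on {a<..<b}. f x = g x"
  shows "g \<in> borel_measurable (lebesgue_on {a<..<b})"
proof -
  let ?S = "{a<..<b}"
  have "(\<lambda>x. if x \<in> ?S then f x else 0) \<in> borel_measurable lebesgue"
    using f by (rule iffD2[OF borel_measurable_if[OF open_interval_lebesgue]])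
  moreover have "AE x in lebesgue. (if x \<in> ?S then f x else 0) = (if x \<in> ?S then g x else 0)"
    using ae by (subst (asm) AE_restrict_space_iff) (auto elim!: eventually_mono)
  ultimately have "(\<lambda>x. if x \<in> ?S then g x else 0) \<in> borel_measurable lebesgue"
    by (rule borel_measurable_AE)
  then show ?thesis by (rule iffD1[OF borel_measurable_if[OF open_interval_lebesgue]])
qed

lemma measurable_limit_AE:
  fixes f :: "nat \<Rightarrow> real \<Rightarrow> real"
  assumes f: "\<And>n. f n \<in> borel_measurable (lebesgue_on {a<..<b})"
    and lim: "AE x in lebesgue_on {a<..<b}. (\<lambda>n. f n x) \<longlonglongrightarrow> g x"
  shows "g \<in> borel_measurable (lebesgue_on {a<..<b})"
proof (rule measurable_lebesgue_on_AE)
  show "(\<lambda>x. lim (\<lambda>n. f n x)) \<in> borel_measurable (lebesgue_on {a<..<b})"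
    by (rule borel_measurable_lim_metric[OF f])
  show "AE x in lebesgue_on {a<..<b}. lim (\<lambda>n. f n x) = g x"
    using lim by eventually_elim (rule limI)
qed

text \<open>Composing F with a simple map gives a finite sum of constants times indicators of
  measurable level sets.\<close>

lemma simple_map_measurable:
  fixes F :: "(real \<Rightarrow> real) \<Rightarrow> real"
  assumes "simple_map T X s"
  shows "(\<lambda>t. F (s t)) \<in> borel_measurable (lebesgue_on {0<..<T})"
proof -
  let ?S = "{0<..<T}"
  have fin: "finite (s ` ?S)" and lev: "{t \<in> ?S. s t = x} \<in> sets lebesgue" for x
    using assms unfolding simple_map_def by blast+
  have "(\<lambda>t. \<Sum>x\<in>s ` ?S. F x * indicator {t \<in> ?S. s t = x} t) \<in> borel_measurable (lebesgue_on ?S)"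
    by (intro borel_measurable_sum borel_measurable_times borel_measurable_const
        measurable_restrict_space1[OF borel_measurable_indicator[OF lev]])
  moreover have "(\<Sum>x\<in>s ` ?S. F x * indicator {t \<in> ?S. s t = x} t) = F (s t)" if "t \<in> ?S" for t
  proof -
    have "(\<Sum>x\<in>s ` ?S. F x * indicator {t \<in> ?S. s t = x} t) = (\<Sum>x\<in>s ` ?S. if x = s t then F x else 0)"
      by (rule sum.cong) (use that in \<open>auto simp: indicator_def\<close>)
    then show ?thesis using fin that by simp
  qed
  ultimately show ?thesis
    using measurable_cong[of "lebesgue_on ?S" "\<lambda>t. \<Sum>x\<in>s ` ?S. F x * indicator {t \<in> ?S. s t = x} t" "\<lambda>t. F (s t)" borel]
    by simp
qed

lemma L2_time_AE: "u \<in> L2_time T X N \<Longrightarrow> AE t in lebesgue_on {0<..<T}. u t \<in> X"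
  unfolding L2_time_def strongly_measurable_def by (auto elim: eventually_mono)

lemma L2_time_norm_L2:
  assumes "u \<in> L2_time T X N" "\<And>w. 0 \<le> N w" shows "(\<lambda>t. N (u t)) \<in> L2 {0<..<T}"
proof (rule L2I)
  show i: "integrable (lebesgue_on {0<..<T}) (\<lambda>t. (N (u t))\<^sup>2)"
    using assms(1) by (simp add: L2_time_def)
  have "(\<lambda>t. sqrt ((N (u t))\<^sup>2)) \<in> borel_measurable (lebesgue_on {0<..<T})"
    using borel_measurable_integrable[OF i] by measurable
  then show "(\<lambda>t. N (u t)) \<in> borel_measurable (lebesgue_on {0<..<T})" using assms(2) by simp
qed

text \<open>Measurability comes from simple approximants, whose pairings with w converge almost
  everywhere; integrability comes from Cauchy-Schwarz and the square-integrable norm.\<close>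

lemma L2_time_ip_L2:
  assumes u: "u \<in> L2_time T (L2 Om) (L2norm Om)" and w: "w \<in> L2 Om"
  shows "(\<lambda>t. ip Om (u t) w) \<in> L2 {0<..<T}"
proof -
  let ?S = "{0<..<T}"
  obtain s where s: "\<And>n. simple_map T (L2 Om) (s n)"
    and lim: "AE t in lebesgue_on ?S. u t \<in> L2 Om \<and> (\<lambda>n. L2norm Om (\<lambda>y. s n t y - u t y)) \<longlonglongrightarrow> 0"
    using u unfolding L2_time_def strongly_measurable_def by blast
  have sL: "s n t \<in> L2 Om" if "t \<in> ?S" for n t
    using s[of n] that unfolding simple_map_def by blast
  have "(\<lambda>t. ip Om (u t) w) \<in> borel_measurable (lebesgue_on ?S)"
  proof (rule measurable_limit_AE)
    show "(\<lambda>t. ip Om (s n t) w) \<in> borel_measurable (lebesgue_on ?S)" for n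
      by (rule simple_map_measurable[OF s])
    show "AE t in lebesgue_on ?S. (\<lambda>n. ip Om (s n t) w) \<longlonglongrightarrow> ip Om (u t) w"
      using lim
    proof (rule lebesgue_on_mono)
      fix t assume "u t \<in> L2 Om \<and> (\<lambda>n. L2norm Om (\<lambda>y. s n t y - u t y)) \<longlonglongrightarrow> 0" "t \<in> ?S"
      then show "(\<lambda>n. ip Om (s n t) w) \<longlonglongrightarrow> ip Om (u t) w"
        using sL w by (intro tendsto_ip_left) auto
    qed
  qed
  moreover have "AE t in lebesgue_on ?S. \<bar>ip Om (u t) w\<bar> \<le> \<bar>L2norm Om w * L2norm Om (u t)\<bar>"
    using L2_time_AE[OF u]
  proof eventually_elim
    case (elim t)
    show ?case using ip_Cauchy_Schwarz[OF elim w] by (simp add: abs_mult mult.commute[of "L2norm Om w"])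
  qed
  ultimately show ?thesis
    by (rule L2_bound[OF L2_scale[OF L2_time_norm_L2[OF u L2norm_nonneg]]])
qed

section \<open>Weak derivatives in time\<close>

lemma Dt_works:
  assumes "u \<in> H1_time T S"
  shows "Dt T S u \<in> L2_time T (L2 S) (L2norm S)" "has_weak_time_deriv T S u (Dt T S u)"
proof -
  have "\<exists>u'. u' \<in> L2_time T (L2 S) (L2norm S) \<and> has_weak_time_deriv T S u u'"
    using assms unfolding H1_time_def by blast
  from someI_ex[OF this] show "Dt T S u \<in> L2_time T (L2 S) (L2norm S)" "has_weak_time_deriv T S u (Dt T S u)"
    unfolding Dt_def by blast+
qed

lemma H1_time_L2: "u \<in> H1_time T S \<Longrightarrow> t \<in> {0..T} \<Longrightarrow> u t \<in> L2 S"
  unfolding H1_time_def by blast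

lemma H1_time_tendsto:
  "u \<in> H1_time T S \<Longrightarrow> t \<in> {0..T} \<Longrightarrow> ((\<lambda>s. L2norm S (\<lambda>y. u s y - u t y)) \<longlongrightarrow> 0) (at t within {0..T})"
  unfolding H1_time_def by blast

text \<open>Pairing with a fixed w reduces the vector-valued statement to du Bois-Reymond for scalar
  functions. The continuous representative built into \<open>H1_time\<close> upgrades the identity
  from almost every t to every t, end points included.\<close>

lemma H1_time_ac:
  assumes u: "u \<in> H1_time T Om" and w: "w \<in> L2 Om" and T: "0 < T"
  shows "ac 0 T (\<lambda>t. ip Om (u t) w) (\<lambda>t. ip Om (Dt T Om u t) w)"
proof -
  let ?S = "{0<..<T}" and ?F = "\<lambda>t. ip Om (u t) w" and ?G = "\<lambda>t. ip Om (Dt T Om u t) w"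
  note D = Dt_works[OF u]
  have cont: "continuous_on {0..T} ?F"
    unfolding continuous_on_def
  proof
    fix t assume t: "t \<in> {0..T}"
    have "((\<lambda>s. ?F s - ?F t) \<longlongrightarrow> 0) (at t within {0..T})"
    proof (rule Lim_null_comparison)
      have le: "norm (?F s - ?F t) \<le> L2norm Om (\<lambda>y. u s y - u t y) * L2norm Om w" if "s \<in> {0..T}" for s
        using ip_Cauchy_Schwarz[OF L2_diff[OF H1_time_L2[OF u that] H1_time_L2[OF u t]] w]
          ip_diff_left[OF H1_time_L2[OF u that] H1_time_L2[OF u t] w] by simp
      show "\<forall>\<^sub>F s in at t within {0..T}. norm (?F s - ?F t) \<le> L2norm Om (\<lambda>y. u s y - u t y) * L2norm Om w"
        unfolding eventually_at_filter using le by (intro always_eventually) blast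
      show "((\<lambda>s. L2norm Om (\<lambda>y. u s y - u t y) * L2norm Om w) \<longlongrightarrow> 0) (at t within {0..T})"
        by (rule tendsto_mult_left_zero[OF H1_time_tendsto[OF u t]])
    qed
    then show "(?F \<longlongrightarrow> ?F t) (at t within {0..T})" by (simp add: LIM_zero_iff)
  qed
  have G: "?G \<in> L2 ?S" by (rule L2_time_ip_L2[OF D(1) w])
  have "has_weak_deriv ?S ?F ?G"
    using D(2) w unfolding has_weak_time_deriv_def has_weak_deriv_def ip_def[of ?S] by blast
  then obtain k where k: "AE t in lebesgue_on ?S. ?F t = k + prim ?S ?G t"
    using du_Bois_Reymond[OF T L2_continuous[OF cont] G] by blast
  have eq: "?F t = k + prim ?S ?G t" if "t \<in> {0..T}" for t
    by (rule continuous_AE_eq[OF T cont _ k that]) (intro continuous_intros G)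
  have "?F 0 = k" using eq[of 0] T by simp
  then show ?thesis unfolding ac_def using G eq by blast
qed

lemma Hs_wD_weak: "u \<in> Hs (Suc m) Om \<Longrightarrow> \<phi> \<in> C1c Om \<Longrightarrow> ip Om (wD Om u) \<phi> = - ip Om u (deriv \<phi>)"
  using Hs_Suc_wD(2)[of u m 0 1] unfolding has_weak_deriv_def by simp

lemma Hs_wD_L2: "u \<in> Hs (Suc m) Om \<Longrightarrow> wD Om u \<in> L2 Om"
  by (rule Hs_L2[OF Hs_Suc_wD(1)])

text \<open>If \<open>\<partial>v/\<partial>t\<close> has a space derivative, it is the time derivative of \<open>\<partial>v/\<partial>y\<close>: this is
  immediate after pairing with \<open>C\<^sup>1\<^sub>c\<close> functions, which are dense.\<close>

lemma H1_time_wD: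
  assumes v: "v \<in> H1_time T Om" and T: "0 < T"
    and z: "Dt T Om v \<in> L2_time T (Hs (Suc m) Om) (Hnorm (Suc m) Om)" and w: "w \<in> L2 Om"
    and v0: "v 0 \<in> Hs (Suc m) Om"
  shows "(\<lambda>\<tau>. ip Om (wD Om (Dt T Om v \<tau>)) w) \<in> L2 {0<..<T}"
    "\<And>t. t \<in> {0..T} \<Longrightarrow> v t \<in> Hs (Suc m) Om \<Longrightarrow>
      ip Om (wD Om (v t)) w = ip Om (wD Om (v 0)) w + prim {0<..<T} (\<lambda>\<tau>. ip Om (wD Om (Dt T Om v \<tau>)) w) t"
proof -
  let ?S = "{0<..<T}" and ?z = "Dt T Om v" and ?N = "\<lambda>\<tau>. Hnorm (Suc m) Om (Dt T Om v \<tau>)"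
  obtain \<phi> where \<phi>: "\<And>n. \<phi> n \<in> C1c Om" "(\<lambda>n. L2norm Om (\<lambda>x. \<phi> n x - w x)) \<longlonglongrightarrow> 0"
    using C1c_dense[OF w] by blast
  note \<phi>L = C1c_L2[OF \<phi>(1)] and \<phi>D = C1c_deriv_L2[OF \<phi>(1)]
  have N: "?N \<in> L2 ?S" by (rule L2_time_norm_L2[OF z Hnorm_nonneg])
  note zH = L2_time_AE[OF z]
  \<comment> \<open>Moving the y-derivative onto \<open>\<phi> n\<close> leaves a pairing with
    \<open>Dt T Om v\<close> itself, to which \<open>H1_time_ac\<close> applies; the limit in n
    restores w.\<close>
  let ?q = "\<lambda>\<tau>. ip Om (wD Om (?z \<tau>)) w" and ?qn = "\<lambda>n \<tau>. - ip Om (?z \<tau>) (deriv (\<phi> n))"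
  have qn: "?qn n \<in> L2 ?S" for n
    by (intro L2_uminus L2_time_ip_L2[OF Dt_works(1)[OF v]] \<phi>D)
  have wz: "L2norm Om (wD Om u) \<le> Hnorm (Suc m) Om u" for u
    using L2norm_wD_le_Hnorm[of 1 "Suc m" Om u] by simp
  have lim: "AE \<tau> in lebesgue_on ?S. (\<lambda>n. ?qn n \<tau>) \<longlonglongrightarrow> ?q \<tau>"
    using zH
  proof eventually_elim
    case (elim \<tau>)
    have "(\<lambda>n. ip Om (\<phi> n) (wD Om (?z \<tau>))) \<longlonglongrightarrow> ip Om w (wD Om (?z \<tau>))"
      by (rule tendsto_ip_left[OF w \<phi>L \<phi>(2) Hs_wD_L2[OF elim]])
    then show ?case using Hs_wD_weak[OF elim \<phi>(1)] by (simp add: ip_commute[of Om _ "wD Om (?z \<tau>)"])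
  qed
  have qm: "?q \<in> borel_measurable (lebesgue_on ?S)"
    by (rule measurable_limit_AE[OF L2_measurable[OF qn] lim])
  have "AE \<tau> in lebesgue_on ?S. \<bar>?q \<tau>\<bar> \<le> \<bar>L2norm Om w * ?N \<tau>\<bar>"
    using zH
  proof eventually_elim
    case (elim \<tau>)
    have "\<bar>?q \<tau>\<bar> \<le> L2norm Om (wD Om (?z \<tau>)) * L2norm Om w"
      by (rule ip_Cauchy_Schwarz[OF Hs_wD_L2[OF elim] w])
    also have "\<dots> \<le> ?N \<tau> * L2norm Om w" by (intro mult_right_mono wz) simp
    finally show ?case by (simp add: abs_mult mult.commute)
  qed
  then show q: "?q \<in> L2 ?S" by (rule L2_bound[OF L2_scale[OF N] qm])
  fix t assume t: "t \<in> {0..T}" and vt: "v t \<in> Hs (Suc m) Om"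
  \<comment> \<open>The norm of the time derivative is square-integrable over time, so the L2 error
    of \<open>\<phi> n\<close> factors out of the time integral.\<close>
  have "(\<lambda>n. prim ?S (?qn n) t - prim ?S ?q t) \<longlonglongrightarrow> 0"
  proof (rule Lim_null_comparison)
    have "\<bar>prim ?S (?qn n) t - prim ?S ?q t\<bar> \<le> L2norm Om (\<lambda>x. \<phi> n x - w x) * (L2norm ?S ?N * sqrt (T - 0))" for n
    proof -
      have "AE \<tau> in lebesgue_on ?S. \<bar>?qn n \<tau> - ?q \<tau>\<bar> \<le> \<bar>L2norm Om (\<lambda>x. \<phi> n x - w x) * ?N \<tau>\<bar>"
        using zH
      proof eventually_elim
        case (elim \<tau>)
        note zL = Hs_wD_L2[OF elim]
        have "?qn n \<tau> - ?q \<tau> = ip Om (wD Om (?z \<tau>)) (\<lambda>x. \<phi> n x - w x)"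
          using Hs_wD_weak[OF elim \<phi>(1)[of n]] ip_diff_right[OF \<phi>L w zL] by simp
        then have "\<bar>?qn n \<tau> - ?q \<tau>\<bar> \<le> L2norm Om (wD Om (?z \<tau>)) * L2norm Om (\<lambda>x. \<phi> n x - w x)"
          using ip_Cauchy_Schwarz[OF zL L2_diff[OF \<phi>L w]] by simp
        also have "\<dots> \<le> ?N \<tau> * L2norm Om (\<lambda>x. \<phi> n x - w x)" by (intro mult_right_mono wz) simp
        finally show ?case by (simp add: abs_mult mult.commute)
      qed
      then have "L2norm ?S (\<lambda>\<tau>. ?qn n \<tau> - ?q \<tau>) \<le> L2norm ?S (\<lambda>\<tau>. L2norm Om (\<lambda>x. \<phi> n x - w x) * ?N \<tau>)"
        by (rule L2norm_mono[OF L2_diff[OF qn q] L2_scale[OF N]])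
      then have "L2norm ?S (\<lambda>\<tau>. ?qn n \<tau> - ?q \<tau>) * sqrt (T - 0) \<le> L2norm Om (\<lambda>x. \<phi> n x - w x) * L2norm ?S ?N * sqrt (T - 0)"
        using T by (intro mult_right_mono) (auto simp: L2norm_scale)
      then show ?thesis
        using prim_bound[OF L2_diff[OF qn[of n] q], of t] t prim_diff[OF qn[of n] q, of t]
        by (simp add: mult.assoc)
    qed
    then show "\<forall>\<^sub>F n in sequentially. norm (prim ?S (?qn n) t - prim ?S ?q t)
        \<le> L2norm Om (\<lambda>x. \<phi> n x - w x) * (L2norm ?S ?N * sqrt (T - 0))"
      by (intro always_eventually) simp
    show "(\<lambda>n. L2norm Om (\<lambda>x. \<phi> n x - w x) * (L2norm ?S ?N * sqrt (T - 0))) \<longlonglongrightarrow> 0"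
      by (rule tendsto_mult_left_zero[OF \<phi>(2)])
  qed
  then have l1: "(\<lambda>n. prim ?S (?qn n) t) \<longlonglongrightarrow> prim ?S ?q t" by (simp only: LIM_zero_iff)
  have "prim ?S (?qn n) t = ip Om (\<phi> n) (wD Om (v t)) - ip Om (\<phi> n) (wD Om (v 0))" for n
  proof -
    have "prim ?S (?qn n) t = - prim ?S (\<lambda>\<tau>. ip Om (?z \<tau>) (deriv (\<phi> n))) t"
      by (simp add: prim_def ip_uminus_left)
    also have "\<dots> = - ip Om (v t) (deriv (\<phi> n)) + ip Om (v 0) (deriv (\<phi> n))"
      using ac_eq[OF H1_time_ac[OF v \<phi>D T] t, of n] by simp
    also have "\<dots> = ip Om (wD Om (v t)) (\<phi> n) - ip Om (wD Om (v 0)) (\<phi> n)"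
      using Hs_wD_weak[OF vt \<phi>(1)[of n]] Hs_wD_weak[OF v0 \<phi>(1)[of n]] by simp
    finally show ?thesis by (simp add: ip_commute)
  qed
  moreover have "(\<lambda>n. ip Om (\<phi> n) (wD Om (v t)) - ip Om (\<phi> n) (wD Om (v 0))) \<longlonglongrightarrow>
      ip Om w (wD Om (v t)) - ip Om w (wD Om (v 0))"
    by (intro tendsto_diff tendsto_ip_left[OF w \<phi>L \<phi>(2)] Hs_wD_L2[OF vt] Hs_wD_L2[OF v0])
  ultimately have "prim ?S ?q t = ip Om w (wD Om (v t)) - ip Om w (wD Om (v 0))"
    using l1 LIMSEQ_unique by fastforce
  then show "ip Om (wD Om (v t)) w = ip Om (wD Om (v 0)) w + prim ?S ?q t"
    by (simp add: ip_commute[of Om _ w])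
qed

section \<open>Boundary values of the initial value and of the time derivative\<close>

lemma Hs_boundary_functional:
  assumes u: "u \<in> Hs (Suc m) Om" and c: "ac 0 1 c (wD Om u)" "AE y in lebesgue_on Om. u y = c y"
    and w: "ac 0 1 w w'"
  shows "ip Om (wD Om u) w + ip Om u w' = c 1 * w 1 - c 0 * w 0"
proof -
  have "ip Om u w' = ip Om c w'"
    by (rule ip_cong_AE[OF c(2) _ Hs_L2[OF u] ac_L2[OF c(1)] ac_L2_deriv[OF w] ac_L2_deriv[OF w]]) simp
  then show ?thesis using ac_ibp[OF c(1) w zero_le_one] by simp
qed

text \<open>The functional (u',y-\<kappa>) + (u,1) equals (1-\<kappa>)u(1) + \<kappa> u(0), so
  \<kappa> = 0 and \<kappa> = 1 isolate the two ends. Along v it agrees almost everywhere with an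
  absolutely continuous function of t that vanishes; hence it is 0 at t = 0, and so, for almost
  every t, is its derivative, the same functional of the time derivative of v.\<close>

lemma boundary_values_vanish:
  assumes v: "v \<in> H1_time T Om" and T: "0 < T"
    and z: "Dt T Om v \<in> L2_time T (Hs (Suc m) Om) (Hnorm (Suc m) Om)"
    and v0: "v 0 \<in> Hs (Suc m) Om"
    and vt: "AE t in lebesgue_on {0<..<T}. v t \<in> H10 Om \<and> v t \<in> Hs (Suc m) Om"
  shows "\<exists>c. ac 0 1 c (wD Om (v 0)) \<and> (AE y in lebesgue_on Om. v 0 y = c y) \<and> c 0 = 0 \<and> c 1 = 0" (is "?P (v 0)")
    "AE t in lebesgue_on {0<..<T}. \<exists>c. ac 0 1 c (wD Om (Dt T Om v t)) \<and>
       (AE y in lebesgue_on Om. Dt T Om v t y = c y) \<and> c 0 = 0 \<and> c 1 = 0"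
proof -
  let ?S = "{0<..<T}" and ?z = "Dt T Om v"
  let ?\<Phi> = "\<lambda>\<kappa> u. ip Om (wD Om u) (\<lambda>y. y - \<kappa>) + ip Om u (\<lambda>y. 1)"
  have w: "ac 0 1 (\<lambda>y. y - \<kappa>) (\<lambda>y. 1)" for \<kappa>
    by (rule ac_C1) (auto intro!: derivative_eq_intros)
  note wL = ac_L2[OF w]
  have key: "?\<Phi> \<kappa> (v 0) = 0" "AE t in lebesgue_on ?S. ?\<Phi> \<kappa> (?z t) = 0" for \<kappa>
  proof -
    note A = H1_time_wD[OF v T z wL[of \<kappa>] v0] and B = H1_time_ac[OF v L2_const T, of 1]
    let ?q = "\<lambda>t. ?\<Phi> \<kappa> (?z t)"
    have q: "?q \<in> L2 ?S" by (intro L2_add A(1) ac_L2_deriv[OF B])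
    have rep: "?\<Phi> \<kappa> (v t) = ?\<Phi> \<kappa> (v 0) + prim ?S ?q t" if "t \<in> {0..T}" "v t \<in> Hs (Suc m) Om" for t
      using A(2)[OF that] ac_eq[OF B that(1)] prim_add[OF A(1) ac_L2_deriv[OF B], of t] by simp
    have "AE t in lebesgue_on ?S. ?\<Phi> \<kappa> (v 0) + prim ?S ?q t = 0"
      using vt
    proof (rule lebesgue_on_mono)
      fix t assume H: "v t \<in> H10 Om \<and> v t \<in> Hs (Suc m) Om" "t \<in> ?S"
      have vH: "v t \<in> Hs (Suc m) Om" and v1: "v t \<in> H10 Om" using H(1) by blast+
      obtain c where c: "ac 0 1 c (wD Om (v t))" "AE y in lebesgue_on Om. v t y = c y" "c 0 = 0" "c 1 = 0"
        by (rule H10_rep[OF v1 zero_less_one])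
      have "t \<in> {0..T}" using H(2) by simp
      moreover have "?\<Phi> \<kappa> (v t) = 0" using Hs_boundary_functional[OF vH c(1,2) w] c(3,4) by simp
      ultimately show "?\<Phi> \<kappa> (v 0) + prim ?S ?q t = 0" using rep[OF _ vH] by simp
    qed
    \<comment> \<open>Continuity extends the identity from almost every t to all of [0,T]; the point
      t = 0 is what gives the boundary values of \<open>v 0\<close>.\<close>
    then have zero: "?\<Phi> \<kappa> (v 0) + prim ?S ?q t = 0" if "t \<in> {0..T}" for t
      by (rule continuous_AE_eq[OF T _ _ _ that, rotated 2]) (intro continuous_intros q)+
    show "?\<Phi> \<kappa> (v 0) = 0" using zero[of 0] T by simp
    then have "prim ?S ?q t = 0" if "t \<in> {0..T}" for t using zero[OF that] by simp
    moreover have "ac 0 T (prim ?S ?q) ?q" unfolding ac_def using q by simp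
    ultimately show "AE t in lebesgue_on ?S. ?q t = 0"
      by (intro ac_deriv_unique[OF _ ac_zero T, of "prim ?S ?q"])
  qed
  have concl: "?P u" if u: "u \<in> Hs (Suc m) Om" "?\<Phi> 0 u = 0" "?\<Phi> 1 u = 0" for u
  proof -
    obtain c where c: "ac 0 1 c (wD Om u)" "AE y in lebesgue_on Om. u y = c y"
      using Hs_rep[OF u(1) zero_less_one] by blast
    have "c 1 = 0" "c 0 = 0"
      using Hs_boundary_functional[OF u(1) c w, of 0] Hs_boundary_functional[OF u(1) c w, of 1] u(2,3) by auto
    then show ?thesis using c by blast
  qed
  show "?P (v 0)" by (rule concl[OF v0 key(1) key(1)])
  show "AE t in lebesgue_on ?S. ?P (?z t)"
    using L2_time_AE[OF z] key(2)[of 0] key(2)[of 1] by eventually_elim (rule concl)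
qed

text \<open>Serves for squares of coefficients in time and for the convection weight in space.
  Integration by parts is known on the whole interval; the version up to an intermediate y follows
  by cutting both derivatives off at y.\<close>

lemma ac_mult:
  assumes c: "ac a b c g" and d: "ac a b d h" and ab: "a \<le> b"
  shows "ac a b (\<lambda>t. c t * d t) (\<lambda>t. c t * h t + d t * g t)"
proof -
  let ?S = "{a<..<b}" and ?P = "prim {a<..<b}"
  note g = ac_L2_deriv[OF c] and h = ac_L2_deriv[OF d]
  have L: "(\<lambda>t. c t * h t) \<in> L2 ?S" "(\<lambda>t. d t * g t) \<in> L2 ?S"
    by (rule L2_mult_bounded_continuous[OF h ac_continuous[OF c]] L2_mult_bounded_continuous[OF g ac_continuous[OF d]])+
  have "c y * d y = c a * d a + ?P (\<lambda>t. c t * h t + d t * g t) y" if y: "y \<in> {a..b}" for y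
  proof -
    let ?i = "\<lambda>f t. f t * indicator {..y} t :: real"
    have trunc: "?P (?i f) t = ?P f (min t y)" for f t
      unfolding prim_def ip_def by (rule Bochner_Integration.integral_cong) (auto simp: indicator_def)
    have gi: "?i g \<in> L2 ?S" and hi: "?i h \<in> L2 ?S" using g h by auto
    have pp: "(\<lambda>t. ?P g t * h t) \<in> L2 ?S" "(\<lambda>t. ?P h t * g t) \<in> L2 ?S"
      by (rule L2_mult_bounded_continuous continuous_on_prim g h)+
    have "ip ?S (?P (?i g)) (?i h) = ?P (\<lambda>t. ?P g t * h t) y"
      unfolding prim_def[of ?S "\<lambda>t. ?P g t * h t"] ip_def
    proof (rule Bochner_Integration.integral_cong[OF refl])
      show "?P (?i g) t * ?i h t = ?P g t * h t * indicator {..y} t" for t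
        by (cases "t \<le> y") (simp_all add: trunc)
    qed
    moreover have "ip ?S (?i g) (?P (?i h)) = ?P (\<lambda>t. ?P h t * g t) y"
      unfolding prim_def[of ?S "\<lambda>t. ?P h t * g t"] ip_def
    proof (rule Bochner_Integration.integral_cong[OF refl])
      show "?i g t * ?P (?i h) t = ?P h t * g t * indicator {..y} t" for t
        by (cases "t \<le> y") (simp_all add: trunc)
    qed
    ultimately have ibp: "?P (\<lambda>t. ?P g t * h t) y + ?P (\<lambda>t. ?P h t * g t) y = ?P g y * ?P h y"
      using prim_ibp[OF gi hi ab] y by (simp add: trunc)
    have cs: "?P (\<lambda>t. c t * h t) y = c a * ?P h y + ?P (\<lambda>t. ?P g t * h t) y"
    proof -
      have "?P (\<lambda>t. c t * h t) y = ?P (\<lambda>t. c a * h t + ?P g t * h t) y"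
        unfolding prim_def[of ?S "\<lambda>t. c t * h t"] prim_def[of ?S "\<lambda>t. c a * h t + ?P g t * h t"]
      proof (rule ip_cong)
        fix t assume "t \<in> ?S"
        then have "c t = c a + ?P g t" by (intro ac_eq[OF c]) auto
        then show "c t * h t = c a * h t + ?P g t * h t" by (simp add: distrib_right)
      qed simp
      then show ?thesis using prim_add[OF L2_scale[OF h] pp(1)] by (simp add: prim_scale)
    qed
    have ds: "?P (\<lambda>t. d t * g t) y = d a * ?P g y + ?P (\<lambda>t. ?P h t * g t) y"
    proof -
      have "?P (\<lambda>t. d t * g t) y = ?P (\<lambda>t. d a * g t + ?P h t * g t) y"
        unfolding prim_def[of ?S "\<lambda>t. d t * g t"] prim_def[of ?S "\<lambda>t. d a * g t + ?P h t * g t"]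
      proof (rule ip_cong)
        fix t assume "t \<in> ?S"
        then have "d t = d a + ?P h t" by (intro ac_eq[OF d]) auto
        then show "d t * g t = d a * g t + ?P h t * g t" by (simp add: distrib_right)
      qed simp
      then show ?thesis using prim_add[OF L2_scale[OF g] pp(2)] by (simp add: prim_scale)
    qed
    have "c y * d y = (c a + ?P g y) * (d a + ?P h y)"
      using ac_eq[OF c y] ac_eq[OF d y] by (simp only:)
    also have "\<dots> = c a * d a + (c a * ?P h y + d a * ?P g y + ?P g y * ?P h y)"
      by (simp add: algebra_simps)
    also have "\<dots> = c a * d a + ?P (\<lambda>t. c t * h t + d t * g t) y"
      unfolding prim_add[OF L] cs ds using ibp by simp
    finally show ?thesis .
  qed
  then show ?thesis unfolding ac_def using L2_add[OF L] by blast
qed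

text \<open>Integration first gives an inequality with an antiderivative F of the continuous
  function E. As F is classically differentiable, exp(-K r)(A + K(F r - F 0)) is nonincreasing by
  the mean value theorem, although E itself is only absolutely continuous. Since s \<ge> 0, its
  integral over the whole interval may stand for the one up to r.\<close>

lemma Gronwall_ac:
  assumes E: "ac 0 T E e" and T: "0 < T" and K: "0 < K"
    and s: "integrable (lebesgue_on {0<..<T}) s" "\<And>t. 0 \<le> s t"
    and le: "AE t in lebesgue_on {0<..<T}. e t \<le> K * E t + s t" and t: "t \<in> {0..T}"
  shows "E t \<le> (E 0 + (LINT t|lebesgue_on {0<..<T}. s t)) * exp (K * t)"
proof -
  let ?S = "{0<..<T}"
  define A where "A = E 0 + (LINT t|lebesgue_on ?S. s t)"
  have cE: "continuous_on {0..T} E" by (rule ac_continuous[OF E])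
  obtain F where F: "\<And>x. x \<in> {0..T} \<Longrightarrow> (F has_real_derivative E x) (at x within {0..T})"
    using antiderivative_continuous[OF cE] by (auto simp: has_real_derivative_iff_has_vector_derivative)
  have bound: "E r \<le> A + K * (F r - F 0)" if r: "r \<in> {0..T}" for r
  proof -
    note i = L2_mult_integrable[OF ac_L2_deriv[OF E] L2_indicator, of "{..r}"]
    note j = L2_mult_integrable[OF L2_continuous[OF cE] L2_indicator, of "{..r}"]
    have "prim ?S e r \<le> (LINT t|lebesgue_on ?S. K * (E t * indicator {..r} t) + s t)"
      unfolding prim_def ip_def
    proof (rule integral_mono_AE)
      show "integrable (lebesgue_on ?S) (\<lambda>t. e t * indicator {..r} t)" by (rule i) simp
      show "integrable (lebesgue_on ?S) (\<lambda>t. K * (E t * indicator {..r} t) + s t)"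
        by (intro Bochner_Integration.integrable_add integrable_mult_right j s) simp
      show "AE t in lebesgue_on ?S. e t * indicator {..r} t \<le> K * (E t * indicator {..r} t) + s t"
        using le by eventually_elim (use s(2) in \<open>auto simp: indicator_def\<close>)
    qed
    also have "\<dots> = (LINT t|lebesgue_on ?S. K * (E t * indicator {..r} t)) + (LINT t|lebesgue_on ?S. s t)"
      by (intro Bochner_Integration.integral_add integrable_mult_right j s) simp
    also have "\<dots> = K * prim ?S E r + (LINT t|lebesgue_on ?S. s t)" by (simp add: prim_def ip_def)
    also have "prim ?S E r = F r - F 0" using r by (intro prim_FTC F cE) auto
    finally show ?thesis using ac_eq[OF E r] by (simp add: A_def)
  qed
  define G where "G r = exp (- K * r) * (A + K * (F r - F 0))" for r
  define G' where "G' r = K * exp (- K * r) * (E r - (A + K * (F r - F 0)))" for r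
  have G: "(G has_real_derivative G' r) (at r within {0..T})" if "r \<in> {0..T}" for r
    unfolding G_def G'_def by (rule derivative_eq_intros F[OF that] refl)+ (simp add: algebra_simps)
  have "G t \<le> G 0"
  proof (cases "t = 0")
    case False
    then have "0 < t" using t by simp
    have "\<exists>r\<in>{0<..<t}. G t - G 0 = G' r * (t - 0)"
    proof (rule mvt_simple[OF \<open>0 < t\<close>])
      fix r assume "0 \<le> r" "r \<le> t"
      then have r: "r \<in> {0..T}" "{0..t} \<subseteq> {0..T}" using t by auto
      show "(G has_derivative (\<lambda>h. G' r * h)) (at r within {0..t})"
        using DERIV_subset[OF G[OF r(1)] r(2)] by (simp add: has_field_derivative_def)
    qed
    then obtain r where r: "0 < r" "r < t" "G t - G 0 = G' r * t" by auto
    have "r \<in> {0..T}" using r(1,2) t by auto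
    then have "G' r \<le> 0"
      unfolding G'_def using bound[of r] K by (intro mult_nonneg_nonpos) auto
    then show ?thesis using r(3) \<open>0 < t\<close> mult_nonpos_nonneg[of "G' r" t] by simp
  qed simp
  then have "A + K * (F t - F 0) \<le> A * exp (K * t)"
    by (simp add: G_def exp_minus field_simps)
  then show ?thesis using bound[OF t] by (simp add: A_def)
qed

section \<open>The energy inequality\<close>

lemma wD_cong_AE:
  assumes "u \<in> Hs (Suc m) {a<..<b}" "AE y in lebesgue_on {a<..<b}. u y = u' y" "u' \<in> L2 {a<..<b}"
  shows "AE y in lebesgue_on {a<..<b}. wD {a<..<b} u y = wD {a<..<b} u' y"
proof -
  note w = Hs_Suc_wD[OF assms(1)]
  have "has_weak_deriv {a<..<b} u' (wD {a<..<b} u)"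
    by (rule has_weak_deriv_cong_AE[OF w(2) assms(2) Hs_L2[OF assms(1)] assms(3)])
  from wD_works(3)[OF Hs_L2[OF w(1)] this] show ?thesis by eventually_elim simp
qed

lemma Sh_diff_wD:
  assumes "W \<in> Sh k n x" "Z \<in> Sh k n x" "is_partition n x"
  shows "AE y in lebesgue_on Om. wD Om (\<lambda>y. W y - Z y) y = wD Om W y - wD Om Z y"
  by (rule Sh_wD_eqI[OF Sh_diff[OF assms(1,2)] assms(3) ac_diff[OF Sh_ac[OF assms(1,3)] Sh_ac[OF assms(2,3)]] refl])

text \<open>The coefficient functional b is a parameter so that one expansion serves both the
  L2-orthonormal and the derivative-orthonormal basis.\<close>

lemma ip_basis_expansion:
  assumes \<phi>: "\<And>i. i < m \<Longrightarrow> \<phi> i \<in> Sh k n x"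
    and span: "\<And>W y. W \<in> Sh k n x \<Longrightarrow> y \<in> {0..1} \<Longrightarrow> W y = (\<Sum>i<m. b W i * \<phi> i y)"
    and W: "W \<in> Sh k n x" and part: "is_partition n x" and f: "f \<in> L2 Om"
  shows "ip Om f W = (\<Sum>i<m. b W i * ip Om f (\<phi> i))"
    "ip Om f (wD Om W) = (\<Sum>i<m. b W i * ip Om f (wD Om (\<phi> i)))"
proof -
  have L: "(\<lambda>y. b W i * \<phi> i y) \<in> L2 Om" "(\<lambda>y. b W i * wD Om (\<phi> i) y) \<in> L2 Om" if "i < m" for i
    using Sh_L2[OF \<phi>[OF that]] Sh_wD_L2[OF \<phi>[OF that] part] by (auto intro: L2_scale)
  have "ip Om f W = ip Om f (\<lambda>y. \<Sum>i<m. b W i * \<phi> i y)"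
    by (rule ip_cong) (use span[OF W] in auto)
  also have "\<dots> = (\<Sum>i<m. b W i * ip Om f (\<phi> i))"
    using ip_sum_right[of "{..<m}" "\<lambda>i y. b W i * \<phi> i y" Om f] L(1) f by (simp add: ip_scale_right)
  finally show "ip Om f W = (\<Sum>i<m. b W i * ip Om f (\<phi> i))" .
  have a: "ac 0 1 (\<lambda>y. \<Sum>i<m. b W i * \<phi> i y) (\<lambda>y. \<Sum>i<m. b W i * wD Om (\<phi> i) y)"
    by (intro ac_sum ac_scale Sh_ac[OF \<phi> part]) simp
  have "ip Om f (wD Om W) = ip Om f (\<lambda>y. \<Sum>i<m. b W i * wD Om (\<phi> i) y)"
    by (rule ip_cong_AE[OF _ Sh_wD_eqI[OF W part a span[OF W]] f f Sh_wD_L2[OF W part] ac_L2_deriv[OF a]]) auto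
  also have "\<dots> = (\<Sum>i<m. b W i * ip Om f (wD Om (\<phi> i)))"
    using ip_sum_right[of "{..<m}" "\<lambda>i y. b W i * wD Om (\<phi> i) y" Om f] L(2) f by (simp add: ip_scale_right)
  finally show "ip Om f (wD Om W) = (\<Sum>i<m. b W i * ip Om f (wD Om (\<phi> i)))" .
qed

text \<open>Time is frozen: \<open>Vt\<close>, z and \<open>Rz\<close> stand for the time
  derivatives of V, v and the projection, A and \<open>A'\<close> for the nonlocal coefficient at V
  and at v, \<beta> for \<open>b2\<close>, and p + q y for \<open>b1\<close>. With N the norm of
  \<theta>', the terms linear in N are collected into Q N and absorbed by the coercive term -\<mu>
  N^2.\<close>

lemma energy_inequality:
  assumes part: "is_partition n x"
    and c: "ac 0 1 c g" "AE y in lebesgue_on Om. v y = c y" "c 0 = 0" "c 1 = 0" and v: "v \<in> L2 Om"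
    and R: "R \<in> Sh k n x" and orth: "\<And>W. W \<in> Sh k n x \<Longrightarrow> ip Om g (wD Om W) = ip Om (wD Om R) (wD Om W)"
    and V: "V \<in> Sh k n x" and L: "Vt \<in> L2 Om" "z \<in> L2 Om" "Rz \<in> L2 Om"
    and eq: "\<And>W. W \<in> Sh k n x \<Longrightarrow>
      ip Om Vt W + A * \<beta> * ip Om (wD Om V) (wD Om W) - ip Om (\<lambda>y. (p + q * y) * wD Om V y) W
      = ip Om z W + A' * \<beta> * ip Om g (wD Om W) - ip Om (\<lambda>y. (p + q * y) * g y) W"
    and B: "\<And>y. y \<in> Om \<Longrightarrow> \<bar>p + q * y\<bar> \<le> B" "\<bar>q\<bar> \<le> B" "0 \<le> B"
    and \<mu>: "0 < \<mu>" "\<mu> \<le> A * \<beta>" and \<beta>: "0 \<le> \<beta>" "\<beta> \<le> \<beta>1"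
    and \<delta>: "\<bar>A - A'\<bar> \<le> \<delta>" and D: "L2norm Om g \<le> D"
  defines "\<theta> \<equiv> L2norm Om (\<lambda>y. V y - R y)" and "\<rho> \<equiv> L2norm Om (\<lambda>y. v y - R y)"
  shows "ip Om (\<lambda>y. Vt y - Rz y) (\<lambda>y. V y - R y)
    \<le> L2norm Om (\<lambda>y. z y - Rz y) * \<theta> + B * \<rho> * \<theta> + (\<beta>1 * \<delta> * D + B * \<theta> + B * \<rho>)\<^sup>2 / (4 * \<mu>)"
proof -
  let ?t = "\<lambda>y. V y - R y" and ?t' = "\<lambda>y. wD Om V y - wD Om R y" and ?b = "\<lambda>y. p + q * y"
  let ?r = "\<lambda>y. c y - R y" and ?r' = "\<lambda>y. g y - wD Om R y"
  define N where "N = L2norm Om ?t'"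
  note V' = Sh_wD_L2[OF V part] and R' = Sh_wD_L2[OF R part] and g = ac_L2_deriv[OF c(1)]
  have t: "?t \<in> Sh k n x" by (rule Sh_diff[OF V R])
  note tL = Sh_L2[OF t]
  have t'L: "?t' \<in> L2 Om" by (rule L2_diff[OF V' R'])
  have ta: "ac 0 1 ?t ?t'" by (rule ac_diff[OF Sh_ac[OF V part] Sh_ac[OF R part]])
  have ra: "ac 0 1 ?r ?r'" by (rule ac_diff[OF c(1) Sh_ac[OF R part]])
  have rL: "?r \<in> L2 Om" by (rule ac_L2[OF ra])
  have r'L: "?r' \<in> L2 Om" by (rule ac_L2_deriv[OF ra])
  have \<rho>: "L2norm Om ?r = \<rho>"
    unfolding \<rho>_def
  proof (rule L2norm_cong_AE[OF _ rL])
    show "AE y in lebesgue_on Om. ?r y = v y - R y" using c(2) by eventually_elim simp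
  qed (intro L2_diff v Sh_L2[OF R])
  have repl: "ip Om f (wD Om ?t) = ip Om f ?t'" if "f \<in> L2 Om" for f
    by (rule ip_cong_AE[OF _ Sh_diff_wD[OF V R part] that that Sh_wD_L2[OF t part] t'L]) simp
  have bc: "continuous_on {0..1} ?b" by (intro continuous_intros)
  have bm: "?b \<in> borel_measurable (lebesgue_on Om)" by (rule continuous_measurable_open_interval[OF bc])
  have bL: "(\<lambda>y. ?b y * f y) \<in> L2 Om" if "f \<in> L2 Om" for f by (rule L2_mult_bounded_continuous[OF that bc])
  have bN: "L2norm Om (\<lambda>y. ?b y * f y) \<le> B * L2norm Om f" if "f \<in> L2 Om" for f
    by (rule L2norm_bounded_mult[OF that bm B(1,3)])
  \<comment> \<open>Orthogonality of the projection removes \<rho>' from the diffusion term: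
    (V',\<theta>') = (\<theta>',\<theta>') + (v',\<theta>').\<close>
  have gt: "ip Om g ?t' = ip Om (wD Om R) ?t'" using orth[OF t] repl[OF g] repl[OF R'] by simp
  have V't: "ip Om (wD Om V) ?t' = N\<^sup>2 + ip Om g ?t'"
    using ip_diff_left[OF V' R' t'L] gt by (simp add: N_def L2norm_square)
  \<comment> \<open>V' - v' = \<theta>' - \<rho>'. Integration by parts moves the derivative from
    \<rho> onto b\<theta>, giving b\<theta>' + q\<theta>; a direct estimate of \<rho>' would lose
    one power of h.\<close>
  have conv: "ip Om (\<lambda>y. ?b y * wD Om V y) ?t - ip Om (\<lambda>y. ?b y * g y) ?t
      = ip Om (\<lambda>y. ?b y * ?t' y) ?t + ip Om ?r (\<lambda>y. ?b y * ?t' y + ?t y * q)"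
  proof -
    have "ac 0 1 ?b (\<lambda>y. q)" by (rule ac_C1) (auto intro!: derivative_eq_intros)
    from ac_ibp[OF ra ac_mult[OF this ta zero_le_one] zero_le_one]
    have 1: "ip Om ?r (\<lambda>y. ?b y * ?t' y + ?t y * q) = - ip Om ?r' (\<lambda>y. ?b y * ?t y)"
      using c(3,4) Sh_boundary[OF R] by simp
    have 2: "ip Om ?r' (\<lambda>y. ?b y * ?t y) = ip Om (\<lambda>y. ?b y * ?r' y) ?t"
      by (simp add: ip_def mult_ac)
    have "ip Om (\<lambda>y. ?b y * wD Om V y - ?b y * g y) ?t = ip Om (\<lambda>y. ?b y * ?t' y - ?b y * ?r' y) ?t"
      by (rule ip_cong) (simp_all add: algebra_simps)
    then show ?thesis
      unfolding 1 2 using ip_diff_left[OF bL[OF V'] bL[OF g] tL] ip_diff_left[OF bL[OF t'L] bL[OF r'L] tL] by simp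
  qed
  have e: "ip Om Vt ?t - ip Om z ?t = (A' - A) * \<beta> * ip Om g ?t' - A * \<beta> * N\<^sup>2
      + ip Om (\<lambda>y. ?b y * ?t' y) ?t + ip Om ?r (\<lambda>y. ?b y * ?t' y + ?t y * q)"
    using eq[OF t] conv unfolding repl[OF V'] repl[OF g] V't by (simp add: algebra_simps)
  have split: "ip Om (\<lambda>y. Vt y - Rz y) ?t = (ip Om Vt ?t - ip Om z ?t) + ip Om (\<lambda>y. z y - Rz y) ?t"
    using ip_diff_left[OF L(1,3) tL] ip_diff_left[OF L(2,3) tL] by simp
  have N0: "0 \<le> N" and \<theta>0: "0 \<le> \<theta>" and \<rho>0: "0 \<le> \<rho>" by (simp_all add: N_def \<theta>_def \<rho>_def)
  \<comment> \<open>The coefficient difference multiplies the full derivative of v; its bound D is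
    how the norm of that derivative reaches the constant.\<close>
  have b1: "(A' - A) * \<beta> * ip Om g ?t' \<le> \<beta>1 * \<delta> * D * N"
  proof -
    have "(A' - A) * \<beta> * ip Om g ?t' \<le> \<bar>A - A'\<bar> * \<beta> * \<bar>ip Om g ?t'\<bar>"
      using abs_ge_self[of "(A' - A) * \<beta> * ip Om g ?t'"] \<beta>(1) by (simp add: abs_mult abs_minus_commute)
    also have "\<dots> \<le> \<delta> * \<beta>1 * (D * N)"
    proof (intro mult_mono)
      have "\<bar>ip Om g ?t'\<bar> \<le> L2norm Om g * N" unfolding N_def by (rule ip_Cauchy_Schwarz[OF g t'L])
      also have "\<dots> \<le> D * N" using D N0 by (rule mult_right_mono)
      finally show "\<bar>ip Om g ?t'\<bar> \<le> D * N" .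
    qed (use \<delta> \<beta> in \<open>auto intro!: mult_nonneg_nonneg\<close>)
    finally show ?thesis by (simp add: mult_ac)
  qed
  have b2: "ip Om (\<lambda>y. ?b y * ?t' y) ?t \<le> B * \<theta> * N"
  proof -
    have "ip Om (\<lambda>y. ?b y * ?t' y) ?t \<le> L2norm Om (\<lambda>y. ?b y * ?t' y) * \<theta>"
      unfolding \<theta>_def using ip_Cauchy_Schwarz[OF bL[OF t'L] tL] by linarith
    also have "\<dots> \<le> (B * N) * \<theta>" unfolding N_def by (rule mult_right_mono[OF bN[OF t'L] \<theta>0])
    finally show ?thesis by (simp add: mult_ac)
  qed
  have b3: "ip Om ?r (\<lambda>y. ?b y * ?t' y + ?t y * q) \<le> B * \<rho> * N + B * \<rho> * \<theta>"
  proof -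
    have tq: "(\<lambda>y. ?t y * q) \<in> L2 Om" using L2_scale[OF tL, of q] by (simp add: mult.commute)
    have "L2norm Om (\<lambda>y. ?t y * q) = \<bar>q\<bar> * \<theta>"
      using L2norm_scale[of Om q ?t] by (simp add: \<theta>_def mult.commute)
    also have "\<dots> \<le> B * \<theta>" by (rule mult_right_mono[OF B(2) \<theta>0])
    finally have "L2norm Om (\<lambda>y. ?b y * ?t' y + ?t y * q) \<le> B * N + B * \<theta>"
      using L2norm_triangle[OF bL[OF t'L] tq] bN[OF t'L] unfolding N_def by linarith
    then have "\<rho> * L2norm Om (\<lambda>y. ?b y * ?t' y + ?t y * q) \<le> \<rho> * (B * N + B * \<theta>)"
      using \<rho>0 by (rule mult_left_mono)
    then show ?thesis
      using ip_Cauchy_Schwarz[OF rL L2_add[OF bL[OF t'L] tq]] \<rho> by (simp add: algebra_simps)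
  qed
  have b4: "ip Om (\<lambda>y. z y - Rz y) ?t \<le> L2norm Om (\<lambda>y. z y - Rz y) * \<theta>"
    unfolding \<theta>_def using ip_Cauchy_Schwarz[OF L2_diff[OF L(2,3)] tL] by linarith
  have b5: "\<mu> * N\<^sup>2 \<le> A * \<beta> * N\<^sup>2" using \<mu>(2) by (rule mult_right_mono) simp
  let ?Q = "\<beta>1 * \<delta> * D + B * \<theta> + B * \<rho>"
  \<comment> \<open>Completing the square (Q - 2\<mu>N)^2 produces the denominator 4\<mu>.\<close>
  have young: "?Q * N - \<mu> * N\<^sup>2 \<le> ?Q\<^sup>2 / (4 * \<mu>)"
  proof -
    have "0 \<le> (?Q - 2 * \<mu> * N)\<^sup>2" by simp
    then have "4 * \<mu> * (?Q * N - \<mu> * N\<^sup>2) \<le> ?Q\<^sup>2" by (simp add: power2_eq_square algebra_simps)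
    then show ?thesis using \<mu>(1) by (simp add: pos_le_divide_eq mult.commute)
  qed
  have "?Q * N = \<beta>1 * \<delta> * D * N + B * \<theta> * N + B * \<rho> * N" by (simp add: algebra_simps)
  then show ?thesis
    using split e b1 b2 b3 b4 b5 young by linarith
qed

section \<open>Summation over the components of the system\<close>

lemma sum_square_le:
  fixes f :: "'n::finite \<Rightarrow> real"
  shows "(\<Sum>i\<in>UNIV. f i)\<^sup>2 \<le> real CARD('n) * (\<Sum>i\<in>UNIV. (f i)\<^sup>2)"
  using Cauchy_Schwarz_ineq_sum[of "\<lambda>_. 1" f UNIV] by simp

lemma sum_squares_le_square_sum:
  fixes f :: "'n::finite \<Rightarrow> real"
  assumes "\<And>i. 0 \<le> f i" shows "(\<Sum>i\<in>UNIV. (f i)\<^sup>2) \<le> (\<Sum>i\<in>UNIV. f i)\<^sup>2"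
proof -
  have "(\<Sum>i\<in>UNIV. (f i)\<^sup>2) \<le> (\<Sum>i\<in>UNIV. f i * (\<Sum>j\<in>UNIV. f j))"
    unfolding power2_eq_square
    by (intro sum_mono mult_left_mono member_le_sum assms) auto
  then show ?thesis by (simp add: power2_eq_square sum_distrib_right)
qed

text \<open>Each term is dominated by the sums \<Theta>, P, Z, and mixed products by squares. The
  three summands of \<kappa> come from r\<theta>, from \<rho>\<theta> and from the Young term, where
  ((G+B)(\<Theta>+P))^2 \<le> 2(G+B)^2(\<Theta>^2+P^2) meets the factor 2/(4\<mu>). One factor
  \<open>CARD('n)\<close> counts the components, the other turns \<Theta>^2 into a sum of
  squares.\<close>

lemma summed_energy_bound:
  fixes \<theta> \<rho> r \<xi> :: "'n::finite \<Rightarrow> real"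
  assumes nn: "\<And>i. 0 \<le> \<theta> i" "\<And>i. 0 \<le> \<rho> i" "\<And>i. 0 \<le> r i" and c: "0 \<le> B" "0 < \<mu>" "0 \<le> G"
    and \<xi>: "\<And>i. \<xi> i \<le> r i * \<theta> i + B * \<rho> i * \<theta> i
      + (G * (\<Sum>j\<in>UNIV. \<theta> j + \<rho> j) + B * \<theta> i + B * \<rho> i)\<^sup>2 / (4 * \<mu>)"
  defines "\<kappa> \<equiv> real CARD('n) * (1 + B + (G + B)\<^sup>2 / \<mu>)"
  shows "2 * (\<Sum>i\<in>UNIV. \<xi> i) \<le> \<kappa> * (real CARD('n) * (\<Sum>i\<in>UNIV. (\<theta> i)\<^sup>2)
      + (\<Sum>i\<in>UNIV. \<rho> i)\<^sup>2 + (\<Sum>i\<in>UNIV. r i)\<^sup>2)"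
proof -
  define \<Theta> P Z where "\<Theta> = (\<Sum>i\<in>UNIV. \<theta> i)" and "P = (\<Sum>i\<in>UNIV. \<rho> i)" and "Z = (\<Sum>i\<in>UNIV. r i)"
  have le: "\<theta> i \<le> \<Theta>" "\<rho> i \<le> P" "r i \<le> Z" for i
    unfolding \<Theta>_def P_def Z_def using nn by (auto intro!: member_le_sum)
  have pos: "0 \<le> \<Theta>" "0 \<le> P" "0 \<le> Z" using le nn order_trans by metis+
  have amgm: "a * b * 2 \<le> a\<^sup>2 + b\<^sup>2" for a b :: real using sum_squares_bound[of a b] by (simp add: mult_ac)
  have one: "2 * \<xi> i \<le> (1 + B + (G + B)\<^sup>2 / \<mu>) * (\<Theta>\<^sup>2 + P\<^sup>2 + Z\<^sup>2)" for i
  proof -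
    have "r i * \<theta> i \<le> Z * \<Theta>" using le nn pos by (intro mult_mono) auto
    then have 1: "2 * (r i * \<theta> i) \<le> \<Theta>\<^sup>2 + P\<^sup>2 + Z\<^sup>2"
      using amgm[of Z \<Theta>] zero_le_power2[of P] by linarith
    have "\<rho> i * \<theta> i \<le> P * \<Theta>" using le nn pos by (intro mult_mono) auto
    then have "2 * (\<rho> i * \<theta> i) \<le> \<Theta>\<^sup>2 + P\<^sup>2 + Z\<^sup>2"
      using amgm[of P \<Theta>] zero_le_power2[of Z] by linarith
    then have 2: "2 * (B * \<rho> i * \<theta> i) \<le> B * (\<Theta>\<^sup>2 + P\<^sup>2 + Z\<^sup>2)"
      using mult_left_mono[OF _ c(1)] by (fastforce simp: mult_ac)
    have "B * \<theta> i \<le> B * \<Theta>" "B * \<rho> i \<le> B * P" using le c by (auto intro: mult_left_mono)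
    moreover have "G * (\<Sum>j\<in>UNIV. \<theta> j + \<rho> j) = G * \<Theta> + G * P"
      by (simp add: sum.distrib \<Theta>_def P_def distrib_left)
    ultimately have "G * (\<Sum>j\<in>UNIV. \<theta> j + \<rho> j) + B * \<theta> i + B * \<rho> i \<le> (G + B) * (\<Theta> + P)"
      by (simp add: algebra_simps)
    moreover have "0 \<le> G * (\<Sum>j\<in>UNIV. \<theta> j + \<rho> j) + B * \<theta> i + B * \<rho> i"
      using nn c by (intro add_nonneg_nonneg mult_nonneg_nonneg sum_nonneg) auto
    ultimately have "(G * (\<Sum>j\<in>UNIV. \<theta> j + \<rho> j) + B * \<theta> i + B * \<rho> i)\<^sup>2 \<le> ((G + B) * (\<Theta> + P))\<^sup>2"
      by (rule power_mono)
    also have "\<dots> \<le> (G + B)\<^sup>2 * (2 * (\<Theta>\<^sup>2 + P\<^sup>2 + Z\<^sup>2))"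
      unfolding power_mult_distrib
    proof (rule mult_left_mono)
      have "(\<Theta> + P)\<^sup>2 \<le> 2 * \<Theta>\<^sup>2 + 2 * P\<^sup>2" using sum_squares_bound[of \<Theta> P] by (simp add: power2_sum)
      then show "(\<Theta> + P)\<^sup>2 \<le> 2 * (\<Theta>\<^sup>2 + P\<^sup>2 + Z\<^sup>2)"
        using zero_le_power2[of Z] unfolding distrib_left by linarith
    qed simp
    finally have "(G * (\<Sum>j\<in>UNIV. \<theta> j + \<rho> j) + B * \<theta> i + B * \<rho> i)\<^sup>2 / (4 * \<mu>)
        \<le> (G + B)\<^sup>2 * (2 * (\<Theta>\<^sup>2 + P\<^sup>2 + Z\<^sup>2)) / (4 * \<mu>)"
      using c(2) by (intro divide_right_mono) auto
    also have "\<dots> = (G + B)\<^sup>2 / \<mu> * (\<Theta>\<^sup>2 + P\<^sup>2 + Z\<^sup>2) / 2" using c(2) by (simp add: field_simps)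
    finally have 3: "2 * ((G * (\<Sum>j\<in>UNIV. \<theta> j + \<rho> j) + B * \<theta> i + B * \<rho> i)\<^sup>2 / (4 * \<mu>))
        \<le> (G + B)\<^sup>2 / \<mu> * (\<Theta>\<^sup>2 + P\<^sup>2 + Z\<^sup>2)" by simp
    have "(1 + B + (G + B)\<^sup>2 / \<mu>) * (\<Theta>\<^sup>2 + P\<^sup>2 + Z\<^sup>2) = (\<Theta>\<^sup>2 + P\<^sup>2 + Z\<^sup>2) + B * (\<Theta>\<^sup>2 + P\<^sup>2 + Z\<^sup>2)
        + (G + B)\<^sup>2 / \<mu> * (\<Theta>\<^sup>2 + P\<^sup>2 + Z\<^sup>2)" by (simp only: distrib_right mult_1)
    then show ?thesis using \<xi>[of i] 1 2 3 by linarith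
  qed
  have \<kappa>: "0 \<le> \<kappa>" unfolding \<kappa>_def using c by (intro mult_nonneg_nonneg add_nonneg_nonneg divide_nonneg_pos) auto
  have "2 * (\<Sum>i\<in>UNIV. \<xi> i) \<le> (\<Sum>i\<in>(UNIV::'n set). (1 + B + (G + B)\<^sup>2 / \<mu>) * (\<Theta>\<^sup>2 + P\<^sup>2 + Z\<^sup>2))"
    unfolding sum_distrib_left by (intro sum_mono one)
  also have "\<dots> = \<kappa> * (\<Theta>\<^sup>2 + P\<^sup>2 + Z\<^sup>2)" by (simp add: \<kappa>_def)
  also have "\<dots> \<le> \<kappa> * (real CARD('n) * (\<Sum>i\<in>UNIV. (\<theta> i)\<^sup>2) + P\<^sup>2 + Z\<^sup>2)"
    using sum_square_le[of \<theta>] \<kappa> unfolding \<Theta>_def by (intro mult_left_mono) auto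
  finally show ?thesis unfolding P_def Z_def .
qed

section \<open>Bounds at almost every time and at every time\<close>

lemma continuous_L2norm_diff:
  assumes u: "u \<in> H1_time T Om" and v: "v \<in> H1_time T Om"
  shows "continuous_on {0..T} (\<lambda>t. L2norm Om (\<lambda>y. u t y - v t y))"
  unfolding continuous_on_def
proof
  fix t assume t: "t \<in> {0..T}"
  let ?F = "\<lambda>t. L2norm Om (\<lambda>y. u t y - v t y)"
  let ?e = "\<lambda>s. L2norm Om (\<lambda>y. u s y - u t y) + L2norm Om (\<lambda>y. v s y - v t y)"
  have le: "norm (?F s - ?F t) \<le> ?e s" if s: "s \<in> {0..T}" for s
  proof -
    note us = H1_time_L2[OF u s] and vs = H1_time_L2[OF v s] and ut = H1_time_L2[OF u t] and vt = H1_time_L2[OF v t]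
    have "L2norm Om (\<lambda>y. (u s y - v s y) - (u t y - v t y)) = L2norm Om (\<lambda>y. (u s y - u t y) - (v s y - v t y))"
      by (rule L2norm_cong) simp
    also have "\<dots> \<le> ?e s"
      using L2norm_triangle_diff[OF L2_diff[OF us ut] L2_zero L2_diff[OF vs vt]]
      by (simp add: L2norm_uminus)
        (metis (mono_tags, lifting) L2norm_cong L2norm_minus_commute minus_diff_eq L2norm_uminus add_left_cancel)
    finally have "L2norm Om (\<lambda>y. (u s y - v s y) - (u t y - v t y)) \<le> ?e s" .
    then show ?thesis
      using L2norm_le_add_diff[OF L2_diff[OF us vs] L2_diff[OF ut vt]]
        L2norm_le_add_diff[OF L2_diff[OF ut vt] L2_diff[OF us vs]]
        L2norm_minus_commute[of Om "\<lambda>y. u s y - v s y" "\<lambda>y. u t y - v t y"] by simp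
  qed
  have "((\<lambda>s. ?F s - ?F t) \<longlongrightarrow> 0) (at t within {0..T})"
  proof (rule Lim_null_comparison)
    show "\<forall>\<^sub>F s in at t within {0..T}. norm (?F s - ?F t) \<le> ?e s"
      unfolding eventually_at_filter using le by (intro always_eventually) blast
    show "(?e \<longlongrightarrow> 0) (at t within {0..T})"
      using tendsto_add[OF H1_time_tendsto[OF u t] H1_time_tendsto[OF v t]] by simp
  qed
  then show "(?F \<longlongrightarrow> ?F t) (at t within {0..T})" by (simp add: LIM_zero_iff)
qed

text \<open>\<open>max (F t) M\<close> is continuous and equals M almost everywhere, hence
  everywhere.\<close>

lemma continuous_le_AE:
  fixes F :: "real \<Rightarrow> real"
  assumes "a < b" "continuous_on {a..b} F" "AE t in lebesgue_on {a<..<b}. F t \<le> M" "t \<in> {a..b}"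
  shows "F t \<le> M"
proof -
  have "max (F t) M = M"
  proof (rule continuous_AE_eq[OF assms(1) _ _ _ assms(4)])
    show "continuous_on {a..b} (\<lambda>t. max (F t) M)" by (intro continuous_intros assms(2))
    show "AE t in lebesgue_on {a<..<b}. max (F t) M = M" using assms(3) by eventually_elim simp
  qed simp
  then show ?thesis by simp
qed

text \<open>\<open>real_of_ereal\<close> returns 0 on infinite values, so the essential supremum
  must be finite on both sides. Above this is membership in the space; below it is nonnegativity,
  which holds because ]0,T[ has positive measure.\<close>

lemma Linf_time_AE:
  assumes u: "u \<in> Linf_time T X N" and N: "\<And>w. 0 \<le> N w" and T: "0 < T"
  shows "AE t in lebesgue_on {0<..<T}. u t \<in> X" "AE t in lebesgue_on {0<..<T}. N (u t) \<le> Linf_time_norm T N u"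
    "0 \<le> Linf_time_norm T N u"
proof -
  let ?M = "lebesgue_on {0<..<T}" and ?e = "esssup (lebesgue_on {0<..<T}) (\<lambda>t. ereal (N (u t)))"
  show "AE t in ?M. u t \<in> X"
    using u unfolding Linf_time_def strongly_measurable_def by (auto elim: eventually_mono)
  have fin: "?e < \<infinity>" using u by (simp add: Linf_time_def)
  have ae: "AE t in ?M. ereal (N (u t)) \<le> ?e" by (rule esssup_AE)
  have "emeasure ?M (space ?M) = ennreal T"
    using T by (simp add: emeasure_restrict_space)
  then have nb: "\<not> (AE t in ?M. False)" using T by (auto simp: eventually_False ae_filter_eq_bot_iff)
  have pos: "0 \<le> ?e"
  proof (rule ccontr)
    assume neg: "\<not> 0 \<le> ?e"
    from ae have "AE t in ?M. False"
    proof eventually_elim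
      case (elim t)
      have "0 \<le> ereal (N (u t))" using N by simp
      then show False using elim neg order_trans by blast
    qed
    then show False using nb by simp
  qed
  then show "0 \<le> Linf_time_norm T N u" by (simp add: Linf_time_norm_def real_of_ereal_pos)
  have "?e = ereal (Linf_time_norm T N u)"
    using fin pos by (cases ?e) (auto simp: Linf_time_norm_def)
  with ae show "AE t in ?M. N (u t) \<le> Linf_time_norm T N u" by simp
qed

section \<open>Error of the semidiscrete solution\<close>

text \<open>The test function \<theta>(t) depends on t, so the equation known for the basis at one
  good t has to be extended to all W; both sides are linear in W.\<close>

lemma Sh_identity_extends:
  assumes \<phi>: "\<And>i. i < m \<Longrightarrow> \<phi> i \<in> Sh k n x"
    and span: "\<And>W y. W \<in> Sh k n x \<Longrightarrow> y \<in> {0..1} \<Longrightarrow> W y = (\<Sum>i<m. ip Om W (\<phi> i) * \<phi> i y)"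
    and W: "W \<in> Sh k n x" and part: "is_partition n x"
    and L: "f1 \<in> L2 Om" "f2 \<in> L2 Om" "f3 \<in> L2 Om" "g1 \<in> L2 Om" "g2 \<in> L2 Om" "g3 \<in> L2 Om"
    and eq: "\<And>i. i < m \<Longrightarrow> ip Om f1 (\<phi> i) + A * ip Om f2 (wD Om (\<phi> i)) - ip Om f3 (\<phi> i)
      = ip Om g1 (\<phi> i) + A' * ip Om g2 (wD Om (\<phi> i)) - ip Om g3 (\<phi> i)"
  shows "ip Om f1 W + A * ip Om f2 (wD Om W) - ip Om f3 W = ip Om g1 W + A' * ip Om g2 (wD Om W) - ip Om g3 W"
proof -
  let ?b = "\<lambda>W i. ip Om W (\<phi> i)"
  have ex1: "ip Om f W = (\<Sum>i<m. ?b W i * ip Om f (\<phi> i))"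
    and ex2: "ip Om f (wD Om W) = (\<Sum>i<m. ?b W i * ip Om f (wD Om (\<phi> i)))" if "f \<in> L2 Om" for f
    by (rule ip_basis_expansion[where b = ?b, OF \<phi> span W part that]; assumption)+
  have expand: "ip Om f W + A * ip Om g (wD Om W) - ip Om h W
      = (\<Sum>i<m. ?b W i * (ip Om f (\<phi> i) + A * ip Om g (wD Om (\<phi> i)) - ip Om h (\<phi> i)))"
    if "f \<in> L2 Om" "g \<in> L2 Om" "h \<in> L2 Om" for f g h A
    unfolding ex1[OF that(1)] ex2[OF that(2)] ex1[OF that(3)]
    by (simp add: sum_distrib_left sum.distrib sum_subtractf algebra_simps)
  show ?thesis unfolding expand[OF L(1-3)] expand[OF L(4-6)] using eq by (intro sum.cong) auto
qed

lemma L2norm_sum_le: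
  assumes "finite I" "\<And>i. i \<in> I \<Longrightarrow> u i \<in> L2 S"
  shows "L2norm S (\<lambda>t. \<Sum>i\<in>I. u i t) \<le> (\<Sum>i\<in>I. L2norm S (u i))"
  using assms
proof (induction I rule: finite_induct)
  case (insert i I)
  have "L2norm S (\<lambda>t. u i t + (\<Sum>i\<in>I. u i t)) \<le> L2norm S (u i) + L2norm S (\<lambda>t. \<Sum>i\<in>I. u i t)"
    using insert.prems by (intro L2norm_triangle L2_sum) auto
  then show ?case using insert by fastforce
qed simp

lemma L2_time_norm_eq: "L2_time_norm T N u = L2norm {0<..<T} (\<lambda>t. N (u t))"
  by (simp add: L2_time_norm_def L2norm_def ip_def power2_eq_square)

text \<open>A Fourier sum for a basis orthonormal in the product of derivatives. The argument g is
  the derivative of the projected function, so the coefficients are pairings whose time dependence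
  \<open>H1_time_wD\<close> describes.\<close>

definition ritz :: "nat \<Rightarrow> (nat \<Rightarrow> real \<Rightarrow> real) \<Rightarrow> (real \<Rightarrow> real) \<Rightarrow> real \<Rightarrow> real" where
  "ritz m \<eta> g y = (\<Sum>j<m. ip Om g (wD Om (\<eta> j)) * \<eta> j y)"

lemma ritz_Sh: "(\<And>j. j < m \<Longrightarrow> \<eta> j \<in> Sh k n x) \<Longrightarrow> ritz m \<eta> g \<in> Sh k n x"
  unfolding ritz_def[abs_def] by (intro Sh_sum Sh_scale) simp

lemma ritz_orthogonal:
  assumes \<eta>: "\<And>j. j < m \<Longrightarrow> \<eta> j \<in> Sh k n x"
    and span: "\<And>W y. W \<in> Sh k n x \<Longrightarrow> y \<in> {0..1} \<Longrightarrow> W y = (\<Sum>i<m. ip Om (wD Om W) (wD Om (\<eta> i)) * \<eta> i y)"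
    and part: "is_partition n x" and g: "g \<in> L2 Om" and W: "W \<in> Sh k n x"
  shows "ip Om g (wD Om W) = ip Om (wD Om (ritz m \<eta> g)) (wD Om W)"
proof -
  note W' = Sh_wD_L2[OF W part]
  have a: "ac 0 1 (\<lambda>y. \<Sum>j<m. ip Om g (wD Om (\<eta> j)) * \<eta> j y) (\<lambda>y. \<Sum>j<m. ip Om g (wD Om (\<eta> j)) * wD Om (\<eta> j) y)"
    by (intro ac_sum ac_scale Sh_ac[OF \<eta> part]) simp
  have R: "ritz m \<eta> g \<in> Sh k n x" by (rule ritz_Sh[OF \<eta>])
  have "ip Om (wD Om (ritz m \<eta> g)) (wD Om W) = ip Om (\<lambda>y. \<Sum>j<m. ip Om g (wD Om (\<eta> j)) * wD Om (\<eta> j) y) (wD Om W)"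
    by (rule ip_cong_AE[OF Sh_wD_eqI[OF R part a ritz_def] _ Sh_wD_L2[OF R part] ac_L2_deriv[OF a] W' W']) simp
  also have "\<dots> = (\<Sum>j<m. ip Om g (wD Om (\<eta> j)) * ip Om (wD Om (\<eta> j)) (wD Om W))"
    using ip_sum_left[of "{..<m}" "\<lambda>j y. ip Om g (wD Om (\<eta> j)) * wD Om (\<eta> j) y" Om "wD Om W"]
      Sh_wD_L2[OF \<eta> part] W' by (simp add: L2_scale ip_scale_left)
  also have "\<dots> = ip Om g (wD Om W)"
    using ip_basis_expansion(2)[where b = "\<lambda>W i. ip Om (wD Om W) (wD Om (\<eta> i))", OF \<eta> span W part g]
    by (simp add: ip_commute[of Om "wD Om W"] mult.commute)
  finally show ?thesis by simp
qed

lemma ip_ritz: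
  assumes "\<And>j. j < m \<Longrightarrow> \<eta> j \<in> Sh k n x" "w \<in> L2 Om"
  shows "ip Om (ritz m \<eta> g) w = (\<Sum>j<m. ip Om g (wD Om (\<eta> j)) * ip Om (\<eta> j) w)"
  unfolding ritz_def[abs_def]
  using ip_sum_left[of "{..<m}" "\<lambda>j y. ip Om g (wD Om (\<eta> j)) * \<eta> j y" Om w] Sh_L2[OF assms(1)] assms(2)
  by (simp add: L2_scale ip_scale_left)

section \<open>Error bound for one fixed discretisation\<close>

locale fem_error =
  fixes T \<gamma>0 \<gamma>1 \<alpha>'max \<gamma>'max ma :: real and \<alpha> \<alpha>' \<gamma> \<gamma>' :: "real \<Rightarrow> real" and L :: "'n::finite \<Rightarrow> real"
    and a :: "'n \<Rightarrow> real ^ 'n \<Rightarrow> real" and f :: "'n \<Rightarrow> real \<Rightarrow> real \<Rightarrow> real"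
    and v0 :: "'n \<Rightarrow> real \<Rightarrow> real" and v V :: "'n \<Rightarrow> real \<Rightarrow> real \<Rightarrow> real"
    and k n :: nat and x :: "nat \<Rightarrow> real" and P :: "real set"
  assumes T: "0 < T" and \<gamma>0: "0 < \<gamma>0" and \<gamma>: "\<And>t. t \<in> {0..T} \<Longrightarrow> \<gamma>0 < \<gamma> t \<and> \<gamma> t < \<gamma>1"
    and \<gamma>': "\<And>t. t \<in> {0..T} \<Longrightarrow> \<bar>\<gamma>' t\<bar> \<le> \<gamma>'max" and \<alpha>': "\<And>t. t \<in> {0..T} \<Longrightarrow> \<bar>\<alpha>' t\<bar> \<le> \<alpha>'max"
    and ma: "0 < ma" and lip: "\<And>i. (L i)-lipschitz_on UNIV (a i)" and a_ge: "\<And>i s. ma \<le> a i s"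
    and weak: "weak_solution T \<alpha> \<alpha>' \<gamma> \<gamma>' a f v0 v"
    and k: "1 \<le> k" and part: "is_partition n x" and nodes: "lagrange_nodes k n x P"
    and semi: "semidiscrete_solution T \<alpha> \<alpha>' \<gamma> \<gamma>' a f v0 k n x P V"
    and v0_Hs: "\<And>i. v0 i \<in> Hs (Suc k) Om"
    and v_Linf: "\<And>i. v i \<in> Linf_time T (Hs (Suc k) Om) (Hnorm (Suc k) Om)"
    and wD_Linf: "\<And>i. (\<lambda>t. wD Om (v i t)) \<in> Linf_time T (L2 Om) (L2norm Om)"
    and v_L2: "\<And>i. v i \<in> L2_time T (Hs (Suc k) Om) (Hnorm (Suc k) Om)"
    and vt_L2: "\<And>i. Dt T Om (v i) \<in> L2_time T (Hs (Suc k) Om) (Hnorm (Suc k) Om)"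
begin

abbreviation "h \<equiv> mesh n x"
abbreviation "I \<equiv> {0<..<T}"

text \<open>\<open>bmax\<close> bounds \<open>b1\<close> and its slope in y, \<mu> bounds the
  diffusion factor from below, and \<open>lipmax\<close> is a Lipschitz constant of the nonlocal
  coefficients for the sum of the L2 norms, with \<gamma>1 from \<open>l\<close>. G multiplies the
  sum of all \<theta> + \<rho> in the Young term, where 1/\<gamma>0^2 bounds \<open>b2\<close>. None
  of them refers to the mesh, the nodes or V.\<close>

definition "bmax = (\<alpha>'max + \<gamma>'max) / \<gamma>0"
definition "\<mu> = ma / \<gamma>1\<^sup>2"
definition "lipmax = (\<Sum>i\<in>UNIV. \<bar>L i\<bar>) * \<gamma>1"
definition "D = (\<Sum>i\<in>UNIV. Linf_time_norm T (L2norm Om) (\<lambda>t. wD Om (v i t)))"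
definition "G = 1 / \<gamma>0\<^sup>2 * lipmax * D"
definition "\<kappa> = real CARD('n) * (1 + bmax + (G + bmax)\<^sup>2 / \<mu>)"

lemma h_pos: "0 < h" by (rule mesh_pos[OF part])

lemma v_H1: "v i \<in> H1_time T Om" and v_init: "AE y in lebesgue_on Om. v i 0 y = v0 i y"
  and v_eq: "variational_eq T \<alpha> \<alpha>' \<gamma> \<gamma>' a f (H10 Om) v"
  and v_Linf2: "v i \<in> Linf_time T (H10 Om \<inter> Hs 2 Om) (Hnorm 2 Om)"
  using weak unfolding weak_solution_def by blast+

lemma V_Sh: "t \<in> {0..T} \<Longrightarrow> V i t \<in> Sh k n x" and V_H1: "V i \<in> H1_time T Om"
  and V_init: "y \<in> {0..1} \<Longrightarrow> V i 0 y = Ih k n x P (v0 i) y"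
  and V_eq: "variational_eq T \<alpha> \<alpha>' \<gamma> \<gamma>' a f (Sh k n x) V"
  using semi unfolding semidiscrete_solution_def by blast+

lemma v_init_Hs: "v i 0 \<in> Hs (Suc k) Om"
proof (rule Hs_cong_AE[OF v0_Hs])
  show "AE y in lebesgue_on Om. v0 i y = v i 0 y" using v_init[of i] by eventually_elim simp
  show "v i 0 \<in> L2 Om" using T by (intro H1_time_L2[OF v_H1]) simp
qed

lemma v_AE: "AE t in lebesgue_on I. v i t \<in> H10 Om \<and> v i t \<in> Hs (Suc k) Om"
  using Linf_time_AE(1)[OF v_Linf2 Hnorm_nonneg T, of i] Linf_time_AE(1)[OF v_Linf Hnorm_nonneg T, of i]
  by eventually_elim blast

lemma bmax_nonneg: "0 \<le> bmax"
  unfolding bmax_def using \<gamma>0 abs_ge_zero[of "\<alpha>' 0"] abs_ge_zero[of "\<gamma>' 0"] \<alpha>'[of 0] \<gamma>'[of 0] T by simp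

lemma \<gamma>1_pos: "0 < \<gamma>1"
  using \<gamma>[of 0] \<gamma>0 T by simp

lemma \<mu>_pos: "0 < \<mu>"
  unfolding \<mu>_def using ma \<gamma>1_pos by simp

lemma D_nonneg: "0 \<le> D"
  unfolding D_def by (intro sum_nonneg Linf_time_AE(3)[OF wD_Linf L2norm_nonneg T])

lemma lipmax_nonneg: "0 \<le> lipmax"
  unfolding lipmax_def using \<gamma>1_pos by (intro mult_nonneg_nonneg sum_nonneg) auto

lemma G_nonneg: "0 \<le> G"
  unfolding G_def using D_nonneg lipmax_nonneg by simp

lemma \<kappa>_pos: "0 < \<kappa>"
  unfolding \<kappa>_def using bmax_nonneg \<mu>_pos by (intro mult_pos_pos add_pos_nonneg) auto

text \<open>Cauchy-Schwarz against 1 on an interval of length 1 bounds each difference of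
  \<open>l\<close> by \<gamma>1 times an L2 norm, and the Euclidean norm of a vector is at most its
  l1 norm.\<close>

lemma coefficient_difference:
  assumes t: "t \<in> {0..T}"
  shows "\<bar>a i (\<chi> j. l \<gamma> (V j) t) - a i (\<chi> j. l \<gamma> (v j) t)\<bar> \<le> lipmax * (\<Sum>j\<in>UNIV. L2norm Om (\<lambda>y. V j t y - v j t y))"
proof -
  let ?V = "\<chi> j. l \<gamma> (V j) t" and ?v = "\<chi> j. l \<gamma> (v j) t"
  have "\<bar>a i ?V - a i ?v\<bar> \<le> L i * dist ?V ?v"
    using lipschitz_onD[OF lip, of ?V ?v i] by (simp add: dist_real_def)
  also have "\<dots> \<le> (\<Sum>i\<in>UNIV. \<bar>L i\<bar>) * (\<gamma>1 * (\<Sum>j\<in>UNIV. L2norm Om (\<lambda>y. V j t y - v j t y)))"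
  proof (rule mult_mono)
    \<comment> \<open>Summing over all components gives a constant that does not depend on
      i.\<close>
    show "L i \<le> (\<Sum>i\<in>UNIV. \<bar>L i\<bar>)"
      using member_le_sum[of i UNIV "\<lambda>i. \<bar>L i\<bar>"] by simp
    have "dist ?V ?v \<le> (\<Sum>j\<in>UNIV. \<bar>(?V - ?v) $ j\<bar>)"
      unfolding dist_norm by (rule norm_le_l1_cart)
    also have "\<dots> \<le> (\<Sum>j\<in>UNIV. \<gamma>1 * L2norm Om (\<lambda>y. V j t y - v j t y))"
    proof (rule sum_mono)
      fix j
      note VL = H1_time_L2[OF V_H1 t, of j] and vL = H1_time_L2[OF v_H1 t, of j]
      have l: "l \<gamma> w t = \<gamma> t * ip Om (w t) (\<lambda>y. 1)" for w by (simp add: l_def ip_def)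
      have "(?V - ?v) $ j = \<gamma> t * ip Om (\<lambda>y. V j t y - v j t y) (\<lambda>y. 1)"
        using ip_diff_left[OF VL vL L2_const, of 1] by (simp add: l right_diff_distrib)
      then have "\<bar>(?V - ?v) $ j\<bar> = \<gamma> t * \<bar>ip Om (\<lambda>y. V j t y - v j t y) (\<lambda>y. 1)\<bar>"
        using \<gamma>[OF t] \<gamma>0 by (simp add: abs_mult)
      also have "\<dots> \<le> \<gamma>1 * L2norm Om (\<lambda>y. V j t y - v j t y)"
        using ip_Cauchy_Schwarz[OF L2_diff[OF VL vL] L2_const, of 1] \<gamma>[OF t] \<gamma>0
        by (intro mult_mono) (auto simp: L2norm_const)
      finally show "\<bar>(?V - ?v) $ j\<bar> \<le> \<gamma>1 * L2norm Om (\<lambda>y. V j t y - v j t y)" .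
    qed
    finally show "dist ?V ?v \<le> \<gamma>1 * (\<Sum>j\<in>UNIV. L2norm Om (\<lambda>y. V j t y - v j t y))"
      by (simp add: sum_distrib_left)
  qed (auto intro: sum_nonneg)
  finally show ?thesis by (simp add: lipmax_def mult.assoc)
qed

text \<open>Each component is fed to \<open>energy_inequality\<close>, the coefficient difference
  being bounded by \<open>lipmax\<close> times the sum of all \<theta> + \<rho>, with the triangle
  inequality through R splitting V - v.\<close>

lemma energy_step:
  assumes t: "t \<in> I" and R: "\<And>i. R i \<in> Sh k n x"
    and orth: "\<And>i W. W \<in> Sh k n x \<Longrightarrow> ip Om (wD Om (v i t)) (wD Om W) = ip Om (wD Om (R i)) (wD Om W)"
    and H10: "\<And>i. v i t \<in> H10 Om" and Rz: "\<And>i. Rz i \<in> L2 Om"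
    and zL: "\<And>i. Dt T Om (v i) t \<in> L2 Om" and VtL: "\<And>i. Dt T Om (V i) t \<in> L2 Om"
    and D_le: "\<And>i. L2norm Om (wD Om (v i t)) \<le> D"
    and eq: "\<And>i W. W \<in> Sh k n x \<Longrightarrow>
        ip Om (Dt T Om (V i) t) W + a i (\<chi> j. l \<gamma> (V j) t) * b2 \<gamma> t * ip Om (wD Om (V i t)) (wD Om W)
          - ip Om (\<lambda>y. b1 \<alpha>' \<gamma> \<gamma>' t y * wD Om (V i t) y) W
        = ip Om (Dt T Om (v i) t) W + a i (\<chi> j. l \<gamma> (v j) t) * b2 \<gamma> t * ip Om (wD Om (v i t)) (wD Om W)
          - ip Om (\<lambda>y. b1 \<alpha>' \<gamma> \<gamma>' t y * wD Om (v i t) y) W"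
  shows "2 * (\<Sum>i\<in>UNIV. ip Om (\<lambda>y. Dt T Om (V i) t y - Rz i y) (\<lambda>y. V i t y - R i y))
    \<le> \<kappa> * (real CARD('n) * (\<Sum>i\<in>UNIV. (L2norm Om (\<lambda>y. V i t y - R i y))\<^sup>2)
        + (\<Sum>i\<in>UNIV. L2norm Om (\<lambda>y. v i t y - R i y))\<^sup>2
        + (\<Sum>i\<in>UNIV. L2norm Om (\<lambda>y. Dt T Om (v i) t y - Rz i y))\<^sup>2)"
  unfolding \<kappa>_def
proof (rule summed_energy_bound[OF L2norm_nonneg L2norm_nonneg L2norm_nonneg bmax_nonneg \<mu>_pos G_nonneg])
  fix i
  have t': "t \<in> {0..T}" using t by simp
  have g: "\<gamma>0 < \<gamma> t" "\<gamma> t < \<gamma>1" "0 < \<gamma> t" using \<gamma>[OF t'] \<gamma>0 by auto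
  obtain c where c: "ac 0 1 c (wD Om (v i t))" "AE y in lebesgue_on Om. v i t y = c y" "c 0 = 0" "c 1 = 0"
    by (rule H10_rep[OF H10 zero_less_one])
  have b1: "b1 \<alpha>' \<gamma> \<gamma>' t = (\<lambda>y. \<alpha>' t / \<gamma> t + \<gamma>' t / \<gamma> t * y)"
    by (simp add: b1_def add_divide_distrib fun_eq_iff)
  have max0: "0 \<le> \<alpha>'max" "0 \<le> \<gamma>'max"
    using order_trans[OF abs_ge_zero \<alpha>'[OF t']] order_trans[OF abs_ge_zero \<gamma>'[OF t']] by auto
  have quot: "\<bar>r / \<gamma> t\<bar> \<le> s / \<gamma>0" if "\<bar>r\<bar> \<le> s" for r s
    using that g \<gamma>0 by (auto simp: abs_divide intro!: frac_le)
  have q: "\<bar>\<gamma>' t / \<gamma> t\<bar> \<le> \<gamma>'max / \<gamma>0" by (rule quot[OF \<gamma>'[OF t']])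
  let ?d = "\<lambda>i. L2norm Om (\<lambda>y. V i t y - R i y) + L2norm Om (\<lambda>y. v i t y - R i y)"
  let ?\<delta> = "lipmax * (\<Sum>j\<in>UNIV. ?d j)"
  have "ip Om (\<lambda>y. Dt T Om (V i) t y - Rz i y) (\<lambda>y. V i t y - R i y)
    \<le> L2norm Om (\<lambda>y. Dt T Om (v i) t y - Rz i y) * L2norm Om (\<lambda>y. V i t y - R i y)
      + bmax * L2norm Om (\<lambda>y. v i t y - R i y) * L2norm Om (\<lambda>y. V i t y - R i y)
      + (1 / \<gamma>0\<^sup>2 * ?\<delta> * D + bmax * L2norm Om (\<lambda>y. V i t y - R i y) + bmax * L2norm Om (\<lambda>y. v i t y - R i y))\<^sup>2
        / (4 * \<mu>)"
  proof (rule energy_inequality[OF part c H1_time_L2[OF v_H1 t'] R orth V_Sh[OF t'] VtL zL Rz eq[unfolded b1]])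
    fix y assume y: "y \<in> Om"
    have "\<bar>\<gamma>' t / \<gamma> t * y\<bar> \<le> \<gamma>'max / \<gamma>0 * 1"
      unfolding abs_mult using q y max0 \<gamma>0 by (intro mult_mono) auto
    then show "\<bar>\<alpha>' t / \<gamma> t + \<gamma>' t / \<gamma> t * y\<bar> \<le> bmax"
      using quot[OF \<alpha>'[OF t']] abs_triangle_ineq[of "\<alpha>' t / \<gamma> t" "\<gamma>' t / \<gamma> t * y"]
      unfolding bmax_def add_divide_distrib by linarith
  next
    have "0 \<le> \<alpha>'max / \<gamma>0" using max0 \<gamma>0 by simp
    then show "\<bar>\<gamma>' t / \<gamma> t\<bar> \<le> bmax" using q unfolding bmax_def add_divide_distrib by linarith
  next
    show "0 \<le> bmax" by (rule bmax_nonneg)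
    show "0 < \<mu>" by (rule \<mu>_pos)
    have "(\<gamma> t)\<^sup>2 \<le> \<gamma>1\<^sup>2" using g by (intro power_mono) auto
    then have "1 / \<gamma>1\<^sup>2 \<le> b2 \<gamma> t" unfolding b2_def using g by (intro divide_left_mono) auto
    then have "ma * (1 / \<gamma>1\<^sup>2) \<le> a i (\<chi> j. l \<gamma> (V j) t) * b2 \<gamma> t"
      using ma a_ge[of i] less_imp_le[OF less_le_trans[OF ma a_ge]] by (intro mult_mono) auto
    then show "\<mu> \<le> a i (\<chi> j. l \<gamma> (V j) t) * b2 \<gamma> t" by (simp add: \<mu>_def)
    show "0 \<le> b2 \<gamma> t" by (simp add: b2_def)
    have "\<gamma>0\<^sup>2 \<le> (\<gamma> t)\<^sup>2" using g \<gamma>0 by (intro power_mono) auto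
    then show "b2 \<gamma> t \<le> 1 / \<gamma>0\<^sup>2" unfolding b2_def using \<gamma>0 g by (intro divide_left_mono) auto
    show "L2norm Om (wD Om (v i t)) \<le> D" by (rule D_le)
    have "(\<Sum>j\<in>UNIV. L2norm Om (\<lambda>y. V j t y - v j t y)) \<le> (\<Sum>j\<in>UNIV. ?d j)"
    proof (rule sum_mono)
      fix j
      show "L2norm Om (\<lambda>y. V j t y - v j t y) \<le> ?d j"
        using L2norm_triangle_diff[OF H1_time_L2[OF V_H1 t'] Sh_L2[OF R] H1_time_L2[OF v_H1 t'], of j j j]
          L2norm_minus_commute[of Om "v j t" "R j"] by simp
    qed
    then show "\<bar>a i (\<chi> j. l \<gamma> (V j) t) - a i (\<chi> j. l \<gamma> (v j) t)\<bar> \<le> ?\<delta>"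
      using coefficient_difference[OF t', of i] mult_left_mono[OF _ lipmax_nonneg] by (meson order_trans)
  qed
  then show "ip Om (\<lambda>y. Dt T Om (V i) t y - Rz i y) (\<lambda>y. V i t y - R i y)
    \<le> L2norm Om (\<lambda>y. Dt T Om (v i) t y - Rz i y) * L2norm Om (\<lambda>y. V i t y - R i y)
      + bmax * L2norm Om (\<lambda>y. v i t y - R i y) * L2norm Om (\<lambda>y. V i t y - R i y)
      + (G * (\<Sum>j\<in>UNIV. ?d j) + bmax * L2norm Om (\<lambda>y. V i t y - R i y) + bmax * L2norm Om (\<lambda>y. v i t y - R i y))\<^sup>2
        / (4 * \<mu>)"
    by (simp add: G_def mult_ac)
qed

end

section \<open>The energy of the projected error and the final estimate\<close>

context fem_error
begin

text \<open>The root undoes the squares of the energy: 4 is the square of the 2 in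
  \<open>initial_error\<close>, \<kappa> multiplies the time integrals of the squared projection
  errors without their power of h, and the exponential is Gronwall's factor at rate \<kappa>
  \<open>CARD('n)\<close> over [0,T].\<close>

definition "errc = sqrt ((4 * (\<Sum>i\<in>UNIV. Hnorm (Suc k) Om (v0 i))\<^sup>2
    + \<kappa> * ((\<Sum>i\<in>UNIV. L2_time_norm T (Hnorm (Suc k) Om) (v i))\<^sup>2
      + (\<Sum>i\<in>UNIV. L2_time_norm T (Hnorm (Suc k) Om) (Dt T Om (v i)))\<^sup>2)) * exp (\<kappa> * real CARD('n) * T))"

context
  fixes N :: nat and \<eta> :: "nat \<Rightarrow> real \<Rightarrow> real"
  assumes \<eta>: "\<And>j. j < N \<Longrightarrow> \<eta> j \<in> Sh k n x"
    and \<eta>_span: "\<And>W y. W \<in> Sh k n x \<Longrightarrow> y \<in> {0..1} \<Longrightarrow>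
      W y = (\<Sum>i<N. ip Om (wD Om W) (wD Om (\<eta> i)) * \<eta> i y)"
begin

abbreviation "R u \<equiv> ritz N \<eta> (wD Om u)"

lemma R_Sh: "R u \<in> Sh k n x"
  by (rule ritz_Sh[OF \<eta>])

lemma R_orthogonal: "wD Om u \<in> L2 Om \<Longrightarrow> W \<in> Sh k n x \<Longrightarrow> ip Om (wD Om u) (wD Om W) = ip Om (wD Om (R u)) (wD Om W)"
  by (rule ritz_orthogonal[OF \<eta> \<eta>_span part])

lemma R_error:
  assumes u: "u \<in> Hs (Suc k) Om" and c: "ac 0 1 c (wD Om u)" "AE y in lebesgue_on Om. u y = c y" "c 0 = 0" "c 1 = 0"
  shows "L2norm Om (\<lambda>y. u y - R u y) \<le> h ^ (k + 1) * Hnorm (Suc k) Om u"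
proof -
  have "AE y in lebesgue_on Om. u y - R u y = c y - R u y" using c(2) by eventually_elim simp
  then have "L2norm Om (\<lambda>y. u y - R u y) = L2norm Om (\<lambda>y. c y - R u y)"
    by (rule L2norm_cong_AE[OF _ L2_diff[OF Hs_L2[OF u] Sh_L2[OF R_Sh]] L2_diff[OF ac_L2[OF c(1)] Sh_L2[OF R_Sh]]])
  also have "\<dots> \<le> h ^ (k + 1) * L2norm Om ((wD Om ^^ Suc k) u)"
    by (rule ritz_error[OF part nodes k u c R_Sh R_orthogonal[OF ac_L2_deriv[OF c(1)]]])
  also have "\<dots> \<le> h ^ (k + 1) * Hnorm (Suc k) Om u"
    using h_pos by (intro mult_left_mono L2norm_wD_le_Hnorm) auto
  finally show ?thesis .
qed

text \<open>The interpolant V(0) and the Ritz projection both approximate the same continuous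
  function c with constant 1, hence the 2. The function c represents v(0) and v0 alike; that it
  vanishes at 0 and 1 is taken from the evolution, by \<open>boundary_values_vanish\<close>.\<close>

lemma initial_error:
  "L2norm Om (\<lambda>y. V i 0 y - R (v i 0) y) \<le> 2 * h ^ (k + 1) * Hnorm (Suc k) Om (v0 i)"
proof -
  have T0: "0 \<in> {0..T}" using T by simp
  obtain c where c: "ac 0 1 c (wD Om (v i 0))" "AE y in lebesgue_on Om. v i 0 y = c y" "c 0 = 0" "c 1 = 0"
    using boundary_values_vanish(1)[OF v_H1 T vt_L2 v_init_Hs v_AE, of i] by blast
  have wD0: "AE y in lebesgue_on Om. wD Om (v i 0) y = wD Om (v0 i) y"
    by (rule wD_cong_AE[OF v_init_Hs v_init Hs_L2[OF v0_Hs]])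
  have w0: "wD Om (v0 i) \<in> L2 Om" by (rule Hs_wD_L2[OF v0_Hs])
  have c': "ac 0 1 c (wD Om (v0 i))" by (rule ac_cong_deriv[OF c(1) wD0 w0])
  have c'_AE: "AE y in lebesgue_on Om. v0 i y = c y"
    using v_init[of i] c(2) by eventually_elim simp
  have "\<exists>d. continuous_on {0..1} d \<and> (AE y in lebesgue_on Om. d y = v0 i y)"
    using c'_AE by (intro exI[of _ c] conjI ac_continuous[OF c']) (auto elim: eventually_mono)
  from someI_ex[OF this] have rep: "continuous_on {0..1} (cont_rep (v0 i))"
    "AE y in lebesgue_on Om. cont_rep (v0 i) y = v0 i y"
    unfolding cont_rep_def by blast+
  \<comment> \<open>Continuous representatives are unique, so the arbitrary choice in
    \<open>cont_rep\<close> is c on [0,1].\<close>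
  have cc: "cont_rep (v0 i) y = c y" if "y \<in> {0..1}" for y
  proof (rule continuous_AE_eq[OF zero_less_one rep(1) ac_continuous[OF c'] _ that])
    show "AE y in lebesgue_on Om. cont_rep (v0 i) y = c y"
      using rep(2) c'_AE by eventually_elim simp
  qed
  have nodal: "V i 0 q = c q" if "q \<in> P" for q
  proof -
    have q: "q \<in> {0..1}" using lagrange_nodesD(2)[OF nodes that] by simp
    show ?thesis
      using V_init[OF q, of i] lagrange_combination(2)[OF part nodes that, of "cont_rep (v0 i)"] cc[OF q]
      by (simp add: Ih_def)
  qed
  note VS = V_Sh[OF T0, of i]
  have e1: "L2norm Om (\<lambda>y. c y - V i 0 y) \<le> h ^ (k + 1) * L2norm Om ((wD Om ^^ Suc k) (v0 i))"
    by (rule interpolation_error(1)[OF part nodes k v0_Hs c' c'_AE c(3,4) VS nodal])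
  have e2: "L2norm Om (\<lambda>y. c y - R (v i 0) y) \<le> h ^ (k + 1) * L2norm Om ((wD Om ^^ Suc k) (v0 i))"
  proof (rule ritz_error[OF part nodes k v0_Hs c' c'_AE c(3,4) R_Sh])
    fix W assume W: "W \<in> Sh k n x"
    note W' = Sh_wD_L2[OF W part]
    have "ip Om (wD Om (v i 0)) (wD Om W) = ip Om (wD Om (v0 i)) (wD Om W)"
      by (rule ip_cong_AE[OF wD0 _ ac_L2_deriv[OF c(1)] w0 W' W']) simp
    then show "ip Om (wD Om (v0 i)) (wD Om W) = ip Om (wD Om (R (v i 0))) (wD Om W)"
      using R_orthogonal[OF ac_L2_deriv[OF c(1)] W] by simp
  qed
  have "L2norm Om (\<lambda>y. V i 0 y - R (v i 0) y)
      \<le> L2norm Om (\<lambda>y. c y - V i 0 y) + L2norm Om (\<lambda>y. c y - R (v i 0) y)"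
    using L2norm_triangle_diff[OF Sh_L2[OF VS] ac_L2[OF c'] Sh_L2[OF R_Sh]]
    by (simp add: L2norm_minus_commute[of Om "V i 0" c])
  also have "\<dots> \<le> 2 * (h ^ (k + 1) * L2norm Om ((wD Om ^^ Suc k) (v0 i)))" using e1 e2 by linarith
  also have "\<dots> \<le> 2 * (h ^ (k + 1) * Hnorm (Suc k) Om (v0 i))"
    using h_pos by (intro mult_left_mono L2norm_wD_le_Hnorm) auto
  finally show ?thesis by (simp only: mult.assoc)
qed

text \<open>The coefficients of \<open>V - R v\<close> in an \<open>L\<^sub>2\<close>-orthonormal basis of \<open>S\<^sub>h\<^sup>k\<close>, written so that they are
  absolutely continuous on \<open>[0,T]\<close>: \<open>R v\<close> itself only makes sense when \<open>v(\<cdot>,t) \<in> H\<^sup>1\<close>.\<close>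

definition "coef \<phi> i t = ip Om (V i t) \<phi> - (\<Sum>j<N. ip Om (\<eta> j) \<phi> *
    (ip Om (wD Om (v i 0)) (wD Om (\<eta> j)) + prim I (\<lambda>\<tau>. ip Om (wD Om (Dt T Om (v i) \<tau>)) (wD Om (\<eta> j))) t))"

definition "coef' \<phi> i t = ip Om (Dt T Om (V i) t) \<phi> - (\<Sum>j<N. ip Om (\<eta> j) \<phi> *
    ip Om (wD Om (Dt T Om (v i) t)) (wD Om (\<eta> j)))"

lemma coef_ac:
  assumes "\<phi> \<in> L2 Om" shows "ac 0 T (coef \<phi> i) (coef' \<phi> i)"
  unfolding coef_def[abs_def] coef'_def[abs_def]
proof (intro ac_diff H1_time_ac[OF V_H1 assms T] ac_sum ac_scale)
  fix j assume "j \<in> {..<N}"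
  then have "wD Om (\<eta> j) \<in> L2 Om" using Sh_wD_L2[OF \<eta> part] by simp
  from H1_time_wD(1)[OF v_H1 T vt_L2 this v_init_Hs]
  show "ac 0 T (\<lambda>t. ip Om (wD Om (v i 0)) (wD Om (\<eta> j)) + prim I (\<lambda>\<tau>. ip Om (wD Om (Dt T Om (v i) \<tau>)) (wD Om (\<eta> j))) t)
      (\<lambda>t. ip Om (wD Om (Dt T Om (v i) t)) (wD Om (\<eta> j)))"
    unfolding ac_def by simp
qed

lemma coef_eq:
  assumes \<phi>: "\<phi> \<in> L2 Om" and t: "t \<in> {0..T}" and vt: "v i t \<in> Hs (Suc k) Om"
  shows "coef \<phi> i t = ip Om (\<lambda>y. V i t y - R (v i t) y) \<phi>"
proof -
  have "coef \<phi> i t = ip Om (V i t) \<phi> - (\<Sum>j<N. ip Om (wD Om (v i t)) (wD Om (\<eta> j)) * ip Om (\<eta> j) \<phi>)"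
    unfolding coef_def
    by (intro arg_cong2[where f = minus] refl sum.cong)
       (simp add: H1_time_wD(2)[OF v_H1 T vt_L2 Sh_wD_L2[OF \<eta> part] v_init_Hs t vt])
  then show ?thesis
    using ip_diff_left[OF Sh_L2[OF V_Sh[OF t]] Sh_L2[OF R_Sh] \<phi>] ip_ritz[OF \<eta> \<phi>] by simp
qed

lemma coef'_eq:
  assumes "\<phi> \<in> L2 Om" "Dt T Om (V i) t \<in> L2 Om"
  shows "coef' \<phi> i t = ip Om (\<lambda>y. Dt T Om (V i) t y - R (Dt T Om (v i) t) y) \<phi>"
  unfolding coef'_def using ip_diff_left[OF assms(2) Sh_L2[OF R_Sh] assms(1)] ip_ritz[OF \<eta> assms(1)]
  by (simp add: mult.commute)

context
  fixes M :: nat and \<phi> :: "nat \<Rightarrow> real \<Rightarrow> real"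
  assumes \<phi>: "\<And>j. j < M \<Longrightarrow> \<phi> j \<in> Sh k n x"
    and \<phi>_span: "\<And>W y. W \<in> Sh k n x \<Longrightarrow> y \<in> {0..1} \<Longrightarrow> W y = (\<Sum>i<M. ip Om W (\<phi> i) * \<phi> i y)"
begin

text \<open>By Parseval this is the sum of the squared norms of V - R v at every t for which all
  v(t) lie in H^(k+1). In coefficients it is absolutely continuous on all of [0,T], which makes
  Gronwall's lemma applicable.\<close>

definition "energy t = (\<Sum>i\<in>UNIV. \<Sum>m<M. coef (\<phi> m) i t * coef (\<phi> m) i t)"
definition "energy' t = (\<Sum>i\<in>UNIV. \<Sum>m<M. coef (\<phi> m) i t * coef' (\<phi> m) i t + coef (\<phi> m) i t * coef' (\<phi> m) i t)"

lemma energy_ac: "ac 0 T energy energy'"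
  unfolding energy_def[abs_def] energy'_def[abs_def]
  using T by (intro ac_sum ac_mult coef_ac Sh_L2[OF \<phi>]) auto

text \<open>The time derivative of V is given only as an L2 function, so the expansion in the basis
  is applied to the other factor V - R v, which lies in \<open>Sh\<close>, and g may be any L2
  function.\<close>

lemma coef_product:
  assumes t: "t \<in> {0..T}" and vt: "v i t \<in> Hs (Suc k) Om" and g: "g \<in> L2 Om"
  shows "(\<Sum>m<M. coef (\<phi> m) i t * ip Om g (\<phi> m)) = ip Om g (\<lambda>y. V i t y - R (v i t) y)"
proof -
  have W: "(\<lambda>y. V i t y - R (v i t) y) \<in> Sh k n x" by (intro Sh_diff V_Sh[OF t] R_Sh)
  have "ip Om g (\<lambda>y. V i t y - R (v i t) y)
      = (\<Sum>m<M. ip Om (\<lambda>y. V i t y - R (v i t) y) (\<phi> m) * ip Om g (\<phi> m))"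
    by (rule ip_basis_expansion(1)[where b = "\<lambda>W i. ip Om W (\<phi> i)", OF \<phi> \<phi>_span W part g])
  then show ?thesis using coef_eq[OF Sh_L2[OF \<phi>] t vt] by simp
qed

lemma energy_eq:
  assumes t: "t \<in> {0..T}" and vt: "\<And>i. v i t \<in> Hs (Suc k) Om"
  shows "energy t = (\<Sum>i\<in>UNIV. (L2norm Om (\<lambda>y. V i t y - R (v i t) y))\<^sup>2)"
  unfolding energy_def
proof (rule sum.cong[OF refl])
  fix i
  have "(\<lambda>y. V i t y - R (v i t) y) \<in> L2 Om" by (rule Sh_L2[OF Sh_diff[OF V_Sh[OF t] R_Sh]])
  from coef_product[OF t vt this]
  show "(\<Sum>m<M. coef (\<phi> m) i t * coef (\<phi> m) i t) = (L2norm Om (\<lambda>y. V i t y - R (v i t) y))\<^sup>2"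
    using coef_eq[OF Sh_L2[OF \<phi>] t vt] by (simp add: L2norm_square)
qed

lemma energy'_eq:
  assumes t: "t \<in> {0..T}" and vt: "\<And>i. v i t \<in> Hs (Suc k) Om" and Vt: "\<And>i. Dt T Om (V i) t \<in> L2 Om"
  shows "energy' t = 2 * (\<Sum>i\<in>UNIV. ip Om (\<lambda>y. Dt T Om (V i) t y - R (Dt T Om (v i) t) y)
      (\<lambda>y. V i t y - R (v i t) y))"
  unfolding energy'_def sum_distrib_left
proof (rule sum.cong[OF refl])
  fix i
  have "(\<lambda>y. Dt T Om (V i) t y - R (Dt T Om (v i) t) y) \<in> L2 Om" by (intro L2_diff Vt Sh_L2[OF R_Sh])
  from coef_product[OF t vt this]
  show "(\<Sum>m<M. coef (\<phi> m) i t * coef' (\<phi> m) i t + coef (\<phi> m) i t * coef' (\<phi> m) i t)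
      = 2 * ip Om (\<lambda>y. Dt T Om (V i) t y - R (Dt T Om (v i) t) y) (\<lambda>y. V i t y - R (v i t) y)"
    using coef'_eq[OF Sh_L2[OF \<phi>] Vt] by (simp flip: sum_distrib_left)
qed

lemma D_AE: "AE t in lebesgue_on I. \<forall>i. L2norm Om (wD Om (v i t)) \<le> D"
  unfolding AE_all_countable
proof
  fix i
  have "Linf_time_norm T (L2norm Om) (\<lambda>t. wD Om (v i t)) \<le> D"
    unfolding D_def by (rule member_le_sum) (auto intro: Linf_time_AE(3)[OF wD_Linf L2norm_nonneg T])
  then show "AE t in lebesgue_on I. L2norm Om (wD Om (v i t)) \<le> D"
    using Linf_time_AE(2)[OF wD_Linf L2norm_nonneg T, of i] by (auto elim: eventually_mono)
qed

text \<open>The exceptional null set of \<^const>\<open>variational_eq\<close> may depend on the test function, so the equations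
  are first collected for the finitely many basis functions.\<close>

lemma basis_equations_AE:
  "AE t in lebesgue_on I. \<forall>i m. m < M \<longrightarrow>
     ip Om (Dt T Om (V i) t) (\<phi> m) + a i (\<chi> j. l \<gamma> (V j) t) * b2 \<gamma> t * ip Om (wD Om (V i t)) (wD Om (\<phi> m))
       - ip Om (\<lambda>y. b1 \<alpha>' \<gamma> \<gamma>' t y * wD Om (V i t) y) (\<phi> m)
     = ip Om (Dt T Om (v i) t) (\<phi> m) + a i (\<chi> j. l \<gamma> (v j) t) * b2 \<gamma> t * ip Om (wD Om (v i t)) (wD Om (\<phi> m))
       - ip Om (\<lambda>y. b1 \<alpha>' \<gamma> \<gamma>' t y * wD Om (v i t) y) (\<phi> m)"
  unfolding AE_all_countable
proof (intro allI)
  fix i m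
  show "AE t in lebesgue_on I. m < M \<longrightarrow>
     ip Om (Dt T Om (V i) t) (\<phi> m) + a i (\<chi> j. l \<gamma> (V j) t) * b2 \<gamma> t * ip Om (wD Om (V i t)) (wD Om (\<phi> m))
       - ip Om (\<lambda>y. b1 \<alpha>' \<gamma> \<gamma>' t y * wD Om (V i t) y) (\<phi> m)
     = ip Om (Dt T Om (v i) t) (\<phi> m) + a i (\<chi> j. l \<gamma> (v j) t) * b2 \<gamma> t * ip Om (wD Om (v i t)) (wD Om (\<phi> m))
       - ip Om (\<lambda>y. b1 \<alpha>' \<gamma> \<gamma>' t y * wD Om (v i t) y) (\<phi> m)"
  proof (cases "m < M")
    case True
    note eqs = bspec[OF spec[OF V_eq[unfolded variational_eq_def]] \<phi>[OF True], of i]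
      bspec[OF spec[OF v_eq[unfolded variational_eq_def]] Sh_H10[OF \<phi>[OF True] part], of i]
    show ?thesis using eqs by eventually_elim simp
  qed simp
qed

text \<open>The exceptional null sets are removed together. At a remaining t,
  \<open>energy_step\<close> applies, and the projection errors of v(t) and of its time derivative
  are at most h^(k+1) times their norms; the second relies on the boundary values of the time
  derivative.\<close>

lemma energy'_bound:
  defines "X \<equiv> \<lambda>t. \<Sum>i\<in>UNIV. Hnorm (Suc k) Om (v i t)" and "Y \<equiv> \<lambda>t. \<Sum>i\<in>UNIV. Hnorm (Suc k) Om (Dt T Om (v i) t)"
  shows "AE t in lebesgue_on I. energy' t
    \<le> \<kappa> * real CARD('n) * energy t + \<kappa> * (h ^ (k + 1))\<^sup>2 * ((X t)\<^sup>2 + (Y t)\<^sup>2)"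
proof -
  have A1: "AE t in lebesgue_on I. \<forall>i. v i t \<in> H10 Om \<and> v i t \<in> Hs (Suc k) Om"
    unfolding AE_all_countable using v_AE by blast
  have A2: "AE t in lebesgue_on I. \<forall>i. Dt T Om (v i) t \<in> Hs (Suc k) Om"
    unfolding AE_all_countable using L2_time_AE[OF vt_L2] by blast
  have A3: "AE t in lebesgue_on I. \<forall>i. \<exists>c. ac 0 1 c (wD Om (Dt T Om (v i) t)) \<and>
       (AE y in lebesgue_on Om. Dt T Om (v i) t y = c y) \<and> c 0 = 0 \<and> c 1 = 0"
    unfolding AE_all_countable using boundary_values_vanish(2)[OF v_H1 T vt_L2 v_init_Hs v_AE] by blast
  have A4: "AE t in lebesgue_on I. \<forall>i. Dt T Om (V i) t \<in> L2 Om"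
    unfolding AE_all_countable using L2_time_AE[OF Dt_works(1)[OF V_H1]] by blast
  have A5: "AE t in lebesgue_on I. t \<in> I" by (rule AE_I2) simp
  from A1 A2 A3 A4 A5 D_AE basis_equations_AE show ?thesis
  proof eventually_elim
    case (elim t)
    note vH = spec[OF elim(1)] and zH = spec[OF elim(2)] and zc = spec[OF elim(3)] and Vt = spec[OF elim(4)]
      and t = elim(5) and DD = spec[OF elim(6)] and eqs = elim(7)
    have t': "t \<in> {0..T}" using t by simp
    have v1: "v i t \<in> H10 Om" and v2: "v i t \<in> Hs (Suc k) Om" for i using vH by blast+
    have wv: "wD Om (v i t) \<in> L2 Om" for i by (rule Hs_wD_L2[OF v2])
    have bL: "(\<lambda>y. b1 \<alpha>' \<gamma> \<gamma>' t y * g y) \<in> L2 Om" if "g \<in> L2 Om" for g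
    proof (rule L2_mult_bounded_continuous[OF that])
      show "continuous_on {0..1} (b1 \<alpha>' \<gamma> \<gamma>' t)"
        unfolding b1_def[abs_def] divide_inverse by (intro continuous_intros)
    qed
    have \<rho>: "L2norm Om (\<lambda>y. v i t y - R (v i t) y) \<le> h ^ (k + 1) * Hnorm (Suc k) Om (v i t)" for i
    proof -
      obtain c where "ac 0 1 c (wD Om (v i t))" "AE y in lebesgue_on Om. v i t y = c y" "c 0 = 0" "c 1 = 0"
        by (rule H10_rep[OF v1 zero_less_one])
      then show ?thesis by (rule R_error[OF v2])
    qed
    have r: "L2norm Om (\<lambda>y. Dt T Om (v i) t y - R (Dt T Om (v i) t) y) \<le> h ^ (k + 1) * Hnorm (Suc k) Om (Dt T Om (v i) t)" for i
    proof -
      obtain c where "ac 0 1 c (wD Om (Dt T Om (v i) t))" "AE y in lebesgue_on Om. Dt T Om (v i) t y = c y"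
        "c 0 = 0" "c 1 = 0" using zc[of i] by blast
      then show ?thesis by (rule R_error[OF zH])
    qed
    have "energy' t \<le> \<kappa> * (real CARD('n) * (\<Sum>i\<in>UNIV. (L2norm Om (\<lambda>y. V i t y - R (v i t) y))\<^sup>2)
        + (\<Sum>i\<in>UNIV. L2norm Om (\<lambda>y. v i t y - R (v i t) y))\<^sup>2
        + (\<Sum>i\<in>UNIV. L2norm Om (\<lambda>y. Dt T Om (v i) t y - R (Dt T Om (v i) t) y))\<^sup>2)"
      unfolding energy'_eq[OF t' v2 Vt]
    proof (rule energy_step[OF t R_Sh R_orthogonal[OF wv] v1 Sh_L2[OF R_Sh] Hs_L2[OF zH] Vt DD])
      fix i W assume W: "W \<in> Sh k n x"
      show "ip Om (Dt T Om (V i) t) W + a i (\<chi> j. l \<gamma> (V j) t) * b2 \<gamma> t * ip Om (wD Om (V i t)) (wD Om W)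
          - ip Om (\<lambda>y. b1 \<alpha>' \<gamma> \<gamma>' t y * wD Om (V i t) y) W
        = ip Om (Dt T Om (v i) t) W + a i (\<chi> j. l \<gamma> (v j) t) * b2 \<gamma> t * ip Om (wD Om (v i t)) (wD Om W)
          - ip Om (\<lambda>y. b1 \<alpha>' \<gamma> \<gamma>' t y * wD Om (v i t) y) W"
        by (rule Sh_identity_extends[OF \<phi> \<phi>_span W part Vt Sh_wD_L2[OF V_Sh[OF t'] part]
              bL[OF Sh_wD_L2[OF V_Sh[OF t'] part]] Hs_L2[OF zH] wv bL[OF wv]]) (use eqs in blast)+
    qed
    also have "\<dots> \<le> \<kappa> * (real CARD('n) * energy t + (h ^ (k + 1) * X t)\<^sup>2 + (h ^ (k + 1) * Y t)\<^sup>2)"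
      unfolding energy_eq[OF t' v2] X_def Y_def sum_distrib_left[of "h ^ (k + 1)"]
      by (intro mult_left_mono add_mono power_mono sum_mono \<rho> r order_refl sum_nonneg L2norm_nonneg less_imp_le[OF \<kappa>_pos])
    finally show ?case by (simp add: power_mult_distrib algebra_simps)
  qed
qed

text \<open>Gronwall's lemma with initial energy from \<open>initial_error\<close> and the squared
  projection errors as source. Minkowski's inequality in time turns norms of sums over the
  components into sums of norms, the quantities on which C may depend.\<close>

lemma energy_bound:
  assumes t: "t \<in> {0..T}" shows "energy t \<le> (h ^ (k + 1) * errc)\<^sup>2"
proof -
  let ?H = "h ^ (k + 1)" and ?N = "Hnorm (Suc k) Om"
  let ?X = "\<lambda>t. \<Sum>i\<in>UNIV. ?N (v i t)" and ?Y = "\<lambda>t. \<Sum>i\<in>UNIV. ?N (Dt T Om (v i) t)"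
  define S0 Fv Fz where "S0 = (\<Sum>i\<in>UNIV. ?N (v0 i))" and "Fv = (\<Sum>i\<in>UNIV. L2_time_norm T ?N (v i))"
    and "Fz = (\<Sum>i\<in>UNIV. L2_time_norm T ?N (Dt T Om (v i)))"
  note vN = L2_time_norm_L2[OF v_L2 Hnorm_nonneg] and zN = L2_time_norm_L2[OF vt_L2 Hnorm_nonneg]
  have X: "?X \<in> L2 I" and Y: "?Y \<in> L2 I" by (intro L2_sum vN zN)+
  let ?s = "\<lambda>t. \<kappa> * ?H\<^sup>2 * ((?X t)\<^sup>2 + (?Y t)\<^sup>2)"
  have XY: "(L2norm I ?X)\<^sup>2 \<le> Fv\<^sup>2" "(L2norm I ?Y)\<^sup>2 \<le> Fz\<^sup>2"
    unfolding Fv_def Fz_def L2_time_norm_eq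
    by (intro power_mono L2norm_sum_le vN zN L2norm_nonneg finite)+
  have "(LINT t|lebesgue_on I. ?s t) = \<kappa> * ?H\<^sup>2 * ((L2norm I ?X)\<^sup>2 + (L2norm I ?Y)\<^sup>2)"
    using L2_square_integrable[OF X] L2_square_integrable[OF Y]
    by (simp add: L2norm_square ip_def flip: power2_eq_square)
  also have "\<dots> \<le> \<kappa> * ?H\<^sup>2 * (Fv\<^sup>2 + Fz\<^sup>2)"
    using XY \<kappa>_pos by (intro mult_left_mono add_mono) auto
  finally have s: "(LINT t|lebesgue_on I. ?s t) \<le> \<kappa> * ?H\<^sup>2 * (Fv\<^sup>2 + Fz\<^sup>2)" .
  \<comment> \<open>A single time is a null set, but t = 0 is known to be good: v(0) lies in H^(k+1)
    because v0 does.\<close>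
  have "energy 0 = (\<Sum>i\<in>UNIV. (L2norm Om (\<lambda>y. V i 0 y - R (v i 0) y))\<^sup>2)"
    using T by (intro energy_eq v_init_Hs) auto
  also have "\<dots> \<le> (\<Sum>i\<in>UNIV. (2 * ?H * ?N (v0 i))\<^sup>2)"
    by (intro sum_mono power_mono initial_error L2norm_nonneg)
  also have "\<dots> = 4 * ?H\<^sup>2 * (\<Sum>i\<in>UNIV. (?N (v0 i))\<^sup>2)"
    unfolding sum_distrib_left by (simp add: power_mult_distrib)
  also have "\<dots> \<le> 4 * ?H\<^sup>2 * S0\<^sup>2"
    unfolding S0_def by (intro mult_left_mono sum_squares_le_square_sum Hnorm_nonneg) auto
  finally have E0: "energy 0 \<le> 4 * ?H\<^sup>2 * S0\<^sup>2" .
  have "energy t \<le> (energy 0 + (LINT t|lebesgue_on I. ?s t)) * exp (\<kappa> * real CARD('n) * t)"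
  proof (rule Gronwall_ac[OF energy_ac T _ _ _ energy'_bound t])
    show "0 < \<kappa> * real CARD('n)" using \<kappa>_pos by simp
    show "integrable (lebesgue_on I) ?s"
      by (intro integrable_mult_right Bochner_Integration.integrable_add L2_square_integrable X Y)
    show "0 \<le> ?s t" for t using \<kappa>_pos by simp
  qed
  also have "\<dots> \<le> (4 * ?H\<^sup>2 * S0\<^sup>2 + \<kappa> * ?H\<^sup>2 * (Fv\<^sup>2 + Fz\<^sup>2)) * exp (\<kappa> * real CARD('n) * T)"
    using E0 s t \<kappa>_pos by (intro mult_mono add_mono) auto
  also have "\<dots> = ?H\<^sup>2 * ((4 * S0\<^sup>2 + \<kappa> * (Fv\<^sup>2 + Fz\<^sup>2)) * exp (\<kappa> * real CARD('n) * T))"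
    by (simp add: algebra_simps)
  also have "(4 * S0\<^sup>2 + \<kappa> * (Fv\<^sup>2 + Fz\<^sup>2)) * exp (\<kappa> * real CARD('n) * T) = errc\<^sup>2"
    unfolding errc_def S0_def Fv_def Fz_def using \<kappa>_pos by simp
  finally show ?thesis by (simp add: power_mult_distrib)
qed

lemma error_bound_AE:
  "AE t in lebesgue_on I. L2norm Om (\<lambda>y. V i t y - v i t y)
    \<le> (errc + (\<Sum>i\<in>UNIV. Linf_time_norm T (Hnorm (Suc k) Om) (v i))) * h ^ (k + 1)"
proof -
  have A1: "AE t in lebesgue_on I. \<forall>i. v i t \<in> H10 Om \<and> v i t \<in> Hs (Suc k) Om"
    unfolding AE_all_countable using v_AE by blast
  have A2: "AE t in lebesgue_on I. t \<in> I" by (rule AE_I2) simp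
  from A1 A2 Linf_time_AE(2)[OF v_Linf[of i] Hnorm_nonneg T] show ?thesis
  proof eventually_elim
    case (elim t)
    note vH = spec[OF elim(1)]
    have v1: "v i t \<in> H10 Om" and v2: "v i t \<in> Hs (Suc k) Om" for i using vH by blast+
    have t: "t \<in> {0..T}" using elim(2) by simp
    let ?\<theta> = "\<lambda>i. L2norm Om (\<lambda>y. V i t y - R (v i t) y)"
    have "(?\<theta> i)\<^sup>2 \<le> energy t"
      unfolding energy_eq[OF t v2] by (rule member_le_sum[of i UNIV "\<lambda>i. (?\<theta> i)\<^sup>2"]) auto
    also have "\<dots> \<le> (h ^ (k + 1) * errc)\<^sup>2" by (rule energy_bound[OF t])
    finally have \<theta>: "?\<theta> i \<le> h ^ (k + 1) * errc"
      by (rule power2_le_imp_le) (use h_pos \<kappa>_pos in \<open>simp add: errc_def\<close>)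
    obtain c where "ac 0 1 c (wD Om (v i t))" "AE y in lebesgue_on Om. v i t y = c y" "c 0 = 0" "c 1 = 0"
      by (rule H10_rep[OF v1 zero_less_one])
    then have "L2norm Om (\<lambda>y. v i t y - R (v i t) y) \<le> h ^ (k + 1) * Hnorm (Suc k) Om (v i t)"
      by (rule R_error[OF v2])
    also have "\<dots> \<le> h ^ (k + 1) * (\<Sum>i\<in>UNIV. Linf_time_norm T (Hnorm (Suc k) Om) (v i))"
    proof (rule mult_left_mono)
      have "Linf_time_norm T (Hnorm (Suc k) Om) (v i) \<le> (\<Sum>i\<in>UNIV. Linf_time_norm T (Hnorm (Suc k) Om) (v i))"
        by (rule member_le_sum) (auto intro: Linf_time_AE(3)[OF v_Linf Hnorm_nonneg T])
      then show "Hnorm (Suc k) Om (v i t) \<le> (\<Sum>i\<in>UNIV. Linf_time_norm T (Hnorm (Suc k) Om) (v i))"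
        using elim(3) by linarith
    qed (use h_pos in simp)
    finally have \<rho>: "L2norm Om (\<lambda>y. v i t y - R (v i t) y)
      \<le> h ^ (k + 1) * (\<Sum>i\<in>UNIV. Linf_time_norm T (Hnorm (Suc k) Om) (v i))" .
    have "L2norm Om (\<lambda>y. V i t y - v i t y) \<le> ?\<theta> i + L2norm Om (\<lambda>y. v i t y - R (v i t) y)"
      using L2norm_triangle_diff[OF H1_time_L2[OF V_H1[of i] t] Sh_L2[OF R_Sh[of "v i t"]] H1_time_L2[OF v_H1[of i] t]]
        L2norm_minus_commute[of Om "v i t" "R (v i t)"] by simp
    then show ?case using \<theta> \<rho> by (simp add: algebra_simps)
  qed
qed

end

end

text \<open>\<open>error_bound_AE\<close> speaks of almost every t, where v(t) lies in H^(k+1). The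
  difference V - v is continuous in time with values in L2, so the bound passes to every t in
  [0,T].\<close>

lemma error_bound:
  assumes t: "t \<in> {0..T}"
  shows "L2norm Om (\<lambda>y. V i t y - v i t y)
    \<le> (errc + (\<Sum>i\<in>UNIV. Linf_time_norm T (Hnorm (Suc k) Om) (v i))) * h ^ (k + 1)"
proof (rule Sh_H1_orthonormal_basis[OF part nodes])
  fix N and \<eta> :: "nat \<Rightarrow> real \<Rightarrow> real"
  assume \<eta>: "\<And>i. i < N \<Longrightarrow> \<eta> i \<in> Sh k n x"
    "\<And>W y. W \<in> Sh k n x \<Longrightarrow> y \<in> {0..1} \<Longrightarrow> W y = (\<Sum>i<N. ip Om (wD Om W) (wD Om (\<eta> i)) * \<eta> i y)"
  show ?thesis
  proof (rule Sh_L2_orthonormal_basis[OF part nodes])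
    fix M and \<phi> :: "nat \<Rightarrow> real \<Rightarrow> real"
    assume \<phi>: "\<And>i. i < M \<Longrightarrow> \<phi> i \<in> Sh k n x"
      "\<And>W y. W \<in> Sh k n x \<Longrightarrow> y \<in> {0..1} \<Longrightarrow> W y = (\<Sum>i<M. ip Om W (\<phi> i) * \<phi> i y)"
    show ?thesis
      by (rule continuous_le_AE[OF T continuous_L2norm_diff[OF V_H1 v_H1] error_bound_AE[OF \<eta> \<phi>] t])
  qed
qed

end

theorem theorem5:
  fixes T \<gamma>0 \<gamma>1 \<alpha>'max \<gamma>'max ma Ma :: real
    and \<alpha> \<alpha>' \<alpha>'' \<beta> \<beta>' \<beta>'' \<gamma> \<gamma>' :: "real \<Rightarrow> real"
    and L :: "'n::finite \<Rightarrow> real"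
  assumes "T > 0"
    and "\<And>t. t \<in> {0..T} \<Longrightarrow> (\<alpha> has_real_derivative \<alpha>' t) (at t within {0..T})"
    and "\<And>t. t \<in> {0..T} \<Longrightarrow> (\<alpha>' has_real_derivative \<alpha>'' t) (at t within {0..T})"
    and "continuous_on {0..T} \<alpha>''"
    and "\<And>t. t \<in> {0..T} \<Longrightarrow> (\<beta> has_real_derivative \<beta>' t) (at t within {0..T})"
    and "\<And>t. t \<in> {0..T} \<Longrightarrow> (\<beta>' has_real_derivative \<beta>'' t) (at t within {0..T})"
    and "continuous_on {0..T} \<beta>''"
    and "\<alpha>' \<in> L2 {0<..<T}" and "\<beta>' \<in> L2 {0<..<T}"
    and "\<gamma> = (\<lambda>t. \<beta> t - \<alpha> t)" and "\<gamma>' = (\<lambda>t. \<beta>' t - \<alpha>' t)"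
    and "0 < \<gamma>0" and "\<And>t. t \<in> {0..T} \<Longrightarrow> \<gamma>0 < \<gamma> t \<and> \<gamma> t < \<gamma>1"
    and "\<And>t. t \<in> {0..T} \<Longrightarrow> \<bar>\<gamma>' t\<bar> \<le> \<gamma>'max"
    and "\<And>t. t \<in> {0..T} \<Longrightarrow> \<bar>\<alpha>' t\<bar> \<le> \<alpha>'max"
    and "0 < ma"
  shows "\<exists>C :: real \<Rightarrow> real \<Rightarrow> real \<Rightarrow> real \<Rightarrow> real \<Rightarrow> real.
    \<forall>(a :: 'n \<Rightarrow> real ^ 'n \<Rightarrow> real) (f :: 'n \<Rightarrow> real \<Rightarrow> real \<Rightarrow> real)
      (u0 :: 'n \<Rightarrow> real \<Rightarrow> real) (v0 :: 'n \<Rightarrow> real \<Rightarrow> real)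
      (v :: 'n \<Rightarrow> real \<Rightarrow> real \<Rightarrow> real) (V :: 'n \<Rightarrow> real \<Rightarrow> real \<Rightarrow> real)
      (k :: nat) (n :: nat) (x :: nat \<Rightarrow> real) (P :: real set).
      (\<forall>i. (L i)-lipschitz_on UNIV (a i)) \<longrightarrow>
      (\<forall>i s. ma \<le> a i s \<and> a i s \<le> Ma) \<longrightarrow>
      (\<forall>i. (\<lambda>(t, x). f i t x) \<in> L2 {(t, x). 0 < t \<and> t < T \<and> \<alpha> t < x \<and> x < \<beta> t}) \<longrightarrow>
      (\<forall>i. u0 i \<in> H10 {\<alpha> 0<..<\<beta> 0}) \<longrightarrow>
      v0 = (\<lambda>i y. u0 i (\<alpha> 0 + \<gamma> 0 * y)) \<longrightarrow>
      weak_solution T \<alpha> \<alpha>' \<gamma> \<gamma>' a f v0 v \<longrightarrow>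
      1 \<le> k \<longrightarrow> is_partition n x \<longrightarrow> lagrange_nodes k n x P \<longrightarrow>
      semidiscrete_solution T \<alpha> \<alpha>' \<gamma> \<gamma>' a f v0 k n x P V \<longrightarrow>
      (\<forall>i. v0 i \<in> Hs (k + 1) Om) \<longrightarrow>
      (\<forall>i. v i \<in> Linf_time T (Hs (k + 1) Om) (Hnorm (k + 1) Om)) \<longrightarrow>
      (\<forall>i. (\<lambda>t. wD Om (v i t)) \<in> Linf_time T (L2 Om) (L2norm Om)) \<longrightarrow>
      (\<forall>i. v i \<in> L2_time T (Hs (k + 1) Om) (Hnorm (k + 1) Om)) \<longrightarrow>
      (\<forall>i. Dt T Om (v i) \<in> L2_time T (Hs (k + 1) Om) (Hnorm (k + 1) Om)) \<longrightarrow>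
      (\<forall>t\<in>{0<..T}. \<forall>i.
         L2norm Om (\<lambda>y. V i t y - v i t y)
         \<le> C (\<Sum>i\<in>UNIV. Hnorm (k + 1) Om (v0 i))
             (\<Sum>i\<in>UNIV. Linf_time_norm T (Hnorm (k + 1) Om) (v i))
             (\<Sum>i\<in>UNIV. Linf_time_norm T (L2norm Om) (\<lambda>t. wD Om (v i t)))
             (\<Sum>i\<in>UNIV. L2_time_norm T (Hnorm (k + 1) Om) (v i))
             (\<Sum>i\<in>UNIV. L2_time_norm T (Hnorm (k + 1) Om) (Dt T Om (v i)))
           * mesh n x ^ (k + 1))"
proof -
  \<comment> \<open>K and C are \<kappa> and the final constant with the norms turned into
    arguments, because C has to be fixed before the coefficients, the data, k and the mesh. The
    summand \<open>Sv\<close> accounts for the projection error at the time considered.\<close>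
  define K where "K D = real CARD('n) * (1 + (\<alpha>'max + \<gamma>'max) / \<gamma>0
    + (1 / \<gamma>0\<^sup>2 * ((\<Sum>i\<in>UNIV. \<bar>L i\<bar>) * \<gamma>1) * D + (\<alpha>'max + \<gamma>'max) / \<gamma>0)\<^sup>2 / (ma / \<gamma>1\<^sup>2))" for D
  define C where "C S0 Sv D Fv Fz = sqrt ((4 * S0\<^sup>2 + K D * (Fv\<^sup>2 + Fz\<^sup>2)) * exp (K D * real CARD('n) * T)) + Sv"
    for S0 Sv D Fv Fz :: real
  show ?thesis
  proof (intro exI[of _ C] allI impI ballI)
    fix a :: "'n \<Rightarrow> real ^ 'n \<Rightarrow> real" and f u0 v0 v V k n x P t i
    assume H: "\<forall>i. (L i)-lipschitz_on UNIV (a i)" "\<forall>i s. ma \<le> a i s \<and> a i s \<le> Ma"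
      "weak_solution T \<alpha> \<alpha>' \<gamma> \<gamma>' a f v0 v" "1 \<le> k" "is_partition n x" "lagrange_nodes k n x P"
      "semidiscrete_solution T \<alpha> \<alpha>' \<gamma> \<gamma>' a f v0 k n x P V" "\<forall>i. v0 i \<in> Hs (k + 1) Om"
      "\<forall>i. v i \<in> Linf_time T (Hs (k + 1) Om) (Hnorm (k + 1) Om)"
      "\<forall>i. (\<lambda>t. wD Om (v i t)) \<in> Linf_time T (L2 Om) (L2norm Om)"
      "\<forall>i. v i \<in> L2_time T (Hs (k + 1) Om) (Hnorm (k + 1) Om)"
      "\<forall>i. Dt T Om (v i) \<in> L2_time T (Hs (k + 1) Om) (Hnorm (k + 1) Om)"
      and t: "t \<in> {0<..T}"
    interpret fem_error T \<gamma>0 \<gamma>1 \<alpha>'max \<gamma>'max ma \<alpha> \<alpha>' \<gamma> \<gamma>' L a f v0 v V k n x P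
      using assms(13-15) H
      by unfold_locales (simp_all only: assms(1,12,16) Suc_eq_plus1)
    have "t \<in> {0..T}" using t by simp
    from error_bound[OF this, of i]
    show "L2norm Om (\<lambda>y. V i t y - v i t y)
         \<le> C (\<Sum>i\<in>UNIV. Hnorm (k + 1) Om (v0 i))
             (\<Sum>i\<in>UNIV. Linf_time_norm T (Hnorm (k + 1) Om) (v i))
             (\<Sum>i\<in>UNIV. Linf_time_norm T (L2norm Om) (\<lambda>t. wD Om (v i t)))
             (\<Sum>i\<in>UNIV. L2_time_norm T (Hnorm (k + 1) Om) (v i))
             (\<Sum>i\<in>UNIV. L2_time_norm T (Hnorm (k + 1) Om) (Dt T Om (v i)))
           * mesh n x ^ (k + 1)"
      unfolding C_def K_def errc_def \<kappa>_def G_def D_def lipmax_def bmax_def \<mu>_def Suc_eq_plus1 .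
  qed
qed

end
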